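(* Assume (P) and let $\mathfrak K:\mathbb{R}^d\to[\kappa_0,\kappa_1]$ be Borel. For every $T>0$ there is $c>0$, depending only on $d$, $T$ and the structural parameters ($\Lambda,\kappa_0,\kappa_1,\alpha_h,C_h,h$, and $\beta_h,c_h$ in case (P2)), such that for all $t\in(0,T]$ and $x,x',y\in\mathbb{R}^d$, $\int_{\mathbb{R}^d}|\delta^{\mathfrak K}(t,x,y;z)|\,\nu(|z|)\,dz\le c\,t^{-1}\rho_t(y-x)$, and $\int_{\mathbb{R}^d}|\delta^{\mathfrak K}(t,x',y;z)-\delta^{\mathfrak K}(t,x,y;z)|\,\nu(|z|)\,dz\le c\Big(\tfrac{|x'-x|}{h^{-1}(1/t)}\wedge1\Big)t^{-1}\big(\rho_t(y-x')+\rho_t(y-x)\big)$.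
   Context: Let $d\in\mathbb{N}$ and let $\nu:[0,\infty)\to[0,\infty]$ be non-increasing with $\int_{\mathbb{R}^d}(1\wedge|x|^2)\nu(|x|)\,dx<\infty$. Let $J:\mathbb{R}^d\to[0,\infty]$ be Borel with $\Lambda^{-1}\nu(|x|)\le J(x)\le\Lambda\nu(|x|)$ for all $x$, for some $\Lambda\ge1$, and let $0<\kappa_0\le\kappa_1$. For $r>0$ let $h(r)=\int_{\mathbb{R}^d}\big(1\wedge \tfrac{|x|^2}{r^2}\big)\nu(|x|)\,dx$ and $K(r)=r^{-2}\int_{|x|<r}|x|^2\nu(|x|)\,dx$. (WLSC): there are $\alpha_h\in(0,2]$, $C_h\ge1$ with $h(r)\le C_h\lambda^{\alpha_h}h(\lambda r)$ for all $\lambda\le1$, $r\le1$. (WUSC): there are $\beta_h\in(0,2]$, $c_h\in(0,1]$ with $h(r)\ge c_h\lambda^{\beta_h}h(\lambda r)$ for all $\lambda\le1$, $r\le1$. Under WLSC, $h$ is continuous, strictly decreasing, $h(0^+)=\infty$, $h(\infty)=0$, and $h^{-1}$ denotes its inverse. Case (P1): WLSC holds with $1<\alpha_h\le2$. Case (P2): WLSC and WUSC hold with $0<\alpha_h\le\beta_h<1$. Case (P3): WLSC holds and $J(z)=J(-z)$ (and the functions $\mathfrak{K}$ considered satisfy $\mathfrak K(z)=\mathfrak K(-z)$). "(P)" means one of (P1), (P2), (P3). Bound function: $\rho_t(x)=[h^{-1}(1/t)]^{-d}\wedge \frac{tK(|x|)}{|x|^d}$. For Borel $\mathfrak K:\mathbb{R}^d\to[\kappa_0,\kappa_1]$,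 let $\psi^{\mathfrak K}(\xi)=-\int_{\mathbb{R}^d}(e^{i\langle\xi,z\rangle}-1-i\langle\xi,z\rangle\mathbf 1_{|z|<1})\mathfrak K(z)J(z)dz$ in case (P1), $\psi^{\mathfrak K}(\xi)=-\int(e^{i\langle\xi,z\rangle}-1)\mathfrak K(z)J(z)dz$ in case (P2), $\psi^{\mathfrak K}(\xi)=\int(1-\cos\langle\xi,z\rangle)\mathfrak K(z)J(z)dz$ in case (P3); the Lévy heat kernel is $p^{\mathfrak K}(t,x,y)=(2\pi)^{-d}\int_{\mathbb{R}^d}e^{-i\langle y-x,\xi\rangle}e^{-t\psi^{\mathfrak K}(\xi)}d\xi$. In case (P1), $\delta^{\mathfrak K}(t,x,y;z)=p^{\mathfrak K}(t,x+z,y)-p^{\mathfrak K}(t,x,y)-\mathbf 1_{|z|<1}\langle z,\nabla_xp^{\mathfrak K}(t,x,y)\rangle$; in case (P2), $\delta^{\mathfrak K}(t,x,y;z)=p^{\mathfrak K}(t,x+z,y)-p^{\mathfrak K}(t,x,y)$; in case (P3), $\delta^{\mathfrak K}(t,x,y;z)=\tfrac12\big(p^{\mathfrak K}(t,x+z,y)+p^{\mathfrak K}(t,x-z,y)-2p^{\mathfrak K}(t,x,y)\big)$. *)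

theory Defs
  imports "HOL-Analysis.Analysis"
begin

datatype pcase = P1 | P2 | P3

definition levy_profile :: "(real \<Rightarrow> ennreal) \<Rightarrow> 'a::euclidean_space itself \<Rightarrow> bool" where
  "levy_profile \<nu> _ \<longleftrightarrow>
     (\<forall>r s. 0 \<le> r \<longrightarrow> r \<le> s \<longrightarrow> \<nu> s \<le> \<nu> r) \<and>
     (\<integral>\<^sup>+ x. ennreal (min 1 ((norm (x::'a))\<^sup>2)) * \<nu> (norm x) \<partial>lborel) < \<infinity>"

text \<open>h(r) = \<integral> (1 \<and> |x|^2/r^2) \<nu>(|x|) dx  (finite under the integrability assumption).\<close>
definition hfun :: "(real \<Rightarrow> ennreal) \<Rightarrow> 'a::euclidean_space itself \<Rightarrow> real \<Rightarrow> real" where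
  "hfun \<nu> _ r = enn2real (\<integral>\<^sup>+ x. ennreal (min 1 ((norm (x::'a))\<^sup>2 / r\<^sup>2)) * \<nu> (norm x) \<partial>lborel)"

definition Kfun :: "(real \<Rightarrow> ennreal) \<Rightarrow> 'a::euclidean_space itself \<Rightarrow> real \<Rightarrow> real" where
  "Kfun \<nu> _ r = enn2real (\<integral>\<^sup>+ x \<in> ball (0::'a) r. ennreal ((norm x)\<^sup>2) * \<nu> (norm x) \<partial>lborel) / r\<^sup>2"

text \<open>Inverse of h on (0,\<infinity>) (h is a bijection of (0,\<infinity>) onto itself under WLSC).\<close>
definition hinv :: "(real \<Rightarrow> ennreal) \<Rightarrow> 'a::euclidean_space itself \<Rightarrow> real \<Rightarrow> real" where
  "hinv \<nu> A s = (THE r. 0 < r \<and> hfun \<nu> A r = s)"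

definition WLSC :: "(real \<Rightarrow> ennreal) \<Rightarrow> 'a::euclidean_space itself \<Rightarrow> real \<Rightarrow> real \<Rightarrow> bool" where
  "WLSC \<nu> A \<alpha> C \<longleftrightarrow> 0 < \<alpha> \<and> \<alpha> \<le> 2 \<and> 1 \<le> C \<and>
     (\<forall>l r. 0 < l \<longrightarrow> l \<le> 1 \<longrightarrow> 0 < r \<longrightarrow> r \<le> 1 \<longrightarrow>
        hfun \<nu> A r \<le> C * l powr \<alpha> * hfun \<nu> A (l * r))"

definition WUSC :: "(real \<Rightarrow> ennreal) \<Rightarrow> 'a::euclidean_space itself \<Rightarrow> real \<Rightarrow> real \<Rightarrow> bool" where
  "WUSC \<nu> A \<beta> c \<longleftrightarrow> 0 < \<beta> \<and> \<beta> \<le> 2 \<and> 0 < c \<and> c \<le> 1 \<and>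
     (\<forall>l r. 0 < l \<longrightarrow> l \<le> 1 \<longrightarrow> 0 < r \<longrightarrow> r \<le> 1 \<longrightarrow>
        c * l powr \<beta> * hfun \<nu> A (l * r) \<le> hfun \<nu> A r)"

text \<open>Bound function \<rho>_t(x); at x = 0 the second term is +\<infinity>.\<close>
definition rho :: "(real \<Rightarrow> ennreal) \<Rightarrow> real \<Rightarrow> 'a::euclidean_space \<Rightarrow> real" where
  "rho \<nu> t x =
     (if x = 0 then hinv \<nu> TYPE('a) (1/t) powr (- real DIM('a))
      else min (hinv \<nu> TYPE('a) (1/t) powr (- real DIM('a)))
               (t * Kfun \<nu> TYPE('a) (norm x) / norm x ^ DIM('a)))"

text \<open>Symbol \<psi>^K; J is ennreal-valued (finite off the origin), converted to real.\<close>
definition psi :: "pcase \<Rightarrow> ('a::euclidean_space \<Rightarrow> ennreal) \<Rightarrow> ('a \<Rightarrow> real) \<Rightarrow> 'a \<Rightarrow> complex" where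
  "psi P J K \<xi> =
     (case P of
        P1 \<Rightarrow> - (\<integral> z. (cis (\<xi> \<bullet> z) - 1 - \<i> * complex_of_real (\<xi> \<bullet> z) *
                         (if norm z < 1 then 1 else 0)) * complex_of_real (K z * enn2real (J z)) \<partial>lborel)
      | P2 \<Rightarrow> - (\<integral> z. (cis (\<xi> \<bullet> z) - 1) * complex_of_real (K z * enn2real (J z)) \<partial>lborel)
      | P3 \<Rightarrow> complex_of_real (\<integral> z. (1 - cos (\<xi> \<bullet> z)) * K z * enn2real (J z) \<partial>lborel))"

text \<open>Heat kernel p^K(t,x,y) = (2\<pi>)^{-d} \<integral> e^{-i<y-x,\<xi>>} e^{-t\<psi>(\<xi>)} d\<xi>
  (a real number; we take the real part of the complex integral).\<close>
definition heat :: "pcase \<Rightarrow> ('a::euclidean_space \<Rightarrow> ennreal) \<Rightarrow> ('a \<Rightarrow> real) \<Rightarrow> real \<Rightarrow> 'a \<Rightarrow> 'a \<Rightarrow> real" where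
  "heat P J K t x y =
     Re ((\<integral> \<xi>. cis (- ((y - x) \<bullet> \<xi>)) * exp (- complex_of_real t * psi P J K \<xi>) \<partial>lborel)
         / complex_of_real ((2 * pi) ^ DIM('a)))"

definition delta :: "pcase \<Rightarrow> ('a::euclidean_space \<Rightarrow> ennreal) \<Rightarrow> ('a \<Rightarrow> real) \<Rightarrow> real \<Rightarrow> 'a \<Rightarrow> 'a \<Rightarrow> 'a \<Rightarrow> real" where
  "delta P J K t x y z =
     (case P of
        P1 \<Rightarrow> heat P J K t (x + z) y - heat P J K t x y
               - (if norm z < 1 then frechet_derivative (\<lambda>w. heat P J K t w y) (at x) z else 0)
      | P2 \<Rightarrow> heat P J K t (x + z) y - heat P J K t x y
      | P3 \<Rightarrow> (heat P J K t (x + z) y + heat P J K t (x - z) y - 2 * heat P J K t x y) / 2)"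

end

theory Submission
  imports Defs "HOL-Complex_Analysis.Complex_Analysis"
begin

text \<open>
  The gradient-type estimates on the heat kernel are replaced by one estimate for Fourier integrals
  \<open>G m w = \<integral> cis (- (w \<bullet> \<xi>)) * m \<xi> * exp (- t \<psi>(\<xi>)) d\<xi>\<close> with an entire multiplier \<open>m\<close> of polynomial
  growth: \<open>\<bar>G m w\<bar> \<le> c \<rho>\<^sub>t(w)\<close> times the size of \<open>m\<close>. Put \<open>r = h\<^sup>-\<^sup>1(1/t)\<close> and cut the jumps at
  \<open>r\<close>. The symbol of the small jumps is entire, so shifting the contour by \<open>1/r\<close> in the direction
  \<open>- w/\<bar>w\<bar>\<close> gives a bound \<open>r\<^sup>-\<^sup>d exp (- \<bar>w\<bar>/r)\<close>, which \<open>\<rho>\<^sub>t\<close> dominates. The large jumps form a finite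
  measure; they are put back by expanding their exponential, where each convolution with the measure
  costs a factor \<open>c/t\<close> because \<open>\<integral>\<^bsub>\<bar>z\<bar> \<ge> r\<^esub> \<rho>\<^sub>t(w - z) \<nu>(\<bar>z\<bar>) dz \<le> c t\<^sup>-\<^sup>1 \<rho>\<^sub>t(w)\<close>. Taking for \<open>m\<close> the
  symbols of \<open>\<delta>\<close> (and \<open>\<delta>\<close> times \<open>exp (\<i> u \<bullet> \<xi>) - 1\<close>, \<open>u = x' - x\<close>) when \<open>\<bar>z\<bar> < r\<close>, and estimating the
  terms of \<open>\<delta>\<close> separately when \<open>\<bar>z\<bar> \<ge> r\<close>, gives both inequalities after integration in \<open>z\<close>.
\<close>

section \<open>The functions h and K\<close>

text \<open>The kernel as a whole admits no contour shift, because \<nu> has no exponential moments;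
  hence the cut at \<open>r\<close>. Below it, a shift of size at most \<open>2/r\<close> changes
  \<open>t\<close> times the exponent by O(1), as \<open>t\<close> times the second moment of these
  jumps is O(r^2). The exponential obtained may be replaced by \<rho>: s^2 K(s) increases and WLSC
  makes K comparable with h, so \<rho> decays no faster than the power d + 2. J and the coefficient
  have no regularity, so all smoothness in x comes from the multiplier, and its order of vanishing
  in z fixes the moment of \<nu> that is needed. Second order is free, since K(r) <= h(r). First
  order occurs for jumps between r and 1 in P1 and below r in P2, where \<alpha> > 1 and \<beta> < 1
  make dyadic sums converge. The symbol of \<delta> has degree at most 2 in \<xi> and the increment
  in x has degree 1; so decay of power d + 5 is extracted from the small-jump exponent, 3 more than
  is spent on integration. The scaling conditions concern radii up to 1, whereas the inverse of h at
  1/t grows with t. A bound R on it carries the dependence on T.\<close>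

lemma ball_borel [measurable]: "ball (a::'a::euclidean_space) r \<in> sets borel"
  by simp

text \<open>The assumption \<open>nz\<close> keeps h positive and invertible. A profile that
  vanishes on the open half-line is treated separately in the final theorem, where both integrals
  are then zero.\<close>

locale levy_measure =
  fixes \<nu> :: "real \<Rightarrow> ennreal" and ty :: "'a::euclidean_space itself"
  assumes prof: "levy_profile \<nu> ty"
    and nz: "\<exists>s>0. 0 < \<nu> s"
begin

abbreviation "h \<equiv> hfun \<nu> ty"
abbreviation "K \<equiv> Kfun \<nu> ty"

definition nuint :: "('a \<Rightarrow> real) \<Rightarrow> ennreal" where
  "nuint f = (\<integral>\<^sup>+ x. ennreal (f x) * \<nu> (norm x) \<partial>lborel)"

lemma nu_antimono: "0 \<le> r \<Longrightarrow> r \<le> s \<Longrightarrow> \<nu> s \<le> \<nu> r"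
  using prof by (auto simp: levy_profile_def)

text \<open>Nothing is known of \<nu> at negative arguments. Composed with \<open>max 0\<close> it
  is non-increasing on the whole line, so its superlevel sets are intervals.\<close>

lemma nu_measurable [measurable]: "(\<lambda>x::'a. \<nu> (norm x)) \<in> borel_measurable borel"
proof -
  have "(\<lambda>s::real. \<nu> (max 0 s)) \<in> borel_measurable borel"
  proof (rule borel_measurableI_greater)
    fix y
    have "is_interval {s::real. y < \<nu> (max 0 s)}"
      unfolding is_interval_1
    proof (intro ballI allI impI)
      fix a b x assume "a \<in> {s. y < \<nu> (max 0 s)}" "b \<in> {s. y < \<nu> (max 0 s)}" "a \<le> x \<and> x \<le> b"
      then have "y < \<nu> (max 0 b)" "\<nu> (max 0 b) \<le> \<nu> (max 0 x)"
        by (auto intro!: nu_antimono)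
      then show "x \<in> {s. y < \<nu> (max 0 s)}" by auto
    qed
    then show "{x \<in> space borel. y < \<nu> (max 0 x)} \<in> sets borel"
      using real_interval_borel_measurable by simp
  qed
  from measurable_compose[OF borel_measurable_norm this]
  show ?thesis by (simp add: max_def)
qed

lemma nuint_mono: "(\<And>x. f x \<le> g x) \<Longrightarrow> nuint f \<le> nuint g"
  unfolding nuint_def by (intro nn_integral_mono mult_right_mono ennreal_leI) auto

lemma nuint_add:
  assumes [measurable]: "f \<in> borel_measurable borel" "g \<in> borel_measurable borel"
    and "\<And>x. 0 \<le> f x" "\<And>x. 0 \<le> g x"
  shows "nuint (\<lambda>x. f x + g x) = nuint f + nuint g"
  unfolding nuint_def using assms(3,4)
  by (subst nn_integral_add[symmetric]) (auto intro!: nn_integral_cong simp: distrib_right ennreal_plus)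

lemma nuint_cmult:
  assumes [measurable]: "f \<in> borel_measurable borel" and "0 \<le> c" 
  shows "nuint (\<lambda>x. c * f x) = ennreal c * nuint f"
  unfolding nuint_def using assms(2)
  by (subst nn_integral_cmult[symmetric]) (auto intro!: nn_integral_cong simp: ennreal_mult' mult.assoc)

lemma nuint_min1: "nuint (\<lambda>x. min 1 ((norm x)\<^sup>2)) < \<infinity>"
  using prof by (auto simp: levy_profile_def nuint_def)

lemma nuint_finite:
  assumes "\<And>x. f x \<le> c * min 1 ((norm x)\<^sup>2)" "0 \<le> c"
  shows "nuint f < \<infinity>"
proof -
  have "nuint f \<le> nuint (\<lambda>x. c * min 1 ((norm x)\<^sup>2))" by (intro nuint_mono assms)
  also have "\<dots> = ennreal c * nuint (\<lambda>x. min 1 ((norm x)\<^sup>2))"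
    using assms(2) by (intro nuint_cmult) auto
  also have "\<dots> < \<infinity>" using nuint_min1 by (simp add: ennreal_mult_less_top)
  finally show ?thesis .
qed

lemma nuint_h:
  assumes "0 < r" shows "nuint (\<lambda>x. min 1 ((norm x)\<^sup>2 / r\<^sup>2)) = ennreal (h r)"
proof -
  have "nuint (\<lambda>x. min 1 ((norm x)\<^sup>2 / r\<^sup>2)) < \<infinity>"
  proof (rule nuint_finite)
    show "min 1 ((norm x)\<^sup>2 / r\<^sup>2) \<le> max 1 (1/r\<^sup>2) * min 1 ((norm x)\<^sup>2)" for x :: 'a
    proof (cases "norm x \<le> 1")
      case True
      then have "(norm x)\<^sup>2 \<le> 1" by (simp add: power_le_one)
      then have "max 1 (1/r\<^sup>2) * min 1 ((norm x)\<^sup>2) = max 1 (1/r\<^sup>2) * (norm x)\<^sup>2" by simp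
      also have "\<dots> \<ge> (1/r\<^sup>2) * (norm x)\<^sup>2" by (intro mult_right_mono) auto
      finally show ?thesis by (auto simp: min_def)
    next
      case False
      then have "1 \<le> (norm x)\<^sup>2" by (simp add: one_le_power)
      then show ?thesis by (auto simp: min_def max_def)
    qed
  qed auto
  then show ?thesis by (simp add: hfun_def nuint_def)
qed

lemma nuint_K:
  assumes "0 < r" 
  shows "nuint (\<lambda>x. indicator (ball 0 r) x * (norm x)\<^sup>2) = ennreal (r\<^sup>2 * K r)"
proof -
  have "nuint (\<lambda>x. indicator (ball 0 r) x * (norm x)\<^sup>2) < \<infinity>"
  proof (rule nuint_finite)
    show "indicator (ball 0 r) x * (norm x)\<^sup>2 \<le> max 1 (r\<^sup>2) * min 1 ((norm x)\<^sup>2)" for x :: 'a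
    proof (cases "norm x < r")
      case True
      then have "(norm x)\<^sup>2 \<le> r\<^sup>2" by (intro power_mono) auto
      moreover have "1 * (norm x)\<^sup>2 \<le> max 1 (r\<^sup>2) * (norm x)\<^sup>2" by (intro mult_right_mono) auto
      ultimately show ?thesis using True by (auto simp: min_def)
    qed auto
  qed auto
  moreover have "nuint (\<lambda>x. indicator (ball 0 r) x * (norm x)\<^sup>2) =
      (\<integral>\<^sup>+ x \<in> ball (0::'a) r. ennreal ((norm x)\<^sup>2) * \<nu> (norm x) \<partial>lborel)"
    unfolding nuint_def by (intro nn_integral_cong) (auto simp: indicator_def)
  ultimately show ?thesis using assms by (simp add: Kfun_def)
qed

lemma h_nonneg: "0 \<le> h r" by (simp add: hfun_def)
lemma K_nonneg: "0 \<le> K r" by (simp add: Kfun_def)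

lemma h_antimono: assumes "0 < r" "r \<le> s" shows "h s \<le> h r"
proof -
  have "nuint (\<lambda>x. min 1 ((norm x)\<^sup>2 / s\<^sup>2)) \<le> nuint (\<lambda>x. min 1 ((norm x)\<^sup>2 / r\<^sup>2))"
    using assms by (intro nuint_mono min.mono divide_left_mono power_mono) auto
  then show ?thesis using assms by (simp add: nuint_h h_nonneg)
qed

lemma h_ge: assumes "0 < r" "r \<le> s" shows "r\<^sup>2 * h r \<le> s\<^sup>2 * h s"
proof -
  have "nuint (\<lambda>x. r\<^sup>2 * min 1 ((norm x)\<^sup>2 / r\<^sup>2)) \<le> nuint (\<lambda>x. s\<^sup>2 * min 1 ((norm x)\<^sup>2 / s\<^sup>2))"
  proof (rule nuint_mono)
    fix x :: 'a
    have "r\<^sup>2 * min 1 ((norm x)\<^sup>2 / r\<^sup>2) = min (r\<^sup>2) ((norm x)\<^sup>2)"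
      "s\<^sup>2 * min 1 ((norm x)\<^sup>2 / s\<^sup>2) = min (s\<^sup>2) ((norm x)\<^sup>2)"
      using assms by (auto simp: min_def field_simps)
    moreover have "r\<^sup>2 \<le> s\<^sup>2" using assms by (intro power_mono) auto
    ultimately show "r\<^sup>2 * min 1 ((norm x)\<^sup>2 / r\<^sup>2) \<le> s\<^sup>2 * min 1 ((norm x)\<^sup>2 / s\<^sup>2)" by auto
  qed
  also have "nuint (\<lambda>x. r\<^sup>2 * min 1 ((norm x)\<^sup>2 / r\<^sup>2)) = ennreal (r\<^sup>2 * h r)"
    using assms by (subst nuint_cmult) (auto simp: nuint_h ennreal_mult')
  also have "nuint (\<lambda>x. s\<^sup>2 * min 1 ((norm x)\<^sup>2 / s\<^sup>2)) = ennreal (s\<^sup>2 * h s)"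
    using assms by (subst nuint_cmult) (auto simp: nuint_h ennreal_mult')
  finally show ?thesis by (simp add: h_nonneg)
qed

lemma K_ge: assumes "0 < r" "r \<le> s" shows "r\<^sup>2 * K r \<le> s\<^sup>2 * K s"
proof -
  have "nuint (\<lambda>x. indicator (ball 0 r) x * (norm x)\<^sup>2) \<le> nuint (\<lambda>x. indicator (ball 0 s) x * (norm x)\<^sup>2)"
    using assms by (intro nuint_mono mult_right_mono) (auto simp: indicator_def)
  then show ?thesis using assms by (simp add: nuint_K K_nonneg)
qed

lemma K_le_h: assumes "0 < r" shows "K r \<le> h r"
proof -
  have "nuint (\<lambda>x. indicator (ball 0 r) x * (norm x)\<^sup>2) \<le> nuint (\<lambda>x. r\<^sup>2 * min 1 ((norm x)\<^sup>2 / r\<^sup>2))"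
  proof (rule nuint_mono)
    fix x :: 'a
    have "norm x < r \<Longrightarrow> (norm x)\<^sup>2 \<le> r\<^sup>2" by (intro power_mono) auto
    then show "indicator (ball 0 r) x * (norm x)\<^sup>2 \<le> r\<^sup>2 * min 1 ((norm x)\<^sup>2 / r\<^sup>2)"
      using assms by (auto simp: indicator_def min_def field_simps)
  qed
  also have "\<dots> = ennreal (r\<^sup>2 * h r)"
    using assms by (subst nuint_cmult) (auto simp: nuint_h ennreal_mult')
  finally show ?thesis using assms by (simp add: nuint_K h_nonneg)
qed

text \<open>For |x| \<ge> r both truncated integrands equal 1, so shrinking the radius costs only
  the second moment inside the ball. With the scaling condition this becomes the converse of
  \<open>K_le_h\<close>.\<close>

lemma h_le_K: assumes "0 < r" "0 < l" "l \<le> 1" shows "h (l * r) \<le> h r + K r / l\<^sup>2"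
proof -
  have "nuint (\<lambda>x. min 1 ((norm x)\<^sup>2 / (l*r)\<^sup>2)) \<le>
    nuint (\<lambda>x. min 1 ((norm x)\<^sup>2 / r\<^sup>2) + 1 / (l*r)\<^sup>2 * (indicator (ball 0 r) x * (norm x)\<^sup>2))"
  proof (rule nuint_mono)
    fix x :: 'a
    show "min 1 ((norm x)\<^sup>2 / (l*r)\<^sup>2) \<le> min 1 ((norm x)\<^sup>2 / r\<^sup>2) + 1 / (l*r)\<^sup>2 * (indicator (ball 0 r) x * (norm x)\<^sup>2)"
    proof (cases "norm x < r")
      case False
      then have "r\<^sup>2 \<le> (norm x)\<^sup>2" using assms by (intro power_mono) auto
      then show ?thesis using False assms by simp
    next
      case True
      have "0 \<le> min 1 ((norm x)\<^sup>2 / r\<^sup>2)" by simp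
      moreover have "min 1 ((norm x)\<^sup>2 / (l*r)\<^sup>2) \<le> (norm x)\<^sup>2 / (l*r)\<^sup>2" by simp
      ultimately show ?thesis using True by (simp del: min.bounded_iff min_le_iff_disj)
    qed
  qed
  also have "\<dots> = nuint (\<lambda>x. min 1 ((norm x)\<^sup>2 / r\<^sup>2)) + ennreal (1 / (l*r)\<^sup>2) * nuint (\<lambda>x. indicator (ball 0 r) x * (norm x)\<^sup>2)"
  proof -
    have eq: "ennreal (1 / (l*r)\<^sup>2) * nuint (\<lambda>x. indicator (ball 0 r) x * (norm x)\<^sup>2)
       = nuint (\<lambda>x. 1 / (l*r)\<^sup>2 * (indicator (ball 0 r) x * (norm x)\<^sup>2))"
      by (rule nuint_cmult[symmetric]) auto
    show ?thesis unfolding eq by (rule nuint_add) auto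
  qed
  also have "\<dots> = ennreal (h r + K r / l\<^sup>2)"
    using assms by (simp add: nuint_h nuint_K ennreal_mult'[symmetric] ennreal_plus[symmetric] h_nonneg K_nonneg power_mult_distrib
      del: ennreal_plus)
  finally show ?thesis using assms by (simp add: nuint_h h_nonneg K_nonneg ennreal_plus[symmetric] del: ennreal_plus)
qed

text \<open>For |x| < r the two integrands differ by exactly (1/r^2 - 1/s^2) |x|^2. As K is
  positive, this is the source of strict monotonicity of h, hence of the uniqueness of its
  inverse.\<close>

lemma h_K_ge: assumes "0 < r" "r \<le> s" shows "h s + (1 - r\<^sup>2/s\<^sup>2) * K r \<le> h r"
proof -
  have rs: "r\<^sup>2 \<le> s\<^sup>2" using assms by (intro power_mono) auto
  have c: "0 \<le> 1/r\<^sup>2 - 1/s\<^sup>2" using assms rs by (simp add: frac_le)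
  have "nuint (\<lambda>x. min 1 ((norm x)\<^sup>2 / s\<^sup>2) + (1/r\<^sup>2 - 1/s\<^sup>2) * (indicator (ball 0 r) x * (norm x)\<^sup>2))
    \<le> nuint (\<lambda>x. min 1 ((norm x)\<^sup>2 / r\<^sup>2))"
  proof (rule nuint_mono)
    fix x :: 'a
    show "min 1 ((norm x)\<^sup>2 / s\<^sup>2) + (1/r\<^sup>2 - 1/s\<^sup>2) * (indicator (ball 0 r) x * (norm x)\<^sup>2) \<le> min 1 ((norm x)\<^sup>2 / r\<^sup>2)"
    proof (cases "norm x < r")
      case True
      then have "(norm x)\<^sup>2 \<le> r\<^sup>2" using assms by (intro power_mono) auto
      then have "min 1 ((norm x)\<^sup>2 / r\<^sup>2) = (norm x)\<^sup>2 / r\<^sup>2" using assms by simp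
      then show ?thesis using True by (simp add: algebra_simps)
    next
      case False
      then have "r\<^sup>2 \<le> (norm x)\<^sup>2" using assms by (intro power_mono) auto
      then show ?thesis using False assms by simp
    qed
  qed
  also have "nuint (\<lambda>x. min 1 ((norm x)\<^sup>2 / s\<^sup>2) + (1/r\<^sup>2 - 1/s\<^sup>2) * (indicator (ball 0 r) x * (norm x)\<^sup>2)) =
     nuint (\<lambda>x. min 1 ((norm x)\<^sup>2 / s\<^sup>2)) + ennreal (1/r\<^sup>2 - 1/s\<^sup>2) * nuint (\<lambda>x. indicator (ball 0 r) x * (norm x)\<^sup>2)"
  proof (subst nuint_add)
    show "(\<lambda>x::'a. (1/r\<^sup>2 - 1/s\<^sup>2) * (indicator (ball 0 r) x * (norm x)\<^sup>2)) \<in> borel_measurable borel"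
      by measurable
  qed (use c in \<open>auto simp: nuint_cmult\<close>)
  also have "\<dots> = ennreal (h s + (1/r\<^sup>2 - 1/s\<^sup>2) * (r\<^sup>2 * K r))"
    using assms c by (simp add: nuint_h nuint_K ennreal_mult'[symmetric] ennreal_plus[symmetric] h_nonneg K_nonneg del: ennreal_plus)
  also have "(1/r\<^sup>2 - 1/s\<^sup>2) * (r\<^sup>2 * K r) = (1 - r\<^sup>2/s\<^sup>2) * K r"
    using assms by (simp add: field_simps)
  finally show ?thesis using assms by (simp add: nuint_h h_nonneg)
qed

lemma K_pos: assumes "0 < r" shows "0 < K r"
proof -
  obtain s where s: "0 < s" "0 < \<nu> s" using nz by auto
  define u where "u = min r s"
  have u: "0 < u" using s assms by (auto simp: u_def)
  have "nuint (\<lambda>x. indicator (ball 0 u) x * (norm x)\<^sup>2) \<noteq> 0"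
  proof
    assume "nuint (\<lambda>x. indicator (ball 0 u) x * (norm x)\<^sup>2) = 0"
    then have "AE x::'a in lborel. ennreal (indicator (ball 0 u) x * (norm x)\<^sup>2) * \<nu> (norm x) = 0"
      unfolding nuint_def by (subst (asm) nn_integral_0_iff_AE) auto
    moreover have "AE x::'a in lborel. x \<noteq> 0" by (rule AE_lborel_singleton)
    ultimately have "AE x::'a in lborel. x \<notin> ball 0 u"
    proof eventually_elim
      case (elim x)
      have "0 < \<nu> (norm x)" if "norm x < u"
        using s(2) nu_antimono[of "norm x" s] that by (simp add: u_def)
      then show ?case using elim by (auto simp: indicator_def)
    qed
    then have "emeasure lborel (ball (0::'a) u) = 0"
      by (subst (asm) AE_iff_measurable[where N = "ball 0 u"]) auto
    then show False using u by (simp add: emeasure_ball unit_ball_vol_pos less_imp_neq[symmetric])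
  qed
  then have "0 < K u" using u K_nonneg[of u] by (cases "K u = 0") (auto simp: nuint_K)
  then have "0 < u\<^sup>2 * K u" using u by simp
  also have "\<dots> \<le> r\<^sup>2 * K r" using u by (intro K_ge) (auto simp: u_def)
  finally show ?thesis using assms by (simp add: zero_less_mult_iff)
qed

lemma h_pos: "0 < r \<Longrightarrow> 0 < h r" using K_pos K_le_h by fastforce

lemma h_strict: assumes "0 < r" "r < s" shows "h s < h r"
proof -
  have "r\<^sup>2 < s\<^sup>2" using assms by (intro power_strict_mono) auto
  then have "0 < (1 - r\<^sup>2/s\<^sup>2) * K r" using assms by (intro mult_pos_pos) (auto simp: K_pos)
  then show ?thesis using h_K_ge[of r s] assms by linarith
qed

text \<open>No limit theorem is needed: h decreases while s^2 h(s) increases, so h(s) / h(r) lies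
  between the minimum and the maximum of 1 and r^2 / s^2.\<close>

lemma h_continuous: "continuous_on {0<..} h"
proof -
  have "isCont h r" if r: "0 < r" for r
  proof -
    have lo: "h r * min 1 (r\<^sup>2 / s\<^sup>2) \<le> h s" if "0 < s" for s
    proof (cases "s \<le> r")
      case True then show ?thesis using that h_antimono[of s r] h_nonneg[of r]
        by (smt (verit) min.cobounded1 mult_left_le)
    next
      case False
      then have "h r * (r\<^sup>2 / s\<^sup>2) \<le> h s" using h_ge[of r s] that r by (simp add: field_simps)
      moreover have "h r * min 1 (r\<^sup>2 / s\<^sup>2) \<le> h r * (r\<^sup>2 / s\<^sup>2)" by (intro mult_left_mono) (auto simp: h_nonneg)
      ultimately show ?thesis by linarith
    qed
    have hi: "h s \<le> h r * max 1 (r\<^sup>2 / s\<^sup>2)" if "0 < s" for s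
    proof (cases "s \<le> r")
      case False then show ?thesis using that h_antimono[of r s] h_nonneg[of r] r
        by (smt (verit) max.cobounded1 mult_le_cancel_left1)
    next
      case True
      then have "h s \<le> h r * (r\<^sup>2 / s\<^sup>2)" using h_ge[of s r] that r by (simp add: field_simps)
      moreover have "h r * (r\<^sup>2 / s\<^sup>2) \<le> h r * max 1 (r\<^sup>2 / s\<^sup>2)" by (intro mult_left_mono) (auto simp: h_nonneg)
      ultimately show ?thesis by linarith
    qed
    have ev: "\<forall>\<^sub>F s in at r. 0 < s" using order_tendstoD(1)[OF tendsto_ident_at r] by simp
    have "((\<lambda>s. h r * min 1 (r\<^sup>2 / s\<^sup>2)) \<longlongrightarrow> h r * min 1 (r\<^sup>2/r\<^sup>2)) (at r)"
      using r by (intro tendsto_intros) auto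
    moreover have "((\<lambda>s. h r * max 1 (r\<^sup>2 / s\<^sup>2)) \<longlongrightarrow> h r * max 1 (r\<^sup>2/r\<^sup>2)) (at r)"
      using r by (intro tendsto_intros) auto
    ultimately show "isCont h r" unfolding isCont_def
      using r by (intro tendsto_sandwich[OF eventually_mono[OF ev lo] eventually_mono[OF ev hi]]) auto
  qed
  then show ?thesis by (simp add: continuous_on_eq_continuous_at)
qed

lemma h_at_top: "0 < e \<Longrightarrow> \<exists>r>0. h r < e"
proof -
  assume e: "0 < e"
  have "(\<lambda>n. \<integral>\<^sup>+ x. ennreal (min 1 ((norm (x::'a))\<^sup>2 / (real (Suc n))\<^sup>2)) * \<nu> (norm x) \<partial>lborel)
     \<longlonglongrightarrow> integral\<^sup>N lborel (\<lambda>x::'a. 0)"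
  proof (rule nn_integral_dominated_convergence[where w = "\<lambda>x::'a. ennreal (min 1 ((norm x)\<^sup>2)) * \<nu> (norm x)"])
    show "(\<integral>\<^sup>+ x. ennreal (min 1 ((norm (x::'a))\<^sup>2)) * \<nu> (norm x) \<partial>lborel) < \<infinity>"
      using prof by (auto simp: levy_profile_def)
    have "(norm x)\<^sup>2 / (1 + real j)\<^sup>2 \<le> (norm x)\<^sup>2 / 1" for x :: 'a and j
      by (intro divide_left_mono) (auto simp: one_le_power)
    then have "ennreal (min 1 ((norm x)\<^sup>2 / (real (Suc j))\<^sup>2)) * \<nu> (norm x) \<le> ennreal (min 1 ((norm x)\<^sup>2)) * \<nu> (norm x)" for x :: 'a and j
      by (intro mult_right_mono ennreal_leI min.mono) auto
    then show "AE x::'a in lborel. ennreal (min 1 ((norm x)\<^sup>2 / (real (Suc j))\<^sup>2)) * \<nu> (norm x) \<le> ennreal (min 1 ((norm x)\<^sup>2)) * \<nu> (norm x)" for j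
      by simp
    have "AE x::'a in lborel. ennreal (min 1 ((norm x)\<^sup>2)) * \<nu> (norm x) \<noteq> \<infinity>"
      using nuint_min1 unfolding nuint_def by (intro nn_integral_PInf_AE) auto
    moreover have "AE x::'a in lborel. x \<noteq> 0" by (rule AE_lborel_singleton)
    ultimately show "AE x::'a in lborel. (\<lambda>i. ennreal (min 1 ((norm x)\<^sup>2 / (real (Suc i))\<^sup>2)) * \<nu> (norm x)) \<longlonglongrightarrow> 0"
    proof eventually_elim
      case (elim x)
      then have nf: "\<nu> (norm x) \<noteq> \<infinity>" by (auto simp: ennreal_mult_eq_top_iff min_def split: if_splits)
      have "(\<lambda>i. 1 / real (Suc i)) \<longlonglongrightarrow> 0" using LIMSEQ_inverse_real_of_nat by (simp add: field_simps)
      then have "(\<lambda>i. min 1 ((norm x)\<^sup>2 * (1 / real (Suc i))\<^sup>2)) \<longlonglongrightarrow> min 1 ((norm x)\<^sup>2 * 0\<^sup>2)"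
        by (intro tendsto_intros)
      then have "(\<lambda>i. ennreal (min 1 ((norm x)\<^sup>2 / (real (Suc i))\<^sup>2))) \<longlonglongrightarrow> ennreal 0"
        by (intro tendsto_ennrealI) (simp add: power_divide)
      then have "(\<lambda>i. \<nu> (norm x) * ennreal (min 1 ((norm x)\<^sup>2 / (real (Suc i))\<^sup>2))) \<longlonglongrightarrow> \<nu> (norm x) * ennreal 0"
        using nf by (intro ennreal_tendsto_cmult) (auto simp: less_top)
      then show ?case by (simp add: mult.commute)
    qed
  qed auto
  then have "(\<lambda>n. ennreal (h (real (Suc n)))) \<longlonglongrightarrow> 0"
    by (simp add: nuint_h[symmetric] nuint_def del: of_nat_Suc)
  then have "\<forall>\<^sub>F n in sequentially. ennreal (h (real (Suc n))) < ennreal e"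
    using e by (intro order_tendstoD(2)) auto
  then obtain n where "h (real (Suc n)) < e"
    using e by (auto simp: eventually_sequentially ennreal_less_iff h_nonneg)
  then show ?thesis by (intro exI[of _ "real (Suc n)"]) auto
qed

lemma hinv_props:
  assumes s: "0 < s" and un: "\<exists>r>0. s < h r"
  shows "0 < hinv \<nu> ty s" "h (hinv \<nu> ty s) = s"
proof -
  obtain a where a: "0 < a" "s < h a" using un by auto
  obtain b where b: "0 < b" "h b < s" using h_at_top[OF s] by auto
  have ab: "a < b" using a b h_antimono[of b a] by (cases "a < b") auto
  have "\<exists>x\<ge>a. x \<le> b \<and> h x = s"
    using a b ab by (intro IVT2') (auto intro: continuous_on_subset[OF h_continuous])
  then obtain x where x: "a \<le> x" "h x = s" by blast
  then have x: "0 < x" "h x = s" using a by auto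
  have "hinv \<nu> ty s = x" unfolding hinv_def
  proof (rule the_equality)
    show "r = x" if "0 < r \<and> h r = s" for r
      using that x h_strict[of r x] h_strict[of x r] by (cases r x rule: linorder_cases) auto
  qed (use x in auto)
  then show "0 < hinv \<nu> ty s" "h (hinv \<nu> ty s) = s" using x by auto
qed

lemma h_ball_compl:
  assumes "0 < r" shows "nuint (indicator (- ball 0 r)) \<le> ennreal (h r)"
proof -
  have "nuint (indicator (- ball 0 r)) \<le> nuint (\<lambda>x. min 1 ((norm x)\<^sup>2 / r\<^sup>2))"
  proof (rule nuint_mono)
    fix x :: 'a
    have "\<not> norm x < r \<Longrightarrow> r\<^sup>2 \<le> (norm x)\<^sup>2" using assms by (intro power_mono) auto
    then show "indicator (- ball 0 r) x \<le> min 1 ((norm x)\<^sup>2 / r\<^sup>2)"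
      using assms by (auto simp: indicator_def)
  qed
  then show ?thesis using assms by (simp add: nuint_h)
qed

end

section \<open>Changes of variables and a tail integral\<close>

lemma nn_integral_lborel_scale:
  fixes f :: "'a::euclidean_space \<Rightarrow> ennreal"
  assumes [measurable]: "f \<in> borel_measurable borel" and c: "0 < c"
  shows "(\<integral>\<^sup>+ x. f x \<partial>lborel) = ennreal (c ^ DIM('a)) * (\<integral>\<^sup>+ x. f (c *\<^sub>R x) \<partial>lborel)"
  using c by (subst lborel_affine[of c 0])
    (auto simp: nn_integral_density nn_integral_distr nn_integral_cmult)

lemma nn_integral_lborel_reflect:
  fixes f :: "'a::euclidean_space \<Rightarrow> ennreal"
  assumes [measurable]: "f \<in> borel_measurable borel"
  shows "(\<integral>\<^sup>+ x. f (w - x) \<partial>lborel) = (\<integral>\<^sup>+ x. f x \<partial>lborel)"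
proof -
  have "(\<integral>\<^sup>+ x. f x \<partial>lborel) = (\<integral>\<^sup>+ x. f (w - x) \<partial>lborel)"
    by (subst lborel_affine[of "-1" w]) (auto simp: nn_integral_density nn_integral_distr)
  then show ?thesis ..
qed

lemma term_le_suminf: "f k \<le> (\<Sum>i. f i :: ennreal)"
  using sum_le_suminf[of f "{k}"] by simp

lemma lborel_distr_minus: "distr lborel borel (uminus :: 'a \<Rightarrow> 'a::euclidean_space) = lborel"
  using lborel_affine[of "- 1" "0 :: 'a"] by (simp add: density_1)

text \<open>Dyadic shells replace polar coordinates. On the shell from 2^k r to 2^(k+1) r the
  integrand is at most (2^k r)^(-d-2), and the volume is at most that of the outer ball, which
  leaves a multiple of 4^(-k) / r^2.\<close>

lemma nn_integral_tail_le:
  "\<exists>c>0. \<forall>r>0. (\<integral>\<^sup>+ x. ennreal (indicator (- ball (0::'a::euclidean_space) r) x / norm x ^ (DIM('a) + 2)) \<partial>lborel)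
     \<le> ennreal (c / r\<^sup>2)"
proof -
  let ?d = "DIM('a)"
  define V where "V = unit_ball_vol (real ?d)"
  have V: "0 < V" by (simp add: V_def unit_ball_vol_pos)
  have main: "(\<integral>\<^sup>+ x. ennreal (indicator (- ball (0::'a) r) x / norm x ^ (?d + 2)) \<partial>lborel) \<le> ennreal (V * 2 ^ ?d * 4 / r\<^sup>2)"
    if r: "0 < r" for r
  proof -
    let ?g = "\<lambda>k (x::'a). ennreal (1 / (2 ^ k * r) ^ (?d + 2)) * indicator (ball 0 (2 ^ Suc k * r)) x"
    have ptw: "ennreal (indicator (- ball (0::'a) r) x / norm x ^ (?d + 2)) \<le> (\<Sum>k. ?g k x)" for x :: 'a
    proof (cases "norm x < r")
      case False
      define k where "k = nat \<lfloor>log 2 (norm x / r)\<rfloor>"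
      have x: "1 \<le> norm x / r" "0 < norm x" using False r by auto
      then have "0 \<le> log 2 (norm x / r)" by simp
      then have k: "real k \<le> log 2 (norm x / r)" "log 2 (norm x / r) < real k + 1"
        unfolding k_def by linarith+
      have "2 powr real k \<le> norm x / r" using k(1) x r by (subst (asm) le_log_iff) auto
      then have k1: "2 ^ k * r \<le> norm x" using r by (simp add: powr_realpow field_simps)
      have "norm x / r < 2 powr (real (Suc k))" using k(2) x r by (subst (asm) log_less_iff) (auto simp: add.commute)
      then have k2: "norm x < 2 ^ Suc k * r" using r by (simp add: powr_realpow field_simps del: power_Suc of_nat_Suc)
      have "1 / norm x ^ (?d + 2) \<le> 1 / (2 ^ k * r) ^ (?d + 2)"
        using k1 r x(2) by (intro divide_left_mono power_mono mult_pos_pos zero_less_power) auto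
      then have "ennreal (indicator (- ball (0::'a) r) x / norm x ^ (?d + 2)) \<le> ?g k x"
        using k2 False by (auto simp: ennreal_leI)
      also have "\<dots> \<le> (\<Sum>k. ?g k x)"
        by (rule term_le_suminf)
      finally show ?thesis .
    qed auto
    have "(\<integral>\<^sup>+ x. ennreal (indicator (- ball (0::'a) r) x / norm x ^ (?d + 2)) \<partial>lborel) \<le> (\<integral>\<^sup>+ x. (\<Sum>k. ?g k x) \<partial>lborel)"
      by (intro nn_integral_mono ptw)
    also have "\<dots> = (\<Sum>k. \<integral>\<^sup>+ x. ?g k x \<partial>lborel)"
      by (intro nn_integral_suminf) measurable
    also have "\<dots> = (\<Sum>k. ennreal (V * 2 ^ ?d / r\<^sup>2 * (1/4) ^ k))"
    proof (intro suminf_cong)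
      fix k
      have "(\<integral>\<^sup>+ x. ?g k x \<partial>lborel) = ennreal (1 / (2 ^ k * r) ^ (?d + 2)) * ennreal (V * (2 ^ Suc k * r) ^ ?d)"
        using r by (subst nn_integral_cmult_indicator) (auto simp: emeasure_ball V_def)
      also have "\<dots> = ennreal (1 / (2 ^ k * r) ^ (?d + 2) * (V * (2 ^ Suc k * r) ^ ?d))"
        using r V by (subst ennreal_mult') auto
      also have "1 / (2 ^ k * r) ^ (?d + 2) * (V * (2 ^ Suc k * r) ^ ?d) = V * 2 ^ ?d / r\<^sup>2 * (1/4) ^ k"
      proof -
        have "(2 ^ Suc k * r) ^ ?d = 2 ^ ?d * (2 ^ k * r) ^ ?d" by (simp add: power_mult_distrib)
        moreover have "(2 ^ k * r) ^ (?d + 2) = (2 ^ k * r) ^ ?d * (4 ^ k * r\<^sup>2)"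
          by (simp only: power_add power_mult_distrib) (simp add: power_mult[symmetric] power2_eq_square power_mult_distrib[symmetric])
        moreover have "(2 ^ k * r) ^ ?d \<noteq> 0" using r by simp
        ultimately show ?thesis by (simp add: field_simps)
      qed
      finally show "(\<integral>\<^sup>+ x. ?g k x \<partial>lborel) = ennreal (V * 2 ^ ?d / r\<^sup>2 * (1/4) ^ k)" .
    qed
    also have "\<dots> = ennreal (\<Sum>k. V * 2 ^ ?d / r\<^sup>2 * (1/4) ^ k)"
      using V by (intro suminf_ennreal2) (auto intro!: summable_mult summable_geometric)
    also have "(\<Sum>k. V * 2 ^ ?d / r\<^sup>2 * (1/4) ^ k) = V * 2 ^ ?d / r\<^sup>2 * (4/3)"
      by (subst suminf_mult) (auto simp: suminf_geometric intro!: summable_geometric)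
    also have "ennreal \<dots> \<le> ennreal (V * 2 ^ ?d * 4 / r\<^sup>2)"
    proof (rule ennreal_leI)
      have "0 \<le> V * 2 ^ ?d / r\<^sup>2" using V by simp
      then show "V * 2 ^ ?d / r\<^sup>2 * (4/3) \<le> V * 2 ^ ?d * 4 / r\<^sup>2" by simp
    qed
    finally show ?thesis .
  qed
  show ?thesis using main V by (intro exI[of _ "V * 2 ^ ?d * 4"]) auto
qed

section \<open>Scaling beyond radius 1, the density \<open>kd\<close> and the bound function\<close>

context levy_measure
begin

text \<open>Times up to T lead to radii above 1, where nothing is assumed. If only r exceeds 1, the
  comparison passes through radius 1; if l r does as well, monotonicity of h suffices because the
  constant is at least 1.\<close>

lemma wlsc_extend:
  assumes "WLSC \<nu> ty \<alpha> C" "1 \<le> R" "0 < l" "l \<le> 1" "0 < r" "r \<le> R"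
  shows "h r \<le> C * R powr \<alpha> * l powr \<alpha> * h (l * r)"
proof -
  have a: "0 < \<alpha>" "1 \<le> C" and sc: "\<And>l r. 0 < l \<Longrightarrow> l \<le> 1 \<Longrightarrow> 0 < r \<Longrightarrow> r \<le> 1 \<Longrightarrow> h r \<le> C * l powr \<alpha> * h (l * r)"
    using assms(1) by (auto simp: WLSC_def)
  have R1: "1 \<le> R powr \<alpha>" using a assms(2) by (simp add: ge_one_powr_ge_zero)
  show ?thesis
  proof (cases "r \<le> 1")
    case True
    have "h r \<le> C * l powr \<alpha> * h (l * r)" using True assms sc by auto
    also have "\<dots> = 1 * (C * l powr \<alpha> * h (l * r))" by simp
    also have "\<dots> \<le> R powr \<alpha> * (C * l powr \<alpha> * h (l * r))"
      using R1 a assms by (intro mult_right_mono) (auto simp: h_nonneg)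
    finally show ?thesis by (simp add: mult_ac)
  next
    case False
    have Rl: "(l * r) powr \<alpha> \<le> R powr \<alpha> * l powr \<alpha>"
      using assms a by (simp add: powr_mult mult.commute mult_left_mono powr_mono2)
    show ?thesis
    proof (cases "l * r \<le> 1")
      case True
      have "h r \<le> h 1" using False by (intro h_antimono) auto
      also have "\<dots> \<le> C * (l * r) powr \<alpha> * h (l * r)" using True assms sc[of "l * r" 1] by auto
      also have "\<dots> \<le> C * (R powr \<alpha> * l powr \<alpha>) * h (l * r)"
        using Rl a by (intro mult_right_mono mult_left_mono) (auto simp: h_nonneg)
      finally show ?thesis by (simp add: mult_ac)
    next
      case lr: False
      have "1 \<le> (l * r) powr \<alpha>" using lr a by (simp add: ge_one_powr_ge_zero)
      then have "1 * 1 \<le> C * (R powr \<alpha> * l powr \<alpha>)" using a Rl by (intro mult_mono) auto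
      moreover have "h r \<le> h (l * r)" using assms by (intro h_antimono) (auto intro: mult_left_le_one_le)
      ultimately have "1 * h r \<le> C * (R powr \<alpha> * l powr \<alpha>) * h (l * r)"
        by (intro mult_mono) (auto simp: h_nonneg)
      then show ?thesis by (simp add: mult_ac)
    qed
  qed
qed

text \<open>The same case distinction as for the lower scaling. The loss R^2 comes from the growth
  of s^2 h(s), which gives h(1) \<le> R^2 h(r).\<close>

lemma wusc_extend:
  assumes "WUSC \<nu> ty \<beta> c" "1 \<le> R" "0 < l" "l \<le> 1" "0 < r" "r \<le> R"
  shows "c / R\<^sup>2 * l powr \<beta> * h (l * r) \<le> h r"
proof -
  have b: "0 < \<beta>" "0 < c" "c \<le> 1" and sc: "\<And>l r. 0 < l \<Longrightarrow> l \<le> 1 \<Longrightarrow> 0 < r \<Longrightarrow> r \<le> 1 \<Longrightarrow> c * l powr \<beta> * h (l * r) \<le> h r"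
    using assms(1) by (auto simp: WUSC_def)
  have R1: "1 \<le> R\<^sup>2" using assms by (simp add: one_le_power)
  have "c * l powr \<beta> * h (l * r) \<le> R\<^sup>2 * h r"
  proof (cases "r \<le> 1")
    case True
    then have "c * l powr \<beta> * h (l * r) \<le> 1 * h r" using assms sc by simp
    also have "\<dots> \<le> R\<^sup>2 * h r" using R1 by (intro mult_right_mono) (auto simp: h_nonneg)
    finally show ?thesis .
  next
    case False
    have "h 1 \<le> r\<^sup>2 * h r" using h_ge[of 1 r] False by simp
    also have "\<dots> \<le> R\<^sup>2 * h r" using assms by (intro mult_right_mono power_mono) (auto simp: h_nonneg)
    finally have h1: "h 1 \<le> R\<^sup>2 * h r" .
    show ?thesis
    proof (cases "l * r \<le> 1")
      case True
      have "c * l powr \<beta> * h (l * r) \<le> c * (l * r) powr \<beta> * h (l * r * 1)"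
        using assms b False by (auto intro!: mult_right_mono mult_left_mono powr_mono2 simp: h_nonneg)
      also have "\<dots> \<le> h 1" using True assms by (intro sc) auto
      finally show ?thesis using h1 by linarith
    next
      case lr: False
      have "c * l powr \<beta> * h (l * r) \<le> 1 * h 1"
        using b assms lr by (intro mult_mono mult_le_one powr_le1 h_antimono) (auto simp: h_nonneg)
      then show ?thesis using h1 by linarith
    qed
  qed
  then show ?thesis using assms by (simp add: field_simps)
qed

lemma h_unbounded:
  assumes "WLSC \<nu> ty \<alpha> C" shows "\<exists>r>0. s < h r"
proof -
  have a: "0 < \<alpha>" "1 \<le> C" and sc: "\<And>l r. 0 < l \<Longrightarrow> l \<le> 1 \<Longrightarrow> 0 < r \<Longrightarrow> r \<le> 1 \<Longrightarrow> h r \<le> C * l powr \<alpha> * h (l * r)"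
    using assms(1) by (auto simp: WLSC_def)
  \<comment> \<open>With l^\<alpha> = m, scaling from radius 1 gives h(1) \<le> C m h(l); this value
    of m turns it into h(l) \<ge> |s| + 1.\<close>
  define m where "m = min 1 (h 1 / (C * (\<bar>s\<bar> + 1)))"
  have m: "0 < m" "m \<le> 1" using h_pos[of 1] a by (auto simp: m_def)
  define l where "l = m powr (1 / \<alpha>)"
  have l: "0 < l" "l \<le> 1" "l powr \<alpha> = m" using m a by (auto simp: l_def powr_le1 powr_powr)
  have "h 1 \<le> C * m * h l" using sc[of l 1] l by simp
  also have "\<dots> \<le> C * (h 1 / (C * (\<bar>s\<bar> + 1))) * h l"
    using a by (intro mult_right_mono mult_left_mono) (auto simp: m_def h_nonneg)
  also have "C * (h 1 / (C * (\<bar>s\<bar> + 1))) * h l = h 1 * h l / (\<bar>s\<bar> + 1)" using a by simp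
  finally have "h 1 * (\<bar>s\<bar> + 1) \<le> h 1 * h l" by (subst (asm) pos_le_divide_eq) auto
  then have "s < h l" using h_pos[of 1] by simp
  then show ?thesis using l by blast
qed

definition kd :: "real \<Rightarrow> real" where "kd s = K s / s ^ DIM('a)"

lemma kd_pos: "0 < s \<Longrightarrow> 0 < kd s" by (simp add: kd_def K_pos)

text \<open>Rescaling the ball to radius 1 exhibits \<open>kd\<close> as an average of \<nu>(s |y|)
  with weight |y|^2. Thus \<open>kd\<close> inherits the monotonicity of \<nu>, which K itself need
  not have.\<close>

lemma kd_eq:
  assumes s: "0 < s"
  shows "ennreal (kd s) = (\<integral>\<^sup>+ y. ennreal (indicator (ball 0 1) y * (norm y)\<^sup>2) * \<nu> (s * norm (y::'a)) \<partial>lborel)"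
proof -
  have m[measurable]: "(\<lambda>y::'a. \<nu> (s * norm y)) \<in> borel_measurable borel"
  proof -
    have "(\<lambda>y::'a. \<nu> (norm (s *\<^sub>R y))) \<in> borel_measurable borel"
      by (rule measurable_compose[OF _ nu_measurable]) auto
    then show ?thesis using s by simp
  qed
  have "ennreal (s\<^sup>2 * K s) = ennreal (s ^ DIM('a)) *
     (\<integral>\<^sup>+ y. ennreal (indicator (ball 0 s) (s *\<^sub>R y) * (norm (s *\<^sub>R y))\<^sup>2) * \<nu> (norm (s *\<^sub>R (y::'a))) \<partial>lborel)"
    using nn_integral_lborel_scale[OF _ s, of "\<lambda>x::'a. ennreal (indicator (ball 0 s) x * (norm x)\<^sup>2) * \<nu> (norm x)"]
    by (simp add: nuint_K[symmetric, OF s] nuint_def)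
  also have "(\<integral>\<^sup>+ y. ennreal (indicator (ball 0 s) (s *\<^sub>R y) * (norm (s *\<^sub>R y))\<^sup>2) * \<nu> (norm (s *\<^sub>R (y::'a))) \<partial>lborel) =
     (\<integral>\<^sup>+ y. ennreal (s\<^sup>2) * (ennreal (indicator (ball 0 1) y * (norm y)\<^sup>2) * \<nu> (s * norm (y::'a))) \<partial>lborel)"
    using s by (intro nn_integral_cong) (auto simp: indicator_def ennreal_mult'[symmetric] power_mult_distrib mult.assoc[symmetric])
  also have "\<dots> = ennreal (s\<^sup>2) * (\<integral>\<^sup>+ y. ennreal (indicator (ball 0 1) y * (norm y)\<^sup>2) * \<nu> (s * norm (y::'a)) \<partial>lborel)"
    by (intro nn_integral_cmult) measurable
  finally have "ennreal (s\<^sup>2 * s ^ DIM('a) * kd s) = ennreal (s\<^sup>2 * s ^ DIM('a)) * (\<integral>\<^sup>+ y. ennreal (indicator (ball 0 1) y * (norm y)\<^sup>2) * \<nu> (s * norm (y::'a)) \<partial>lborel)"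
    using s by (simp add: kd_def ennreal_mult mult_ac)
  then have "ennreal (s\<^sup>2 * s ^ DIM('a)) * ennreal (kd s) = ennreal (s\<^sup>2 * s ^ DIM('a)) * (\<integral>\<^sup>+ y. ennreal (indicator (ball 0 1) y * (norm y)\<^sup>2) * \<nu> (s * norm (y::'a)) \<partial>lborel)"
    using s kd_pos[of s] by (simp add: ennreal_mult'[symmetric])
  then show ?thesis using s by (subst (asm) ennreal_mult_cancel_left) auto
qed

lemma kd_antimono: assumes "0 < r" "r \<le> s" shows "kd s \<le> kd r"
proof -
  have "ennreal (kd s) \<le> ennreal (kd r)"
    using assms by (subst (1 2) kd_eq) (auto intro!: nn_integral_mono mult_left_mono nu_antimono mult_right_mono)
  then show ?thesis using assms kd_pos[of r] by simp
qed

text \<open>The counterpart of \<open>kd_antimono\<close>: together they give the doubling property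
  on which all comparisons of \<open>rr\<close> at nearby points rest.\<close>

lemma kd_growth: assumes "0 < r" "r \<le> s" shows "r ^ (DIM('a) + 2) * kd r \<le> s ^ (DIM('a) + 2) * kd s"
  using K_ge[OF assms] assms by (simp add: kd_def power_add power2_eq_square mult_ac)

lemma kd_half: assumes "0 < s" shows "kd (s / 2) \<le> 2 ^ (DIM('a) + 2) * kd s"
  using kd_growth[of "s/2" s] assms by (simp add: power_divide field_simps)

text \<open>In the average \<open>kd_eq\<close> every value \<nu>(s |y|) is at least \<nu>(s), so
  the second moment of the unit ball can be divided out. This also shows that \<nu> is finite off
  the origin.\<close>

lemma nu_le_kd: "\<exists>c>0. \<forall>s>0. \<nu> s \<le> ennreal (c * kd s)"
proof -
  define m where "m = (\<integral>\<^sup>+ y. ennreal (indicator (ball 0 1) y * (norm y)\<^sup>2) \<partial>(lborel :: 'a measure))"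
  have "m \<le> (\<integral>\<^sup>+ y. indicator (ball 0 1) y \<partial>(lborel :: 'a measure))"
    unfolding m_def by (intro nn_integral_mono) (auto simp: indicator_def power_le_one)
  also have "\<dots> < \<infinity>" by (simp add: emeasure_ball)
  finally have mfin: "m < \<infinity>" .
  have "m \<noteq> 0"
  proof
    assume "m = 0"
    then have "AE y::'a in lborel. ennreal (indicator (ball 0 1) y * (norm y)\<^sup>2) = 0"
      unfolding m_def by (subst (asm) nn_integral_0_iff_AE) auto
    moreover have "AE x::'a in lborel. x \<noteq> 0" by (rule AE_lborel_singleton)
    ultimately have "AE x::'a in lborel. x \<notin> ball 0 1"
      by eventually_elim (auto simp: indicator_def)
    then have "emeasure lborel (ball (0::'a) 1) = 0"
      by (subst (asm) AE_iff_measurable[where N = "ball 0 1"]) auto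
    then show False by (simp add: emeasure_ball unit_ball_vol_pos less_imp_neq[symmetric])
  qed
  then obtain m' where m': "0 < m'" "m = ennreal m'"
    using mfin by (cases m) (auto simp: ennreal_eq_0_iff not_le)
  have "\<nu> s \<le> ennreal (1 / m' * kd s)" if s: "0 < s" for s
  proof -
    have "\<nu> s * m = (\<integral>\<^sup>+ y. \<nu> s * ennreal (indicator (ball 0 1) y * (norm y)\<^sup>2) \<partial>(lborel :: 'a measure))"
      unfolding m_def by (intro nn_integral_cmult[symmetric]) measurable
    also have "\<dots> \<le> ennreal (kd s)"
    proof (subst kd_eq[OF s], rule nn_integral_mono)
      fix y :: 'a
      have "norm y < 1 \<Longrightarrow> \<nu> s \<le> \<nu> (s * norm y)" using s by (intro nu_antimono) auto
      then show "\<nu> s * ennreal (indicator (ball 0 1) y * (norm y)\<^sup>2) \<le> ennreal (indicator (ball 0 1) y * (norm y)\<^sup>2) * \<nu> (s * norm y)"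
        by (auto simp: indicator_def mult.commute intro!: mult_right_mono)
    qed
    finally have "ennreal (1/m') * (\<nu> s * ennreal m') \<le> ennreal (1/m') * ennreal (kd s)"
      using m' by (intro mult_left_mono) auto
    also have "ennreal (1/m') * (\<nu> s * ennreal m') = (ennreal (1/m') * ennreal m') * \<nu> s" by (simp add: mult_ac)
    also have "ennreal (1/m') * ennreal m' = 1" using m' by (simp add: ennreal_mult'[symmetric])
    finally show ?thesis using m' kd_pos[OF s] by (simp add: ennreal_mult'[symmetric] del: ennreal_mult'')
  qed
  then show ?thesis using m' by (intro exI[of _ "1/m'"]) auto
qed

text \<open>\<open>rr r\<close> is \<open>\<rho>\<^sub>t\<close> for \<open>t = 1 / h r\<close>.\<close>

definition rr :: "real \<Rightarrow> 'a \<Rightarrow> real" where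
  "rr r x = (if x = 0 then 1 / r ^ DIM('a) else min (1 / r ^ DIM('a)) (kd (norm x) / h r))"

lemma kd_measurable [measurable]: "kd \<in> borel_measurable borel"
proof -
  have eq: "(\<integral>\<^sup>+ x \<in> ball (0::'a) r. ennreal ((norm x)\<^sup>2) * \<nu> (norm x) \<partial>lborel) =
    (\<integral>\<^sup>+ x. (if norm (x::'a) < r then ennreal ((norm x)\<^sup>2) * \<nu> (norm x) else 0) \<partial>lborel)" for r
    by (intro nn_integral_cong) (auto simp: indicator_def)
  show ?thesis unfolding kd_def[abs_def] Kfun_def eq by measurable
qed

lemma rr_measurable [measurable]: "rr r \<in> borel_measurable borel"
  unfolding rr_def[abs_def] by measurable

lemma rr_pos: "0 < r \<Longrightarrow> 0 < rr r x"
  by (auto simp: rr_def kd_pos h_pos)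

lemma rr_le: "0 < r \<Longrightarrow> rr r x \<le> 1 / r ^ DIM('a)" by (auto simp: rr_def)

lemma rr_double: assumes r: "0 < r" and a: "norm w / 2 \<le> norm a" shows "rr r a \<le> 2 ^ (DIM('a) + 2) * rr r w"
proof (cases "w = 0")
  case True
  have "rr r a \<le> 1 * rr r w" using rr_le[OF r, of a] True by (simp add: rr_def)
  also have "\<dots> \<le> 2 ^ (DIM('a) + 2) * rr r w" using rr_pos[OF r, of w] by (intro mult_right_mono one_le_power) auto
  finally show ?thesis .
next
  case False
  then have a0: "a \<noteq> 0" using a by auto
  have "kd (norm a) \<le> kd (norm w / 2)" using False a by (intro kd_antimono) auto
  also have "\<dots> \<le> 2 ^ (DIM('a) + 2) * kd (norm w)" using False by (intro kd_half) auto
  finally have "kd (norm a) / h r \<le> 2 ^ (DIM('a) + 2) * (kd (norm w) / h r)"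
    using h_pos[OF r] by (simp add: field_simps)
  moreover have "1 * (1 / r ^ DIM('a)) \<le> 2 ^ (DIM('a) + 2) * (1 / r ^ DIM('a))"
    using r by (intro mult_right_mono one_le_power) auto
  ultimately have "rr r a \<le> min (2 ^ (DIM('a) + 2) * (1 / r ^ DIM('a))) (2 ^ (DIM('a) + 2) * (kd (norm w) / h r))"
    using a0 by (auto simp: rr_def)
  then show ?thesis using False by (simp add: rr_def min_mult_distrib_left)
qed

text \<open>Inside the ball of radius r the bound r^(-d) gives the volume of the unit ball. Outside,
  \<open>kd\<close> is written as a second-moment integral in y and the order is exchanged: the tail
  of |x|^(-d-2) leaves min(1, |y|^2 / r^2), whose integral is h(r) and cancels the denominator. So
  the mass is bounded uniformly in r.\<close>

lemma rr_integral: "\<exists>c>0. \<forall>r>0. (\<integral>\<^sup>+ x. ennreal (rr r x) \<partial>lborel) \<le> ennreal c"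
proof -
  let ?d = "DIM('a)"
  obtain c where c: "0 < c" "\<And>r. 0 < r \<Longrightarrow> (\<integral>\<^sup>+ x. ennreal (indicator (- ball (0::'a) r) x / norm x ^ (?d + 2)) \<partial>lborel) \<le> ennreal (c / r\<^sup>2)"
    using nn_integral_tail_le[where 'a='a] by auto
  define V where "V = unit_ball_vol (real ?d)"
  have V: "0 < V" by (simp add: V_def unit_ball_vol_pos)
  have "(\<integral>\<^sup>+ x. ennreal (rr r x) \<partial>lborel) \<le> ennreal (V + c)" if r: "0 < r" for r
  proof -
    let ?u = "\<lambda>(x::'a) (y::'a). ennreal (indicator (- ball 0 r) x / norm x ^ (?d + 2)) * (ennreal (if norm y < norm x then (norm y)\<^sup>2 else 0) * \<nu> (norm y))"
    have ptw: "ennreal (rr r x) \<le> ennreal (1 / r ^ ?d) * indicator (ball 0 r) x + ennreal (1 / h r) * (\<integral>\<^sup>+ y. ?u x y \<partial>lborel)" for x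
    proof (cases "norm x < r")
      case True
      then show ?thesis using rr_le[OF r, of x] by (auto intro!: ennreal_leI add_increasing2)
    next
      case False
      then have x: "0 < norm x" using r by auto
      have "ennreal (rr r x) \<le> ennreal (1 / h r) * ennreal (kd (norm x))"
        using x h_pos[OF r] by (subst ennreal_mult'[symmetric]) (auto simp: rr_def intro!: ennreal_leI)
      also have "ennreal (kd (norm x)) = ennreal (1 / norm x ^ (?d + 2)) * ennreal ((norm x)\<^sup>2 * K (norm x))"
        using x K_nonneg[of "norm x"] by (subst ennreal_mult'[symmetric]) (auto simp: kd_def power_add power2_eq_square)
      also have "ennreal ((norm x)\<^sup>2 * K (norm x)) = (\<integral>\<^sup>+ y. ennreal (if norm y < norm x then (norm y)\<^sup>2 else 0) * \<nu> (norm (y::'a)) \<partial>lborel)"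
        unfolding nuint_K[symmetric, OF x] nuint_def by (intro nn_integral_cong) (auto simp: indicator_def)
      also have "ennreal (1 / norm x ^ (?d + 2)) * \<dots> = (\<integral>\<^sup>+ y. ?u x y \<partial>lborel)"
      proof -
        have "(\<lambda>y::'a. ennreal (if norm y < norm x then (norm y)\<^sup>2 else 0) * \<nu> (norm y)) \<in> borel_measurable lborel"
          by measurable
        from nn_integral_cmult[OF this, symmetric] show ?thesis using False by simp
      qed
      finally show ?thesis using False by simp
    qed
    have inner: "(\<integral>\<^sup>+ x. ?u x y \<partial>lborel) \<le> ennreal (c * min 1 ((norm y)\<^sup>2 / r\<^sup>2)) * \<nu> (norm y)" for y
    proof -
      \<comment> \<open>The two restrictions on x, beyond r and beyond |y|, are merged into one
        radius.\<close>
      define q where "q = max r (norm y)"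
      have q: "0 < q" using r by (auto simp: q_def)
      have "(\<integral>\<^sup>+ x. ?u x y \<partial>lborel) \<le> (\<integral>\<^sup>+ x. (ennreal ((norm y)\<^sup>2) * \<nu> (norm y)) * ennreal (indicator (- ball (0::'a) q) x / norm x ^ (?d + 2)) \<partial>lborel)"
        by (intro nn_integral_mono) (auto simp: indicator_def q_def mult_ac)
      also have "\<dots> = (ennreal ((norm y)\<^sup>2) * \<nu> (norm y)) * (\<integral>\<^sup>+ x. ennreal (indicator (- ball (0::'a) q) x / norm x ^ (?d + 2)) \<partial>lborel)"
        by (intro nn_integral_cmult) measurable
      also have "\<dots> \<le> (ennreal ((norm y)\<^sup>2) * \<nu> (norm y)) * ennreal (c / q\<^sup>2)"
        by (intro mult_left_mono c q) auto
      also have "\<dots> = ennreal (c * ((norm y)\<^sup>2 / q\<^sup>2)) * \<nu> (norm y)"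
        using c by (simp add: ennreal_mult'[symmetric] mult_ac)
      also have "\<dots> \<le> ennreal (c * min 1 ((norm y)\<^sup>2 / r\<^sup>2)) * \<nu> (norm y)"
      proof (intro mult_right_mono ennreal_leI mult_left_mono)
        have "(norm y)\<^sup>2 / q\<^sup>2 \<le> (norm y)\<^sup>2 / r\<^sup>2" using r q by (intro divide_left_mono power_mono) (auto simp: q_def)
        moreover have "(norm y)\<^sup>2 / q\<^sup>2 \<le> 1" using q by (auto simp: q_def divide_le_eq intro!: power_mono)
        ultimately show "(norm y)\<^sup>2 / q\<^sup>2 \<le> min 1 ((norm y)\<^sup>2 / r\<^sup>2)" by simp
      qed (use c in auto)
      finally show ?thesis .
    qed
    have um: "(\<lambda>(x, y). ?u x y) \<in> borel_measurable (lborel \<Otimes>\<^sub>M lborel)"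
      by measurable
    have "(\<integral>\<^sup>+ x. ennreal (rr r x) \<partial>lborel) \<le> (\<integral>\<^sup>+ x. ennreal (1 / r ^ ?d) * indicator (ball 0 r) x + ennreal (1 / h r) * (\<integral>\<^sup>+ y. ?u x y \<partial>lborel) \<partial>lborel)"
      by (intro nn_integral_mono ptw)
    also have "\<dots> = ennreal (1 / r ^ ?d) * emeasure lborel (ball (0::'a) r) + ennreal (1 / h r) * (\<integral>\<^sup>+ x. \<integral>\<^sup>+ y. ?u x y \<partial>lborel \<partial>lborel)"
      by (subst nn_integral_add, measurable) (simp add: nn_integral_cmult_indicator nn_integral_cmult)
    also have "(\<integral>\<^sup>+ x. \<integral>\<^sup>+ y. ?u x y \<partial>lborel \<partial>lborel) = (\<integral>\<^sup>+ y. \<integral>\<^sup>+ x. ?u x y \<partial>lborel \<partial>lborel)"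
      using lborel_pair.Fubini'[OF um] by simp
    also have "\<dots> \<le> nuint (\<lambda>y. c * min 1 ((norm y)\<^sup>2 / r\<^sup>2))"
      unfolding nuint_def by (intro nn_integral_mono inner)
    also have "\<dots> = ennreal (c * h r)"
      using r c by (subst nuint_cmult) (auto simp: nuint_h ennreal_mult')
    also have "ennreal (1 / r ^ ?d) * emeasure lborel (ball (0::'a) r) = ennreal V"
      using r V by (simp add: emeasure_ball V_def ennreal_mult'[symmetric])
    also have "ennreal V + ennreal (1 / h r) * ennreal (c * h r) = ennreal (V + c)"
      using V c h_pos[OF r] by (simp add: ennreal_mult'[symmetric])
    finally show ?thesis by (simp add: add_left_mono mult_left_mono)
  qed
  then show ?thesis using V c by (intro exI[of _ "V + c"]) auto
qed

text \<open>If |z| < |w|/2, then w - z is still of size |w|; \<open>rr\<close> changes by the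
  doubling constant and the measure beyond r has mass at most h(r). If |z| \<ge> |w|/2, the density
  of the measure is itself bounded by a multiple of h(r) \<open>rr r w\<close>, and what remains is
  the bounded mass of \<open>rr\<close>.\<close>

lemma rr_conv:
  "\<exists>c>0. \<forall>r>0. \<forall>w. nuint (\<lambda>z. indicator (- ball 0 r) z * rr r (w - z)) \<le> ennreal (c * h r * rr r w)"
proof -
  let ?d = "DIM('a)"
  obtain c1 where c1: "0 < c1" "\<And>s. 0 < s \<Longrightarrow> \<nu> s \<le> ennreal (c1 * kd s)" using nu_le_kd by auto
  obtain c2 where c2: "0 < c2" "\<And>r. 0 < r \<Longrightarrow> (\<integral>\<^sup>+ x. ennreal (rr r x) \<partial>lborel) \<le> ennreal c2" using rr_integral by auto
  define D :: real where "D = 2 ^ (?d + 2)"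
  have D: "1 \<le> D" unfolding D_def by (rule one_le_power) simp
  have main: "nuint (\<lambda>z. indicator (- ball 0 r) z * rr r (w - z)) \<le> ennreal ((D + c1 * D * c2) * h r * rr r w)" if r: "0 < r" for r w
  proof -
    have rw: "0 < rr r w" by (rule rr_pos[OF r])
    have ptw: "ennreal (indicator (- ball 0 r) z * rr r (w - z)) * \<nu> (norm z) \<le>
       ennreal (D * rr r w * indicator (- ball 0 r) z) * \<nu> (norm z) + ennreal (c1 * D * h r * rr r w) * ennreal (rr r (w - z))" for z
    proof (cases "norm z < r")
      case False
      show ?thesis
      proof (cases "norm z < norm w / 2")
        case True
        have "norm w \<le> norm (w - z) + norm z" using norm_triangle_ineq[of "w - z" z] by simp
        then have "norm w / 2 \<le> norm (w - z)" using True by linarith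
        then have "rr r (w - z) \<le> D * rr r w" unfolding D_def by (rule rr_double[OF r])
        then show ?thesis using False by (intro add_increasing2 mult_right_mono ennreal_leI) auto
      next
        case ge: False
        have z: "0 < norm z" using False r by auto
        have "kd (norm z) \<le> D * h r * rr r w"
        proof -
          have "kd (norm z) \<le> kd r" using False r by (intro kd_antimono) auto
          also have "\<dots> \<le> h r * (1 / r ^ ?d)" using K_le_h[OF r] r by (simp add: kd_def divide_right_mono)
          also have "\<dots> \<le> D * (h r * (1 / r ^ ?d))" using D h_pos[OF r] r mult_right_mono[of 1 D "h r * (1 / r ^ ?d)"] by simp
          finally have 1: "kd (norm z) \<le> D * (h r * (1 / r ^ ?d))" .
          have 2: "kd (norm z) \<le> D * (h r * (kd (norm w) / h r))" if "w \<noteq> 0"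
          proof -
            have "kd (norm z) \<le> kd (norm w / 2)" using ge that by (intro kd_antimono) auto
            also have "\<dots> \<le> D * kd (norm w)" unfolding D_def using that by (intro kd_half) auto
            finally show ?thesis using h_pos[OF r] by simp
          qed
          show ?thesis using 1 2 unfolding rr_def by (auto simp: min_def mult.assoc)
        qed
        then have "c1 * kd (norm z) \<le> c1 * D * h r * rr r w" using c1 by (simp add: mult.assoc)
        then have "\<nu> (norm z) \<le> ennreal (c1 * D * h r * rr r w)"
          using c1(2)[OF z] by (meson ennreal_leI order_trans)
        then have "ennreal (rr r (w - z)) * \<nu> (norm z) \<le> ennreal (rr r (w - z)) * ennreal (c1 * D * h r * rr r w)"
          by (rule mult_left_mono) simp
        then show ?thesis using False by (intro add_increasing) (auto simp: mult_ac)
      qed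
    qed auto
    have "nuint (\<lambda>z. indicator (- ball 0 r) z * rr r (w - z)) \<le>
      (\<integral>\<^sup>+ z. ennreal (D * rr r w * indicator (- ball 0 r) z) * \<nu> (norm z) + ennreal (c1 * D * h r * rr r w) * ennreal (rr r (w - z)) \<partial>lborel)"
      unfolding nuint_def by (intro nn_integral_mono ptw)
    also have "\<dots> = nuint (\<lambda>z. D * rr r w * indicator (- ball 0 r) z) + ennreal (c1 * D * h r * rr r w) * (\<integral>\<^sup>+ z. ennreal (rr r (w - z)) \<partial>lborel)"
      unfolding nuint_def by (subst nn_integral_add, measurable) (simp add: nn_integral_cmult)
    also have "(\<integral>\<^sup>+ z. ennreal (rr r (w - z)) \<partial>lborel) = (\<integral>\<^sup>+ z. ennreal (rr r z) \<partial>lborel)"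
      by (rule nn_integral_lborel_reflect) measurable
    also have "nuint (\<lambda>z. D * rr r w * indicator (- ball 0 r) z) = ennreal (D * rr r w) * nuint (indicator (- ball 0 r))"
      using D rw by (intro nuint_cmult) auto
    also have "\<dots> + ennreal (c1 * D * h r * rr r w) * (\<integral>\<^sup>+ z. ennreal (rr r z) \<partial>lborel) \<le>
       ennreal (D * rr r w) * ennreal (h r) + ennreal (c1 * D * h r * rr r w) * ennreal c2"
      by (intro add_mono mult_left_mono c2 r h_ball_compl) auto
    also have "\<dots> = ennreal ((D + c1 * D * c2) * h r * rr r w)"
      using D c1 c2 rw h_pos[OF r] by (simp add: ennreal_mult'[symmetric] ennreal_plus[symmetric] algebra_simps del: ennreal_plus)
    finally show ?thesis .
  qed
  show ?thesis using main D c1 c2 by (intro exI[of _ "D + c1 * D * c2"]) (auto intro!: add_pos_pos)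
qed

text \<open>A choice makes the constant of \<open>rr_conv\<close> a function of the profile alone,
  so that it may occur in constants fixed before the radius.\<close>

definition conv_const :: real where
  "conv_const = (SOME c. 0 < c \<and> (\<forall>r>0. \<forall>w. nuint (\<lambda>z. indicator (- ball 0 r) z * rr r (w - z)) \<le> ennreal (c * h r * rr r w)))"

lemma conv_const: "0 < conv_const"
  "0 < r \<Longrightarrow> nuint (\<lambda>z. indicator (- ball 0 r) z * rr r (w - z)) \<le> ennreal (conv_const * h r * rr r w)"
  using someI_ex[OF rr_conv, folded conv_const_def] by blast+

end

text \<open>In the final theorem \<open>R\<close> bounds all radii that belong to times up to T, and
  \<open>C\<close> already contains the factor lost in \<open>wlsc_extend\<close>.\<close>

locale levy_scaling = levy_measure \<nu> ty for \<nu> and ty :: "'a::euclidean_space itself" +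
  fixes R \<alpha> C :: real
  assumes R1: "1 \<le> R" and alpha: "0 < \<alpha>" and C1: "1 \<le> C"
    and scale: "0 < l \<Longrightarrow> l \<le> 1 \<Longrightarrow> 0 < r \<Longrightarrow> r \<le> R \<Longrightarrow> h r \<le> C * l powr \<alpha> * h (l * r)"
begin

definition CK :: real where "CK = (2 * C) powr (2 / \<alpha>)"

lemma CK1: "1 \<le> CK" using C1 alpha by (simp add: CK_def ge_one_powr_ge_zero)

text \<open>Take l with C l^\<alpha> = 1/2. Scaling gives h(r) \<le> h(l r) / 2, and by
  \<open>h_le_K\<close> half of h(r) is absorbed on the left; \<open>CK\<close> is l^(-2).\<close>

lemma h_le_CK: assumes r: "0 < r" "r \<le> R" shows "h r \<le> CK * K r"
proof -
  define l where "l = (2 * C) powr (- 1 / \<alpha>)"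
  have l: "0 < l" "l \<le> 1" using C1 alpha powr_mono[of "- 1 / \<alpha>" 0 "2 * C"] by (auto simp: l_def)
  have la: "l powr \<alpha> = 1 / (2 * C)"   proof -
    have "l powr \<alpha> = (2 * C) powr (- 1 / \<alpha> * \<alpha>)" unfolding l_def by (rule powr_powr)
    also have "- 1 / \<alpha> * \<alpha> = - 1" using alpha by simp
    finally show ?thesis using C1 by (simp add: powr_minus_divide)
  qed
  have l2: "1 / l\<^sup>2 = CK"   proof -
    have "l\<^sup>2 = l powr 2" using l by (simp add: powr_numeral)
    also have "\<dots> = (2 * C) powr (- 1 / \<alpha> * 2)" unfolding l_def by (rule powr_powr)
    also have "- 1 / \<alpha> * 2 = - (2 / \<alpha>)" by simp
    finally show ?thesis using C1 by (simp add: CK_def powr_minus_divide)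
  qed
  have "h r \<le> C * l powr \<alpha> * h (l * r)" using l r by (intro scale)
  also have "C * l powr \<alpha> = 1 / 2" using C1 by (simp add: la)
  also have "1 / 2 * h (l * r) \<le> 1 / 2 * (h r + K r / l\<^sup>2)" using h_le_K[of r l] r l by simp
  finally have "h r \<le> K r * (1 / l\<^sup>2)" by simp
  then show ?thesis unfolding l2 by (simp add: mult.commute)
qed

text \<open>The cutoff of P1 is at 1, not at r; this compares the mass of the jumps beyond 1 with
  h(r).\<close>

lemma h1_le:
  assumes "0 < r" "r \<le> R" shows "h 1 \<le> R\<^sup>2 * h r"
proof (cases "r \<le> 1")
  case True
  have "h 1 \<le> 1 * h r" using True h_antimono[of r 1] assms by simp
  also have "\<dots> \<le> R\<^sup>2 * h r" using R1 by (intro mult_right_mono) (auto simp: h_nonneg one_le_power)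
  finally show ?thesis .
next
  case False
  have "h 1 \<le> r\<^sup>2 * h r" using h_ge[of 1 r] False by simp
  also have "\<dots> \<le> R\<^sup>2 * h r" using assms by (intro mult_right_mono power_mono) (auto simp: h_nonneg)
  finally show ?thesis .
qed

lemma rr_lower_near: assumes r: "0 < r" "r \<le> R" and w: "norm w \<le> r" shows "1 / r ^ DIM('a) \<le> CK * rr r w"
proof -
  have a: "1 / r ^ DIM('a) \<le> CK * (1 / r ^ DIM('a))" using CK1 r by (simp add: divide_right_mono)
  have b: "1 / r ^ DIM('a) \<le> CK * (kd (norm w) / h r)" if "w \<noteq> 0"
  proof -
    have "h r / r ^ DIM('a) \<le> CK * kd r" using h_le_CK[OF r] r by (simp add: kd_def divide_right_mono)
    also have "\<dots> \<le> CK * kd (norm w)" using CK1 w that by (intro mult_left_mono kd_antimono) auto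
    finally show ?thesis using h_pos[OF r(1)] r by (simp add: field_simps)
  qed
  show ?thesis using a b by (auto simp: rr_def min_def)
qed

text \<open>The second moment |w|^2 K(|w|) only increases beyond r, where it is already comparable
  with r^2 h(r). With \<open>rr_lower_near\<close> this is what lets \<open>rr\<close> dominate an
  exponential in |w|/r.\<close>

lemma rr_lower_far: assumes r: "0 < r" "r \<le> R" and w: "r \<le> norm w" shows "r\<^sup>2 / norm w ^ (DIM('a) + 2) \<le> CK * rr r w"
proof -
  let ?d = "DIM('a)"
  have w0: "0 < norm w" using r w by linarith
  have a: "r\<^sup>2 / norm w ^ (?d + 2) \<le> 1 / r ^ ?d"
    using r w w0 power_mono[OF w, of "?d + 2"] by (simp add: field_simps power_add power2_eq_square)
  have "1 / r ^ ?d \<le> CK * (1 / r ^ ?d)" using CK1 r by (simp add: divide_right_mono)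
  then have a: "r\<^sup>2 / norm w ^ (?d + 2) \<le> CK * (1 / r ^ ?d)" using a by linarith
  have "r\<^sup>2 * h r \<le> CK * (r\<^sup>2 * K r)" using h_le_CK[OF r] r by simp
  also have "\<dots> \<le> CK * ((norm w)\<^sup>2 * K (norm w))" using CK1 r w by (intro mult_left_mono K_ge) auto
  also have "\<dots> = CK * (norm w ^ (?d + 2) * kd (norm w))" using w0 by (simp add: kd_def power_add power2_eq_square)
  finally have b: "r\<^sup>2 / norm w ^ (?d + 2) \<le> CK * (kd (norm w) / h r)"
    using h_pos[OF r(1)] w0 by (simp add: field_simps)
  show ?thesis using a b w0 by (auto simp: rr_def min_def)
qed

end

section \<open>Lower bound for the symbol and first moments\<close>

lemma nn_integral_lborel_permute:
  fixes f :: "'a::euclidean_space \<Rightarrow> ennreal"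
  assumes [measurable]: "f \<in> borel_measurable borel" and p: "p permutes (Basis :: 'a set)"
  shows "(\<integral>\<^sup>+ x. f (\<Sum>b\<in>Basis. (x \<bullet> p b) *\<^sub>R b) \<partial>lborel) = (\<integral>\<^sup>+ x. f x \<partial>lborel)"
proof -
  define S where "S = (\<lambda>x::'a. \<Sum>b\<in>Basis. (x \<bullet> p b) *\<^sub>R b)"
  have Sb: "S x \<bullet> b = x \<bullet> p b" if "b \<in> Basis" for x b using that by (simp add: S_def)
  have [measurable]: "S \<in> borel_measurable borel" unfolding S_def by measurable
  have pB: "p b \<in> Basis \<longleftrightarrow> b \<in> Basis" for b using permutes_in_image[OF p] .
  define q where "q = inv p"
  have q: "q permutes Basis" unfolding q_def by (rule permutes_inv[OF p])
  have qB: "q b \<in> Basis \<longleftrightarrow> b \<in> Basis" for b using permutes_in_image[OF q] .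
  have pq: "p (q b) = b" "q (p b) = b" for b unfolding q_def using permutes_inverses[OF p] by auto
  have "lborel = distr lborel borel S"
  proof (rule lborel_eqI)
    fix l u :: 'a assume lu: "\<And>b. b \<in> Basis \<Longrightarrow> l \<bullet> b \<le> u \<bullet> b"
    define l' where "l' = (\<Sum>b\<in>Basis. (l \<bullet> q b) *\<^sub>R b)"
    define u' where "u' = (\<Sum>b\<in>Basis. (u \<bullet> q b) *\<^sub>R b)"
    have l': "l' \<bullet> b = l \<bullet> q b" "u' \<bullet> b = u \<bullet> q b" if "b \<in> Basis" for b using that by (auto simp: l'_def u'_def)
    have "S -` box l u = box l' u'"
    proof -
      have "x \<in> box l' u' \<longleftrightarrow> S x \<in> box l u" for x
      proof -
        have "x \<in> box l' u' \<longleftrightarrow> (\<forall>b\<in>Basis. l \<bullet> q b < x \<bullet> b \<and> x \<bullet> b < u \<bullet> q b)"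
          by (auto simp: mem_box l')
        also have "\<dots> \<longleftrightarrow> (\<forall>b\<in>Basis. l \<bullet> b < x \<bullet> p b \<and> x \<bullet> p b < u \<bullet> b)"
          by (metis pB pq qB)
        finally show ?thesis by (simp add: mem_box Sb)
      qed
      then show ?thesis by auto
    qed
    then have "emeasure (distr lborel borel S) (box l u) = emeasure lborel (box l' u')"
      by (subst emeasure_distr) auto
    also have "\<dots> = ennreal (\<Prod>b\<in>Basis. (u' - l') \<bullet> b)"
      using lu qB by (intro emeasure_lborel_box) (auto simp: l')
    also have "(\<Prod>b\<in>Basis. (u' - l') \<bullet> b) = (\<Prod>b\<in>Basis. (u - l) \<bullet> q b)"
      by (intro prod.cong) (auto simp: l' inner_diff_left)
    also have "\<dots> = (\<Prod>b\<in>Basis. (u - l) \<bullet> b)"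
      using prod.permute[OF q, of "\<lambda>b. (u - l) \<bullet> b"] by (simp add: o_def)
    finally show "emeasure (distr lborel borel S) (box l u) = ennreal (prod ((\<bullet>) (u - l)) Basis)" .
  qed simp
  then have "(\<integral>\<^sup>+ x. f x \<partial>lborel) = (\<integral>\<^sup>+ x. f x \<partial>(distr lborel borel S))" by simp
  also have "\<dots> = (\<integral>\<^sup>+ x. f (S x) \<partial>lborel)" by (subst nn_integral_distr) auto
  finally show ?thesis by (simp add: S_def)
qed

lemma euclidean_norm_square: "(norm (x::'a::euclidean_space))\<^sup>2 = (\<Sum>b\<in>Basis. (x \<bullet> b)\<^sup>2)"
  by (simp add: power2_norm_eq_inner euclidean_inner[of x x] power2_eq_square[symmetric])

text \<open>By the half-angle formula this follows from |sin y| \<ge> 5/6 |y|, which the cubic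
  Taylor remainder gives for y = x/2.\<close>

lemma one_minus_cos_ge: assumes "\<bar>x\<bar> \<le> 1" shows "x\<^sup>2 / 4 \<le> 1 - cos (x::real)"
proof -
  define y where "y = x / 2"
  have y: "\<bar>y\<bar> \<le> 1/2" using assms by (simp add: y_def)
  have "\<bar>sin y - (\<Sum>m<3. sin_coeff m * y ^ m)\<bar> \<le> inverse (fact 3) * \<bar>y\<bar> ^ 3" by (rule Maclaurin_sin_bound)
  then have s: "\<bar>sin y - y\<bar> \<le> \<bar>y\<bar> ^ 3 / 6"
    by (simp add: sin_coeff_def eval_nat_numeral lessThan_Suc field_simps)
  have "\<bar>y\<bar> ^ 3 = \<bar>y\<bar> * y\<^sup>2" by (simp add: eval_nat_numeral)
  also have "\<dots> \<le> \<bar>y\<bar> * 1" using y by (intro mult_left_mono) (auto simp: abs_square_le_1)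
  finally have "5/6 * \<bar>y\<bar> \<le> \<bar>sin y\<bar>" using s by linarith
  then have "(5/6 * \<bar>y\<bar>)\<^sup>2 \<le> \<bar>sin y\<bar>\<^sup>2" by (intro power_mono) auto
  then have "25/36 * y\<^sup>2 \<le> (sin y)\<^sup>2" by (simp add: power_mult_distrib power_divide)
  moreover have "1 - cos x = 2 * (sin y)\<^sup>2" using cos_double_sin[of y] by (simp add: y_def)
  moreover have "x\<^sup>2 = 4 * y\<^sup>2" by (simp add: y_def power_divide)
  moreover have "0 \<le> y\<^sup>2" by simp
  ultimately show ?thesis by linarith
qed

context levy_measure
begin

lemma nuint_cong_lborel:
  assumes [measurable]: "f \<in> borel_measurable borel"
    and T: "\<And>g :: 'a \<Rightarrow> ennreal. g \<in> borel_measurable borel \<Longrightarrow> (\<integral>\<^sup>+ x. g (T x) \<partial>lborel) = (\<integral>\<^sup>+ x. g x \<partial>lborel)"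
    and n: "\<And>x. norm (T x) = norm x"
  shows "nuint (\<lambda>x. f (T x)) = nuint f"
  using T[of "\<lambda>x. ennreal (f x) * \<nu> (norm x)"] by (simp add: nuint_def n)

text \<open>Swapping two coordinates preserves both Lebesgue measure and the norm, so the d
  coordinate moments agree, and their sum is s^2 K(s). Rotation invariance is thus used only through
  coordinate swaps and, in the next lemma, a reflection.\<close>

lemma nuint_coord:
  assumes i: "i \<in> Basis" and s: "0 < s"
  shows "ennreal (s\<^sup>2 * K s / DIM('a)) = nuint (\<lambda>z. indicator (ball 0 s) z * (z \<bullet> i)\<^sup>2)"
proof -
  have sym: "nuint (\<lambda>z. indicator (ball 0 s) z * (z \<bullet> j)\<^sup>2) = nuint (\<lambda>z. indicator (ball 0 s) z * (z \<bullet> i)\<^sup>2)"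
    if j: "j \<in> Basis" for j
  proof -
    define p where "p = Transposition.transpose i j"
    have p: "p permutes Basis" unfolding p_def using i j by (rule permutes_swap_id)
    define S where "S = (\<lambda>x::'a. \<Sum>b\<in>Basis. (x \<bullet> p b) *\<^sub>R b)"
    have Sb: "S x \<bullet> b = x \<bullet> p b" if "b \<in> Basis" for x b using that by (simp add: S_def)
    have nS: "norm (S x) = norm x" for x
    proof -
      have "(norm (S x))\<^sup>2 = (\<Sum>b\<in>Basis. (x \<bullet> p b)\<^sup>2)" by (simp add: euclidean_norm_square Sb)
      also have "\<dots> = (\<Sum>b\<in>Basis. (x \<bullet> b)\<^sup>2)" using sum.permute[OF p, of "\<lambda>b. (x \<bullet> b)\<^sup>2"] by (simp add: o_def)
      finally show ?thesis by (simp add: euclidean_norm_square[symmetric])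
    qed
    have "nuint (\<lambda>z. indicator (ball 0 s) (S z) * (S z \<bullet> i)\<^sup>2) = nuint (\<lambda>z. indicator (ball 0 s) z * (z \<bullet> i)\<^sup>2)"
    proof (rule nuint_cong_lborel[where T = S])
      show "(\<lambda>z. indicator (ball 0 s) z * (z \<bullet> i)\<^sup>2) \<in> borel_measurable borel" by measurable
      show "(\<integral>\<^sup>+ x. g (S x) \<partial>lborel) = (\<integral>\<^sup>+ x. g x \<partial>lborel)" if "g \<in> borel_measurable borel" for g :: "'a \<Rightarrow> ennreal"
        unfolding S_def by (rule nn_integral_lborel_permute[OF that p])
    qed (rule nS)
    moreover have "p i = j" by (simp add: p_def)
    ultimately show ?thesis by (simp add: Sb[OF i] indicator_def nS)
  qed
  define F where "F = (\<lambda>(j::'a) (z::'a). indicator (ball 0 s) z * (z \<bullet> j)\<^sup>2 :: real)"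
  have F0: "0 \<le> F j z" for j z by (simp add: F_def)
  have [measurable]: "F j \<in> borel_measurable borel" for j unfolding F_def by measurable
  have "ennreal (s\<^sup>2 * K s) = nuint (\<lambda>z. indicator (ball 0 s) z * (norm z)\<^sup>2)" by (simp add: nuint_K[OF s])
  also have "\<dots> = nuint (\<lambda>z. \<Sum>j\<in>Basis. F j z)"
    unfolding F_def by (simp only: euclidean_norm_square sum_distrib_left)
  also have "\<dots> = (\<integral>\<^sup>+ z. (\<Sum>j\<in>Basis. ennreal (F j z) * \<nu> (norm z)) \<partial>lborel)"
    unfolding nuint_def by (intro nn_integral_cong) (simp add: sum_ennreal[symmetric] F0 sum_distrib_right del: sum_ennreal)
  also have "\<dots> = (\<Sum>j\<in>Basis. nuint (F j))"
    unfolding nuint_def by (intro nn_integral_sum) measurable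
  also have "\<dots> = (\<Sum>j\<in>Basis. nuint (\<lambda>z. indicator (ball 0 s) z * (z \<bullet> j)\<^sup>2))"
    by (simp add: F_def)
  also have "\<dots> = (\<Sum>j\<in>(Basis::'a set). nuint (\<lambda>z. indicator (ball 0 s) z * (z \<bullet> i)\<^sup>2))"
    by (intro sum.cong sym) auto
  also have "\<dots> = ennreal (DIM('a)) * nuint (\<lambda>z. indicator (ball 0 s) z * (z \<bullet> i)\<^sup>2)"
    by (simp add: ennreal_of_nat_eq_real_of_nat)
  finally have "ennreal (1 / DIM('a)) * ennreal (s\<^sup>2 * K s) = ennreal (1 / DIM('a)) * (ennreal (DIM('a)) * nuint (\<lambda>z. indicator (ball 0 s) z * (z \<bullet> i)\<^sup>2))"
    by simp
  then show ?thesis by (simp add: mult.assoc[symmetric] ennreal_mult'[symmetric])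
qed

text \<open>Averaging over the reflection of the coordinate in which \<open>u\<close> is largest removes the cross terms.\<close>

lemma nuint_direction:
  assumes s: "0 < s"
  shows "ennreal ((norm u)\<^sup>2 / (DIM('a))\<^sup>2 * (s\<^sup>2 * K s)) \<le> nuint (\<lambda>z. indicator (ball 0 s) z * (u \<bullet> z)\<^sup>2)"
proof -
  let ?d = "DIM('a)"
  obtain i where i: "i \<in> Basis" and ui: "(norm u)\<^sup>2 / ?d \<le> (u \<bullet> i)\<^sup>2"
  proof (rule ccontr)
    assume "\<not> thesis"
    then have "(u \<bullet> i)\<^sup>2 < (norm u)\<^sup>2 / ?d" if "i \<in> Basis" for i using that \<open>\<And>i. i \<in> Basis \<Longrightarrow> (norm u)\<^sup>2 / ?d \<le> (u \<bullet> i)\<^sup>2 \<Longrightarrow> thesis\<close> by force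
    then have "(\<Sum>i\<in>Basis. (u \<bullet> i)\<^sup>2) < (\<Sum>i\<in>(Basis::'a set). (norm u)\<^sup>2 / ?d)"
      by (intro sum_strict_mono) auto
    then show False by (simp add: euclidean_norm_square[symmetric])
  qed
  define c where "c = (\<lambda>j::'a. if j = i then - 1 else (1::real))"
  define S where "S = (\<lambda>x::'a. \<Sum>j\<in>Basis. (c j * (x \<bullet> j)) *\<^sub>R j)"
  have Sb: "S x \<bullet> b = c b * (x \<bullet> b)" if "b \<in> Basis" for x b using that by (simp add: S_def)
  have nS: "norm (S x) = norm x" for x
  proof -
    have "(norm (S x))\<^sup>2 = (\<Sum>b\<in>Basis. (x \<bullet> b)\<^sup>2)" unfolding euclidean_norm_square[of "S x"]
      by (intro sum.cong) (auto simp: Sb c_def)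
    then show ?thesis by (simp add: euclidean_norm_square[symmetric])
  qed
  have Sx: "S x = x - (2 * (x \<bullet> i)) *\<^sub>R i" for x
    by (rule euclidean_eqI) (simp add: Sb inner_diff_left inner_Basis i c_def)
  have [measurable]: "S \<in> borel_measurable borel" unfolding S_def by measurable
  have inv: "(\<integral>\<^sup>+ x. g (S x) \<partial>lborel) = (\<integral>\<^sup>+ x. g x \<partial>lborel)" if [measurable]: "g \<in> borel_measurable borel" for g :: "'a \<Rightarrow> ennreal"
  proof -
    have "lborel = density (distr lborel borel (\<lambda>x::'a. 0 + (\<Sum>j\<in>Basis. (c j * (x \<bullet> j)) *\<^sub>R j))) (\<lambda>_. ennreal (\<Prod>j\<in>Basis. \<bar>c j\<bar>))"
      by (rule lborel_affine_euclidean) (auto simp: c_def)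
    moreover have "(\<Prod>j\<in>(Basis::'a set). \<bar>c j\<bar>) = 1" by (intro prod.neutral) (auto simp: c_def)
    ultimately have "lborel = density (distr lborel borel S) (\<lambda>_. 1)" by (simp add: S_def)
    then have "(\<integral>\<^sup>+ x. g x \<partial>lborel) = (\<integral>\<^sup>+ x. g x \<partial>(density (distr lborel borel S) (\<lambda>_. 1)))" by simp
    also have "\<dots> = (\<integral>\<^sup>+ x. g (S x) \<partial>lborel)" by (simp add: nn_integral_density nn_integral_distr)
    finally show ?thesis ..
  qed
  let ?f = "\<lambda>z. indicator (ball 0 s) z * (u \<bullet> z)\<^sup>2"
  have fm [measurable]: "?f \<in> borel_measurable borel" by measurable
  have refl: "nuint (\<lambda>z. ?f (S z)) = nuint ?f"
    by (rule nuint_cong_lborel[where T = S]) (auto simp: nS inv)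
  have "ennreal ((norm u)\<^sup>2 / ?d\<^sup>2 * (s\<^sup>2 * K s)) = ennreal ((norm u)\<^sup>2 / ?d * (s\<^sup>2 * K s / ?d))" by (simp add: power2_eq_square)
  also have "\<dots> \<le> ennreal ((u \<bullet> i)\<^sup>2 * (s\<^sup>2 * K s / ?d))"
    using ui by (intro ennreal_leI mult_right_mono) (auto simp: K_nonneg)
  also have "\<dots> = nuint (\<lambda>z. (u \<bullet> i)\<^sup>2 * (indicator (ball 0 s) z * (z \<bullet> i)\<^sup>2))"
    by (subst nuint_cmult) (simp_all add: nuint_coord[OF i s, symmetric] ennreal_mult'[symmetric])
  finally have A: "ennreal ((norm u)\<^sup>2 / ?d\<^sup>2 * (s\<^sup>2 * K s)) \<le> nuint (\<lambda>z. (u \<bullet> i)\<^sup>2 * (indicator (ball 0 s) z * (z \<bullet> i)\<^sup>2))" .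
  have "2 * nuint (\<lambda>z. (u \<bullet> i)\<^sup>2 * (indicator (ball 0 s) z * (z \<bullet> i)\<^sup>2)) = nuint (\<lambda>z. 2 * ((u \<bullet> i)\<^sup>2 * (indicator (ball 0 s) z * (z \<bullet> i)\<^sup>2)))"
    by (subst nuint_cmult) auto
  also have "\<dots> \<le> nuint (\<lambda>z. ?f z + ?f (S z))"
  proof (rule nuint_mono)
    fix z
    have eq: "u \<bullet> S z = u \<bullet> z - 2 * ((u \<bullet> i) * (z \<bullet> i))" by (simp add: Sx inner_diff_right)
    have "(u \<bullet> z)\<^sup>2 + (u \<bullet> S z)\<^sup>2 = 2 * ((u \<bullet> i)\<^sup>2 * (z \<bullet> i)\<^sup>2) + 2 * (u \<bullet> z - (u \<bullet> i) * (z \<bullet> i))\<^sup>2"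
      unfolding eq by (simp add: power2_eq_square algebra_simps)
    then have "2 * ((u \<bullet> i)\<^sup>2 * (z \<bullet> i)\<^sup>2) \<le> (u \<bullet> z)\<^sup>2 + (u \<bullet> S z)\<^sup>2" by simp
    then show "2 * ((u \<bullet> i)\<^sup>2 * (indicator (ball 0 s) z * (z \<bullet> i)\<^sup>2)) \<le> ?f z + ?f (S z)"
      by (auto simp: indicator_def nS)
  qed
  also have "\<dots> = nuint ?f + nuint (\<lambda>z. ?f (S z))" by (intro nuint_add) auto
  also have "\<dots> = 2 * nuint ?f" unfolding refl by (simp add: mult_2)
  finally have "nuint (\<lambda>z. (u \<bullet> i)\<^sup>2 * (indicator (ball 0 s) z * (z \<bullet> i)\<^sup>2)) \<le> nuint ?f"
    by (subst (asm) ennreal_mult_le_mult_iff) auto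
  then show ?thesis using A by order
qed

text \<open>The device behind both first-moment bounds: a function lying at each point below some
  step a_k on the complement of the ball of radius s_k costs at most the sum of a_k h(s_k). The
  scaling of h then decides convergence.\<close>

lemma nuint_dyadic:
  assumes ptw: "\<And>z. \<exists>k::nat. g z \<le> a k * indicator (- ball 0 (s k)) z"
    and a: "\<And>k. 0 \<le> a k" and s: "\<And>k. 0 < s k" and b: "\<And>k. a k * h (s k) \<le> b k" and sb: "summable b"
  shows "nuint g \<le> ennreal (suminf b)"
proof -
  let ?g = "\<lambda>k (z::'a). ennreal (a k * indicator (- ball 0 (s k)) z) * \<nu> (norm z)"
  have le: "ennreal (g z) * \<nu> (norm z) \<le> (\<Sum>k. ?g k z)" for z
  proof -
    obtain k where "g z \<le> a k * indicator (- ball 0 (s k)) z" using ptw by blast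
    then have "ennreal (g z) * \<nu> (norm z) \<le> ?g k z" by (intro mult_right_mono ennreal_leI) auto
    also have "\<dots> \<le> (\<Sum>k. ?g k z)"
      by (rule term_le_suminf)
    finally show ?thesis .
  qed
  have "nuint g \<le> (\<integral>\<^sup>+ z. (\<Sum>k. ?g k z) \<partial>lborel)" unfolding nuint_def by (intro nn_integral_mono le)
  also have "\<dots> = (\<Sum>k. nuint (\<lambda>z. a k * indicator (- ball 0 (s k)) z))"
    unfolding nuint_def by (intro nn_integral_suminf) measurable
  also have "\<dots> \<le> (\<Sum>k. ennreal (b k))"
  proof (intro suminf_le allI summableI)
    fix k
    have "nuint (\<lambda>z. a k * indicator (- ball 0 (s k)) z) = ennreal (a k) * nuint (indicator (- ball 0 (s k)))"
      using a by (intro nuint_cmult) auto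
    also have "\<dots> \<le> ennreal (a k) * ennreal (h (s k))" by (intro mult_left_mono h_ball_compl s) auto
    also have "\<dots> \<le> ennreal (b k)" using a b by (subst ennreal_mult'[symmetric]) (auto intro: ennreal_leI)
    finally show "nuint (\<lambda>z. a k * indicator (- ball 0 (s k)) z) \<le> ennreal (b k)" .
  qed
  also have "\<dots> = ennreal (suminf b)"
    using sb a b h_nonneg by (intro suminf_ennreal2) (auto intro: order_trans[OF mult_nonneg_nonneg])
  finally show ?thesis .
qed

lemma geom_powr: assumes "0 < q" shows "summable (\<lambda>k. (2 powr (- q)) ^ k :: real)" "0 \<le> (\<Sum>k. (2 powr (- q)) ^ k :: real)"
proof -
  have "2 powr (- q) < (1::real)" using assms by (simp add: powr_minus_divide gr_one_powr)
  then show "summable (\<lambda>k. (2 powr (- q)) ^ k :: real)" by (intro summable_geometric) auto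
  then show "0 \<le> (\<Sum>k. (2 powr (- q)) ^ k :: real)" by (intro suminf_nonneg) auto
qed

lemma nuint_lin:
  assumes [measurable]: "f \<in> borel_measurable borel" "k \<in> borel_measurable borel"
    and "\<And>z. 0 \<le> f z" "\<And>z. 0 \<le> k z" "0 \<le> p" "0 \<le> q" "nuint f \<le> ennreal X" "nuint k \<le> ennreal Y" "0 \<le> X" "0 \<le> Y"
  shows "nuint (\<lambda>z. p * f z + q * k z) \<le> ennreal (p * X + q * Y)"
proof -
  have "nuint (\<lambda>z. p * f z + q * k z) = ennreal p * nuint f + ennreal q * nuint k"
    using assms by (subst nuint_add) (auto simp: nuint_cmult)
  also have "\<dots> \<le> ennreal p * ennreal X + ennreal q * ennreal Y"
    using assms by (intro add_mono mult_left_mono) auto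
  also have "\<dots> = ennreal (p * X + q * Y)" using assms by (simp add: ennreal_mult ennreal_plus)
  finally show ?thesis .
qed

lemma rr_minus: "rr r (- x) = rr r x" by (simp add: rr_def)

lemma conv_const_plus: assumes "0 < r" shows "nuint (\<lambda>z. indicator (- ball 0 r) z * rr r (w + z)) \<le> ennreal (conv_const * h r * rr r w)"
proof -
  have "rr r (w + z) = rr r (- w - z)" for z using rr_minus[of r "w + z"] by simp
  then show ?thesis using conv_const(2)[OF assms, of "- w"] by (simp add: rr_minus)
qed

text \<open>Upper scaling bounds h(2^(-k) r) by a multiple of 2^(k \<beta>) h(r), so the shell of
  radius 2^(-k) r contributes about 2^(-k (1 - \<beta>)) r h(r), summable exactly because \<beta> <
  1. Scaling is assumed at the given r only, but M precedes r.\<close>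

lemma moment_small:
  assumes b: "0 < \<beta>" "\<beta> < 1" and c: "0 < c"
  shows "\<exists>M>0. \<forall>r>0. (\<forall>l. 0 < l \<longrightarrow> l \<le> 1 \<longrightarrow> c * l powr \<beta> * h (l * r) \<le> h r) \<longrightarrow>
    nuint (\<lambda>z. indicator (ball 0 r) z * norm z) \<le> ennreal (M * r * h r)"
proof -
  define G where "G = (\<Sum>k. (2 powr (- (1 - \<beta>))) ^ k :: real)"
  have G: "0 \<le> G" "summable (\<lambda>k. (2 powr (- (1 - \<beta>))) ^ k :: real)" using geom_powr[of "1 - \<beta>"] b by (auto simp: G_def)
  have "nuint (\<lambda>z. indicator (ball 0 r) z * norm z) \<le> ennreal (2 powr \<beta> / c * G * r * h r)"
    if r: "0 < r" and sc: "\<And>l. 0 < l \<Longrightarrow> l \<le> 1 \<Longrightarrow> c * l powr \<beta> * h (l * r) \<le> h r" for r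
  proof -
    let ?b = "\<lambda>k. (2 powr \<beta> / c * r * h r) * (2 powr (- (1 - \<beta>))) ^ k"
    have "nuint (\<lambda>z. indicator (ball 0 r) z * norm z) \<le> ennreal (suminf ?b)"
    proof (rule nuint_dyadic[where a = "\<lambda>k. (1/2) ^ k * r" and s = "\<lambda>k. (1/2) ^ Suc k * r"])
      fix z :: 'a
      show "\<exists>k. indicator (ball 0 r) z * norm z \<le> (1/2) ^ k * r * indicator (- ball 0 ((1/2) ^ Suc k * r)) z"
      proof (cases "z = 0 \<or> r \<le> norm z")
        case True then show ?thesis using r by (intro exI[of _ 0]) auto
      next
        case False
        then have z: "0 < norm z" "norm z < r" by auto
        have ex: "\<exists>n. (1/2) ^ n * r \<le> norm z"
        proof -
          obtain n where "(1/2::real) ^ n < norm z / r" using real_arch_pow_inv[of "norm z / r" "1/2"] z r by auto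
          then show ?thesis using r by (intro exI[of _ n]) (simp add: field_simps)
        qed
        \<comment> \<open>The first dyadic radius not exceeding |z|; its predecessor still exceeds
          |z|, which brackets z in one shell.\<close>
        define n where "n = (LEAST n. (1/2) ^ n * r \<le> norm z)"
        have n: "(1/2) ^ n * r \<le> norm z" unfolding n_def using LeastI_ex[OF ex] .
        have "n \<noteq> 0" using n z by (intro notI) simp
        then obtain k where k: "n = Suc k" using not0_implies_Suc by blast
        have "\<not> (1/2) ^ k * r \<le> norm z" using not_less_Least[of k "\<lambda>n. (1/2) ^ n * r \<le> norm z"] k by (simp add: n_def)
        then show ?thesis using n z by (intro exI[of _ k]) (auto simp: k)
      qed
    next
      fix k
      have l: "0 < (1/2::real) ^ Suc k" "(1/2::real) ^ Suc k \<le> 1" by (auto simp del: power_Suc intro: power_le_one)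
      have "((1/2::real) ^ Suc k) powr \<beta> = (2 powr (- \<beta>)) ^ Suc k"
        by (simp add: powr_realpow[symmetric] powr_powr powr_divide powr_minus_divide power_divide mult.commute del: power_Suc of_nat_Suc)
      then have "h ((1/2) ^ Suc k * r) \<le> h r / (c * (2 powr (- \<beta>)) ^ Suc k)"
        using sc[OF l] c by (simp add: field_simps del: power_Suc)
      also have "\<dots> = h r / c * (2 powr \<beta>) ^ Suc k"
        by (simp add: powr_minus_divide power_divide del: power_Suc)
      finally have "(1/2) ^ k * r * h ((1/2) ^ Suc k * r) \<le> (1/2) ^ k * r * (h r / c * (2 powr \<beta>) ^ Suc k)"
        using r by (intro mult_left_mono) auto
      also have "\<dots> = (2 powr \<beta> / c * r * h r) * (1/2 * 2 powr \<beta>) ^ k" by (simp only: power_mult_distrib power_Suc) simp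
      also have "1/2 * 2 powr \<beta> = 2 powr (- (1 - \<beta>))" by (simp add: powr_diff powr_minus_divide)
      finally show "(1/2) ^ k * r * h ((1/2) ^ Suc k * r) \<le> ?b k" .
    next
      show "summable ?b" using G by (intro summable_mult)
    qed (use r in auto)
    also have "suminf ?b = 2 powr \<beta> / c * r * h r * G" unfolding G_def using G by (intro suminf_mult) auto
    finally show ?thesis by (simp add: mult_ac)
  qed
  \<comment> \<open>Adding 1 makes the constant positive without a separate argument that G
    is.\<close>
  moreover have "ennreal (2 powr \<beta> / c * G * r * h r) \<le> ennreal ((2 powr \<beta> / c * G + 1) * r * h r)" if "0 < r" for r
    using that h_pos[OF that] by (intro ennreal_leI) (simp add: algebra_simps)
  moreover have "0 < 2 powr \<beta> / c * G + 1" using c G by (intro add_nonneg_pos) auto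
  ultimately show ?thesis
    by (intro exI[of _ "2 powr \<beta> / c * G + 1"]) (blast intro: order_trans)
qed

text \<open>The mirror image of \<open>moment_small\<close>: going outward, the shell of radius 2^k
  r contributes about 2^(-k (\<alpha> - 1)) r h(r), and \<alpha> > 1 gives convergence.\<close>

lemma moment_large:
  assumes a: "1 < \<alpha>" and C: "1 \<le> C"
  shows "\<exists>M>0. \<forall>r>0. (\<forall>k::nat. 2 ^ k * r \<le> 1 \<longrightarrow> h (2 ^ k * r) \<le> C * (1 / 2 ^ k) powr \<alpha> * h r) \<longrightarrow>
    nuint (\<lambda>z. indicator (ball 0 1 - ball 0 r) z * norm z) \<le> ennreal (M * r * h r)"
proof -
  define G where "G = (\<Sum>k. (2 powr (- (\<alpha> - 1))) ^ k :: real)"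
  have G: "0 \<le> G" "summable (\<lambda>k. (2 powr (- (\<alpha> - 1))) ^ k :: real)" using geom_powr[of "\<alpha> - 1"] a by (auto simp: G_def)
  have "nuint (\<lambda>z. indicator (ball 0 1 - ball 0 r) z * norm z) \<le> ennreal (2 * C * G * r * h r)"
    if r: "0 < r" and sc: "\<And>k::nat. 2 ^ k * r \<le> 1 \<Longrightarrow> h (2 ^ k * r) \<le> C * (1 / 2 ^ k) powr \<alpha> * h r" for r
  proof -
    let ?b = "\<lambda>k. (2 * C * r * h r) * (2 powr (- (\<alpha> - 1))) ^ k"
    \<comment> \<open>The weight is set to 0 once 2^k r exceeds 1: scaling is not assumed there, and
      no z of the unit ball lies in such a shell.\<close>
    have "nuint (\<lambda>z. indicator (ball 0 1 - ball 0 r) z * norm z) \<le> ennreal (suminf ?b)"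
    proof (rule nuint_dyadic[where a = "\<lambda>k. if 2 ^ k * r \<le> 1 then 2 ^ Suc k * r else 0" and s = "\<lambda>k. 2 ^ k * r"])
      fix z :: 'a
      show "\<exists>k. indicator (ball 0 1 - ball 0 r) z * norm z \<le> (if 2 ^ k * r \<le> 1 then 2 ^ Suc k * r else 0) * indicator (- ball 0 (2 ^ k * r)) z"
      proof (cases "norm z < r \<or> 1 \<le> norm z")
        case True then show ?thesis using r by (intro exI[of _ 0]) auto
      next
        case False
        then have z: "r \<le> norm z" "norm z < 1" by auto
        have ex: "\<exists>n. norm z < 2 ^ n * r"
        proof -
          obtain n where "norm z / r < (2::real) ^ n" using real_arch_pow[of "2::real" "norm z / r"] by auto
          then show ?thesis using r by (intro exI[of _ n]) (simp add: field_simps)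
        qed
        define n where "n = (LEAST n. norm z < 2 ^ n * r)"
        have n: "norm z < 2 ^ n * r" unfolding n_def using LeastI_ex[OF ex] .
        have "n \<noteq> 0" using n z by (intro notI) simp
        then obtain k where k: "n = Suc k" using not0_implies_Suc by blast
        have "\<not> norm z < 2 ^ k * r" using not_less_Least[of k "\<lambda>n. norm z < 2 ^ n * r"] k by (simp add: n_def)
        then show ?thesis using n z by (intro exI[of _ k]) (auto simp: k)
      qed
    next
      fix k
      show "(if 2 ^ k * r \<le> 1 then 2 ^ Suc k * r else 0) * h (2 ^ k * r) \<le> ?b k"
      proof (cases "2 ^ k * r \<le> 1")
        case True
        have "2 ^ Suc k * r * h (2 ^ k * r) \<le> 2 ^ Suc k * r * (C * (1 / 2 ^ k) powr \<alpha> * h r)"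
          using r True by (intro mult_left_mono sc) auto
        also have "(1 / 2 ^ k) powr \<alpha> = (2 powr (- \<alpha>)) ^ k"
          by (simp add: powr_realpow[symmetric] powr_powr powr_divide powr_minus_divide power_divide mult.commute)
        also have "2 ^ Suc k * r * (C * (2 powr (- \<alpha>)) ^ k * h r) = (2 * C * r * h r) * (2 * 2 powr (- \<alpha>)) ^ k"
          by (simp add: power_mult_distrib)
        also have "2 * 2 powr (- \<alpha>) = 2 powr (- (\<alpha> - 1))" by (simp add: powr_diff powr_minus_divide)
        finally show ?thesis using True by simp
      next
        case False
        then show ?thesis using C r by (simp add: h_nonneg)
      qed
    next
      show "summable ?b" using G by (intro summable_mult)
    qed (use r in auto)
    also have "suminf ?b = 2 * C * r * h r * G" unfolding G_def using G by (intro suminf_mult) auto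
    finally show ?thesis by (simp add: mult_ac)
  qed
  moreover have "ennreal (2 * C * G * r * h r) \<le> ennreal ((2 * C * G + 1) * r * h r)" if "0 < r" for r
    using that h_pos[OF that] by (intro ennreal_leI) (simp add: algebra_simps)
  moreover have "0 < 2 * C * G + 1" using C G by (intro add_nonneg_pos) auto
  ultimately show ?thesis
    by (intro exI[of _ "2 * C * G + 1"]) (blast intro: order_trans)
qed

end

context levy_scaling
begin

text \<open>Only jumps shorter than s = 1/|\<xi>| are kept, where 1 - cos is quadratic.
  \<open>nuint_direction\<close> then leaves K(s) / (4 d^2); K(s) is comparable with h(s), and
  scaling from s up to r produces the factor (r |\<xi>|)^\<alpha>.\<close>

lemma symbol_lower:
  assumes r: "0 < r" "r \<le> R" and xi: "1 \<le> r * norm \<xi>"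
  shows "ennreal (1 / (4 * (real DIM('a))\<^sup>2 * CK * C) * (r * norm \<xi>) powr \<alpha> * h r) \<le> nuint (\<lambda>z. indicator (ball 0 r) z * (1 - cos (\<xi> \<bullet> z)))"
proof -
  let ?d = "real DIM('a)"
  define s where "s = 1 / norm \<xi>"
  have xi0: "0 < norm \<xi>" using xi r by (auto intro: ccontr)
  have s: "0 < s" "s \<le> r" using xi xi0 by (auto simp: s_def field_simps)
  have "1 / (4 * ?d\<^sup>2 * CK * C) * (r * norm \<xi>) powr \<alpha> * h r \<le> 1 / 4 * ((norm \<xi>)\<^sup>2 / ?d\<^sup>2 * (s\<^sup>2 * K s))"
  proof -
    have "h r \<le> C * (s / r) powr \<alpha> * h (s / r * r)" using s r by (intro scale) auto
    then have "h r \<le> C * (s / r) powr \<alpha> * (CK * K s)" using h_le_CK[of s] s r C1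
      by (auto intro: order_trans mult_left_mono)
    also have "s / r = 1 / (r * norm \<xi>)" by (simp add: s_def)
    also have "(1 / (r * norm \<xi>)) powr \<alpha> = 1 / (r * norm \<xi>) powr \<alpha>" using r by (simp add: powr_divide)
    finally have "(r * norm \<xi>) powr \<alpha> * h r \<le> C * CK * K s" using xi0 r by (simp add: field_simps)
    moreover have "(norm \<xi>)\<^sup>2 * s\<^sup>2 = 1" using xi0 by (simp add: s_def power_divide)
    ultimately show ?thesis using C1 CK1 by (simp add: field_simps)
  qed
  then have "ennreal (1 / (4 * ?d\<^sup>2 * CK * C) * (r * norm \<xi>) powr \<alpha> * h r) \<le> ennreal (1 / 4 * ((norm \<xi>)\<^sup>2 / ?d\<^sup>2 * (s\<^sup>2 * K s)))"
    by (rule ennreal_leI)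
  also have "\<dots> = ennreal (1/4) * ennreal ((norm \<xi>)\<^sup>2 / ?d\<^sup>2 * (s\<^sup>2 * K s))" by (rule ennreal_mult'') (simp add: K_nonneg)
  also have "\<dots> \<le> ennreal (1/4) * nuint (\<lambda>z. indicator (ball 0 s) z * (\<xi> \<bullet> z)\<^sup>2)"
    using nuint_direction[OF s(1), of \<xi>] by (intro mult_left_mono) auto
  also have "\<dots> = nuint (\<lambda>z. 1/4 * (indicator (ball 0 s) z * (\<xi> \<bullet> z)\<^sup>2))" by (intro nuint_cmult[symmetric]) auto
  also have "\<dots> \<le> nuint (\<lambda>z. indicator (ball 0 r) z * (1 - cos (\<xi> \<bullet> z)))"
  proof (rule nuint_mono)
    fix z
    have "norm z < s \<Longrightarrow> (\<xi> \<bullet> z)\<^sup>2 / 4 \<le> 1 - cos (\<xi> \<bullet> z)"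
    proof (rule one_minus_cos_ge)
      assume "norm z < s"
      then have "norm \<xi> * norm z \<le> norm \<xi> * s" by (intro mult_left_mono) auto
      also have "\<dots> = 1" using xi0 by (simp add: s_def)
      finally show "\<bar>\<xi> \<bullet> z\<bar> \<le> 1" using Cauchy_Schwarz_ineq2[of \<xi> z] by linarith
    qed
    then show "1/4 * (indicator (ball 0 s) z * (\<xi> \<bullet> z)\<^sup>2) \<le> indicator (ball 0 r) z * (1 - cos (\<xi> \<bullet> z))"
      using s(2) by (auto simp: indicator_def)
  qed
  finally show ?thesis .
qed

end

section \<open>Entire multipliers and the contour shift\<close>

text \<open>Used for the holomorphy of the small-jump exponent and for the gradient of the heat
  kernel. In both places a Taylor bound inside the integral gives the quadratic remainder, which
  avoids differentiating under the integral sign.\<close>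

lemma has_derivative_quadratic:
  fixes f :: "'a::real_normed_vector \<Rightarrow> 'b::real_normed_vector"
  assumes L: "bounded_linear L" and e: "0 < e"
    and q: "\<And>v. norm v \<le> e \<Longrightarrow> norm (f (x + v) - f x - L v) \<le> C * (norm v)\<^sup>2"
  shows "(f has_derivative L) (at x)"
  unfolding has_derivative_at
proof (intro conjI L)
  have "((\<lambda>v::'a. C * norm v) \<longlongrightarrow> C * norm (0::'a)) (at 0)" by (intro tendsto_intros)
  then have t: "((\<lambda>v::'a. C * norm v) \<longlongrightarrow> 0) (at 0)" by simp
  have "\<forall>\<^sub>F v in at (0::'a). norm v < e"
    using order_tendstoD(2)[OF tendsto_norm[OF tendsto_ident_at[of "0::'a" UNIV]], of e] e by simp
  then have "\<forall>\<^sub>F v in at (0::'a). norm (norm (f (x + v) - f x - L v) / norm v) \<le> C * norm v"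
  proof eventually_elim
    case (elim v)
    then show ?case using q[of v] by (cases "v = 0") (auto simp: field_simps power2_eq_square)
  qed
  then show "((\<lambda>v. norm (f (x + v) - f x - L v) / norm v) \<longlongrightarrow> 0) (at 0)" by (rule Lim_null_comparison[OF _ t])
qed

text \<open>Cauchy's inequality on discs of radius b/2 bounds the second derivative by 2 B /
  (b/2)^2. For centres within b/4 of z0 these discs stay inside the region where the bound B is
  known.\<close>

lemma entire_first_order_remainder:
  assumes hol: "f holomorphic_on UNIV" and b: "0 < b" and B: "\<And>w. w \<in> ball z0 b \<Longrightarrow> norm (f w) \<le> B"
    and v: "norm v \<le> b / 4"
  shows "norm (f (z0 + v) - f z0 - v * deriv f z0) \<le> 8 * B / b\<^sup>2 * (norm v)\<^sup>2"
proof -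
  have d: "((deriv ^^ i) f has_field_derivative (deriv ^^ Suc i) f w) (at w within cball z0 (b/4))" for i w
    using holomorphic_derivI[OF holomorphic_higher_deriv[OF hol open_UNIV, of i] open_UNIV UNIV_I]
    by (auto intro: has_field_derivative_at_within)
  have "norm ((deriv ^^ 2) f w) \<le> 8 * B / b\<^sup>2" if w: "w \<in> cball z0 (b/4)" for w
  proof -
    have "norm ((deriv ^^ 2) f w) \<le> fact 2 * B / (b/2) ^ 2"
    proof (rule Cauchy_inequality)
      show "f holomorphic_on ball w (b/2)" using hol holomorphic_on_subset by blast
      show "continuous_on (cball w (b/2)) f"
        using holomorphic_on_imp_continuous_on[OF hol] continuous_on_subset by blast
      show "norm (f x) \<le> B" if "norm (w - x) = b/2" for x
      proof (rule B)
        have "dist z0 x \<le> dist z0 w + dist w x" by (rule dist_triangle)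
        also have "\<dots> \<le> b/4 + b/2" using w that by (auto simp: dist_norm)
        finally show "x \<in> ball z0 b" using b by simp
      qed
    qed (use b in auto)
    also have "\<dots> = 8 * B / b\<^sup>2" using b by (simp add: power_divide)
    finally show ?thesis .
  qed
  then have "norm ((deriv ^^ 0) f (z0 + v) - (\<Sum>i\<le>1. (deriv ^^ i) f z0 * (z0 + v - z0) ^ i / fact i)) \<le> 8 * B / b\<^sup>2 * norm (z0 + v - z0) ^ Suc 1 / fact 1"
    using b v by (intro complex_Taylor[where S = "cball z0 (b/4)"] d) (auto simp: numeral_2_eq_2 dist_norm)
  then show ?thesis by (simp add: algebra_simps power2_eq_square)
qed

lemma integral_lborel_translate:
  fixes f :: "'a::euclidean_space \<Rightarrow> 'b::{banach,second_countable_topology}"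
  assumes [measurable]: "f \<in> borel_measurable borel"
  shows "(LBINT x. f (x + c)) = (LBINT x. f x)" "integrable lborel (\<lambda>x. f (x + c)) \<longleftrightarrow> integrable lborel f"
proof -
  have "(LBINT x. f x) = (\<integral>x. f x \<partial>(distr lborel borel ((+) c)))" by (simp add: lborel_distr_plus)
  also have "\<dots> = (LBINT x. f (c + x))" by (subst integral_distr) auto
  finally show "(LBINT x. f (x + c)) = (LBINT x. f x)" by (simp add: add.commute)
  have "integrable lborel f \<longleftrightarrow> integrable (distr lborel borel ((+) c)) f" by (simp add: lborel_distr_plus)
  also have "\<dots> \<longleftrightarrow> integrable lborel (\<lambda>x. f (c + x))" by (subst integrable_distr_eq) auto
  finally show "integrable lborel (\<lambda>x. f (x + c)) \<longleftrightarrow> integrable lborel f" by (simp add: add.commute)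
qed

text \<open>No path integral is needed: over a step of length \<open>\<delta>\<close> the imaginary increment of an entire
  function is \<open>\<i>\<close> times its real increment up to \<open>O(\<delta>\<^sup>2)\<close>, and the real increment integrates to zero by
  translation invariance.\<close>

lemma contour_shift:
  fixes H :: "'a::euclidean_space \<Rightarrow> 'a \<Rightarrow> complex"
  assumes b: "0 < b"
    and hol: "\<And>\<xi>. (\<lambda>s. H (\<xi> + Re s *\<^sub>R e) (Im s *\<^sub>R e)) holomorphic_on UNIV"
    and meas [measurable]: "\<And>\<eta>. (\<lambda>\<xi>. H \<xi> \<eta>) \<in> borel_measurable borel"
    and g: "integrable lborel g"
    and bd: "\<And>\<xi> s. \<bar>Re s\<bar> \<le> b \<Longrightarrow> \<bar>Im s\<bar> \<le> 2 * b \<Longrightarrow> norm (H (\<xi> + Re s *\<^sub>R e) (Im s *\<^sub>R e)) \<le> g \<xi>"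
  shows "(LBINT \<xi>. H \<xi> 0) = (LBINT \<xi>. H \<xi> (b *\<^sub>R e))"
proof -
  define I where "I = (\<lambda>\<sigma>. \<integral>\<xi>. H \<xi> (\<sigma> *\<^sub>R e) \<partial>lborel)"
  define G where "G = (LBINT \<xi>. g \<xi>)"
  have int: "integrable lborel (\<lambda>\<xi>. H \<xi> (\<sigma> *\<^sub>R e))" if "\<bar>\<sigma>\<bar> \<le> 2 * b" for \<sigma>
  proof (rule Bochner_Integration.integrable_bound[OF g])
    show "AE \<xi> in lborel. norm (H \<xi> (\<sigma> *\<^sub>R e)) \<le> norm (g \<xi>)"
      using bd[of "Complex 0 \<sigma>"] that b by (intro AE_I2) (auto intro: order_trans[OF _ abs_ge_self])
  qed measurable
  \<comment> \<open>The Cauchy discs of radius b are centred at heights \<sigma> up to b, which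
    explains why the majorant must hold up to height 2 b although the contour moves only by
    b.\<close>
  have step: "norm (I (\<sigma> + \<delta>) - I \<sigma>) \<le> 16 * \<delta>\<^sup>2 / b\<^sup>2 * G" if s: "0 \<le> \<sigma>" "\<sigma> \<le> b" and d: "0 < \<delta>" "\<delta> \<le> b / 4" for \<sigma> \<delta>
  proof -
    let ?h = "\<lambda>\<xi>. H \<xi> ((\<sigma> + \<delta>) *\<^sub>R e) - H \<xi> (\<sigma> *\<^sub>R e) - \<i> * (H (\<xi> + \<delta> *\<^sub>R e) (\<sigma> *\<^sub>R e) - H \<xi> (\<sigma> *\<^sub>R e))"
    have i1: "integrable lborel (\<lambda>\<xi>. H \<xi> (\<sigma> *\<^sub>R e))" "integrable lborel (\<lambda>\<xi>. H \<xi> ((\<sigma> + \<delta>) *\<^sub>R e))"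
      using s d by (auto intro!: int)
    have i2: "integrable lborel (\<lambda>\<xi>. H (\<xi> + \<delta> *\<^sub>R e) (\<sigma> *\<^sub>R e))" "(LBINT \<xi>. H (\<xi> + \<delta> *\<^sub>R e) (\<sigma> *\<^sub>R e)) = I \<sigma>"
      using integral_lborel_translate[of "\<lambda>\<xi>. H \<xi> (\<sigma> *\<^sub>R e)" "\<delta> *\<^sub>R e"] i1 by (auto simp: I_def)
    have "I (\<sigma> + \<delta>) - I \<sigma> = (LBINT \<xi>. ?h \<xi>)"
      using i1 i2 by (simp add: I_def)
    also have "norm \<dots> \<le> (LBINT \<xi>. 16 * \<delta>\<^sup>2 / b\<^sup>2 * g \<xi>)"
    proof (rule Bochner_Integration.integral_norm_bound_integral)
      show "integrable lborel ?h" using i1 i2 by auto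
      show "integrable lborel (\<lambda>\<xi>. 16 * \<delta>\<^sup>2 / b\<^sup>2 * g \<xi>)" using g by auto
      fix \<xi>
      define \<Phi> where "\<Phi> = (\<lambda>s. H (\<xi> + Re s *\<^sub>R e) (Im s *\<^sub>R e))"
      have rem: "norm (\<Phi> (Complex 0 \<sigma> + v) - \<Phi> (Complex 0 \<sigma>) - v * deriv \<Phi> (Complex 0 \<sigma>)) \<le> 8 * g \<xi> / b\<^sup>2 * (norm v)\<^sup>2"
        if "norm v \<le> b / 4" for v
      proof (rule entire_first_order_remainder[OF _ b _ that])
        show "\<Phi> holomorphic_on UNIV" unfolding \<Phi>_def by (rule hol)
        fix w assume w: "w \<in> ball (Complex 0 \<sigma>) b"
        have "\<bar>Re w\<bar> \<le> norm (w - Complex 0 \<sigma>)" using abs_Re_le_cmod[of "w - Complex 0 \<sigma>"] by simp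
        moreover have "\<bar>Im w - \<sigma>\<bar> \<le> norm (w - Complex 0 \<sigma>)" using abs_Im_le_cmod[of "w - Complex 0 \<sigma>"] by simp
        ultimately show "norm (\<Phi> w) \<le> g \<xi>"
          unfolding \<Phi>_def using w s by (intro bd) (auto simp: dist_norm norm_minus_commute)
      qed
      have "?h \<xi> = (\<Phi> (Complex 0 \<sigma> + \<i> * \<delta>) - \<Phi> (Complex 0 \<sigma>) - \<i> * \<delta> * deriv \<Phi> (Complex 0 \<sigma>))
          - \<i> * (\<Phi> (Complex 0 \<sigma> + \<delta>) - \<Phi> (Complex 0 \<sigma>) - \<delta> * deriv \<Phi> (Complex 0 \<sigma>))"
        by (simp add: \<Phi>_def algebra_simps)
      also have "norm \<dots> \<le> 8 * g \<xi> / b\<^sup>2 * (norm (\<i> * complex_of_real \<delta>))\<^sup>2 + 8 * g \<xi> / b\<^sup>2 * (norm (complex_of_real \<delta>))\<^sup>2"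
      proof -
        have tri: "norm (x - \<i> * y) \<le> norm x + norm y" for x y :: complex
          using norm_triangle_ineq4[of x "\<i> * y"] by (simp add: norm_mult)
        have "norm (\<i> * complex_of_real \<delta>) \<le> b / 4" "norm (complex_of_real \<delta>) \<le> b / 4"
          using d by (auto simp: norm_mult)
        then show ?thesis by (intro order_trans[OF tri] add_mono rem)
      qed
      also have "\<dots> = 16 * \<delta>\<^sup>2 / b\<^sup>2 * g \<xi>" by (simp add: norm_mult)
      finally show "norm (?h \<xi>) \<le> 16 * \<delta>\<^sup>2 / b\<^sup>2 * g \<xi>" .
    qed
    also have "\<dots> = 16 * \<delta>\<^sup>2 / b\<^sup>2 * G" by (simp add: G_def)
    finally show ?thesis .
  qed
  have tel: "norm (I b - I 0) \<le> 16 * G / real n" if n: "4 \<le> n" for n :: nat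
  proof -
    define \<delta> where "\<delta> = b / real n"
    have d: "0 < \<delta>" "\<delta> \<le> b / 4" unfolding \<delta>_def using n b by (simp, intro divide_left_mono) auto
    have "I b - I 0 = (\<Sum>k<n. I (real (Suc k) * \<delta>) - I (real k * \<delta>))"
      using n by (subst sum_lessThan_telescope) (auto simp: \<delta>_def)
    also have "norm \<dots> \<le> (\<Sum>k<n. 16 * \<delta>\<^sup>2 / b\<^sup>2 * G)"
    proof (rule order_trans[OF norm_sum sum_mono])
      fix k assume k: "k \<in> {..<n}"
      have "real k * \<delta> \<le> real n * \<delta>" using k d by (intro mult_right_mono) auto
      also have "\<dots> = b" using n by (simp add: \<delta>_def)
      finally show "norm (I (real (Suc k) * \<delta>) - I (real k * \<delta>)) \<le> 16 * \<delta>\<^sup>2 / b\<^sup>2 * G"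
        using step[of "real k * \<delta>" \<delta>] d by (simp add: algebra_simps)
    qed
    also have "\<dots> = 16 * G / real n" using n b by (simp add: \<delta>_def power_divide power2_eq_square)
    finally show ?thesis .
  qed
  have "(\<lambda>n. 16 * G / real n) \<longlonglongrightarrow> 0" by (rule lim_const_over_n)
  then have "norm (I b - I 0) \<le> 0"
    by (rule LIMSEQ_le_const) (use tel in auto)
  then show ?thesis by (simp add: I_def)
qed

section \<open>Elementary bounds for exponentials\<close>

lemma two_pi_power_ge_1: "1 \<le> (2 * pi) ^ n"
  using pi_ge_two by (intro one_le_power) linarith

lemma abs_Re_divide_le: assumes "1 \<le> u" shows "\<bar>Re v / u\<bar> \<le> norm v"
proof -
  have "\<bar>Re v\<bar> / u \<le> \<bar>Re v\<bar> / 1" using assms by (intro divide_left_mono) auto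
  then show ?thesis using abs_Re_le_cmod[of v] assms by (simp add: abs_divide)
qed

lemma norm_exp_i_minus_1: "norm (exp (\<i> * \<zeta>) - 1) \<le> norm \<zeta> * exp \<bar>Im \<zeta>\<bar>"
  using Taylor_exp[of "\<i> * \<zeta>" 0] by (simp add: norm_mult mult.commute)

lemma norm_exp_i_minus_2: "norm (exp (\<i> * \<zeta>) - 1 - \<i> * \<zeta>) \<le> (norm \<zeta>)\<^sup>2 * exp \<bar>Im \<zeta>\<bar>"
  using Taylor_exp[of "\<i> * \<zeta>" 1] by (simp add: norm_mult mult.commute power2_eq_square diff_diff_eq add.commute)

lemma norm_cos_minus_1: "norm (cos \<zeta> - 1) \<le> (norm \<zeta>)\<^sup>2 * exp \<bar>Im \<zeta>\<bar>" for \<zeta> :: complex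
proof -
  have "cos \<zeta> - 1 = ((exp (\<i> * \<zeta>) - 1 - \<i> * \<zeta>) + (exp (\<i> * (- \<zeta>)) - 1 - \<i> * (- \<zeta>))) / 2"
    by (simp add: cos_exp_eq field_simps)
  also have "norm \<dots> \<le> (norm \<zeta>)\<^sup>2 * exp \<bar>Im \<zeta>\<bar>"
    using norm_exp_i_minus_2[of \<zeta>] norm_exp_i_minus_2[of "- \<zeta>"]
      norm_triangle_ineq[of "exp (\<i> * \<zeta>) - 1 - \<i> * \<zeta>" "exp (\<i> * (- \<zeta>)) - 1 - \<i> * (- \<zeta>)"]
    by (simp add: norm_divide)
  finally show ?thesis .
qed

text \<open>With \<zeta> = p + i q the left side is -exp(-q) (1 - cos p) + (exp(-q) - 1 + q). The
  first part shows that the decay in the frequency survives the shift, the second that the shift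
  costs only O(q^2). The range |q| \<le> 2 is what jumps up to r and shifts up to 2/r
  produce.\<close>

lemma Re_exp_i_minus_2:
  assumes "\<bar>Im \<zeta>\<bar> \<le> 2"
  shows "Re (exp (\<i> * \<zeta>) - 1 - \<i> * \<zeta>) \<le> - (exp (- 2) * (1 - cos (Re \<zeta>))) + exp 2 * (Im \<zeta>)\<^sup>2"
proof -
  define q where "q = Im \<zeta>"
  have q: "\<bar>q\<bar> \<le> 2" using assms by (simp add: q_def)
  have "norm (exp (\<i> * (\<i> * q)) - 1 - \<i> * (\<i> * complex_of_real q)) \<le> q\<^sup>2 * exp \<bar>q\<bar>"
    using norm_exp_i_minus_2[of "\<i> * complex_of_real q" for q] by (metis Im_i_times Re_complex_of_real norm_ii norm_mult norm_of_real mult_1 power2_abs)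
  also have "exp (\<i> * (\<i> * q)) - 1 - \<i> * (\<i> * complex_of_real q) = complex_of_real (exp (- q) - 1 + q)"
    by (simp add: exp_of_real[symmetric] mult.assoc[symmetric])
  finally have "exp (- q) - 1 + q \<le> q\<^sup>2 * exp \<bar>q\<bar>" by (simp only: norm_of_real)
  also have "\<dots> \<le> q\<^sup>2 * exp 2" using q by (intro mult_left_mono) auto
  finally have 1: "exp (- q) - 1 + q \<le> exp 2 * q\<^sup>2" by (simp add: mult.commute)
  have 2: "exp (- 2) * (1 - cos (Re \<zeta>)) \<le> exp (- q) * (1 - cos (Re \<zeta>))"
    using q by (intro mult_right_mono) auto
  have "Re (exp (\<i> * \<zeta>) - 1 - \<i> * \<zeta>) = exp (- q) * cos (Re \<zeta>) - 1 + q"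
    by (simp add: Re_exp q_def)
  also have "\<dots> = - (exp (- q) * (1 - cos (Re \<zeta>))) + (exp (- q) - 1 + q)" by (simp add: algebra_simps)
  finally show ?thesis using 1 2 unfolding q_def by linarith
qed

lemma power_div_fact_le_exp: assumes "0 \<le> y" shows "y ^ k / fact k \<le> exp (y::real)"
proof -
  have "(\<Sum>i\<in>{k}. y ^ i /\<^sub>R fact i) \<le> (\<Sum>i. y ^ i /\<^sub>R fact i)"
    using assms by (intro sum_le_suminf summable_exp_generic) auto
  then show ?thesis by (simp add: exp_def field_simps)
qed

text \<open>Choose k with k \<alpha> \<ge> n and use exp(-y) \<le> k! / y^k. The exponent is cut off
  below x = 1 because \<open>symbol_lower\<close> says nothing for r |\<xi>| < 1.\<close>

lemma poly_exp_bound: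
  assumes "0 < \<alpha>" "0 < c"
  shows "\<exists>B>0. \<forall>x\<ge>0. (1 + x) ^ n * exp (- c * (if 1 \<le> x then x powr \<alpha> else 0)) \<le> (B::real)"
proof -
  obtain k :: nat where k: "real n / \<alpha> \<le> real k" using real_arch_simple by blast
  define B where "B = 2 ^ n * max 1 (fact k / c ^ k)"
  have "(1 + x) ^ n * exp (- c * (if 1 \<le> x then x powr \<alpha> else 0)) \<le> B" if x: "0 \<le> x" for x
  proof (cases "1 \<le> x")
    case False
    then have "(1 + x) ^ n \<le> 2 ^ n" using x by (intro power_mono) auto
    also have "\<dots> \<le> B" by (simp add: B_def)
    finally show ?thesis using False by simp
  next
    case True
    define y where "y = c * x powr \<alpha>"
    have y: "0 < y" using assms True by (simp add: y_def)
    have "y ^ k / fact k \<le> exp y" using y by (intro power_div_fact_le_exp) auto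
    then have e: "exp (- y) \<le> fact k / y ^ k" using y by (simp add: exp_minus field_simps)
    have "real n \<le> \<alpha> * real k" using k assms by (simp add: field_simps)
    then have "x ^ n \<le> x powr (\<alpha> * real k)" using True by (simp add: powr_realpow[symmetric] powr_mono)
    also have "\<dots> = (x powr \<alpha>) ^ k" using True by (simp add: powr_powr[symmetric] powr_realpow)
    finally have xn: "x ^ n \<le> (x powr \<alpha>) ^ k" .
    have "(1 + x) ^ n * exp (- y) \<le> (2 * x) ^ n * (fact k / y ^ k)"
      using True e by (intro mult_mono power_mono) auto
    also have "\<dots> \<le> 2 ^ n * (x powr \<alpha>) ^ k * (fact k / y ^ k)"
      unfolding power_mult_distrib using y by (intro mult_right_mono mult_left_mono xn) auto
    also have "\<dots> = 2 ^ n * (fact k / c ^ k)" using True assms by (simp add: y_def power_mult_distrib)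
    also have "\<dots> \<le> B" unfolding B_def by (intro mult_left_mono) auto
    finally show ?thesis using True by (simp add: y_def)
  qed
  moreover have "0 < B" by (simp add: B_def)
  ultimately show ?thesis by blast
qed

section \<open>Multipliers on a complex tube\<close>

definition cdot :: "'a::euclidean_space \<Rightarrow> 'a \<Rightarrow> 'a \<Rightarrow> complex" where
  "cdot z \<xi> \<eta> = Complex (z \<bullet> \<xi>) (z \<bullet> \<eta>)"

lemma cdot_line: "cdot z (\<xi> + Re s *\<^sub>R e) (Im s *\<^sub>R e) = complex_of_real (z \<bullet> \<xi>) + s * complex_of_real (z \<bullet> e)"
  by (simp add: cdot_def complex_eq_iff inner_add_right)

lemma cdot_0: "cdot z \<xi> 0 = complex_of_real (z \<bullet> \<xi>)" by (simp add: cdot_def complex_eq_iff)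

lemma norm_cdot: "norm (cdot z \<xi> \<eta>) \<le> norm z * (norm \<xi> + norm \<eta>)"
proof -
  have "norm (cdot z \<xi> \<eta>) \<le> \<bar>z \<bullet> \<xi>\<bar> + \<bar>z \<bullet> \<eta>\<bar>" using cmod_le[of "cdot z \<xi> \<eta>"] by (simp add: cdot_def)
  also have "\<dots> \<le> norm z * norm \<xi> + norm z * norm \<eta>" by (intro add_mono Cauchy_Schwarz_ineq2)
  finally show ?thesis by (simp add: distrib_left)
qed

lemma Im_cdot: "\<bar>Im (cdot z \<xi> \<eta>)\<bar> \<le> norm z * norm \<eta>"
  by (simp add: cdot_def Cauchy_Schwarz_ineq2)

lemma measurable_Complex [measurable]:
  assumes [measurable]: "f \<in> borel_measurable M" "g \<in> borel_measurable M"
  shows "(\<lambda>x. Complex (f x) (g x)) \<in> borel_measurable M"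
  unfolding Complex_eq by measurable

lemma measurable_cdot [measurable]:
  assumes [measurable]: "f \<in> borel_measurable M" "g \<in> borel_measurable M" "k \<in> borel_measurable M"
  shows "(\<lambda>x. cdot (f x) (g x) (k x)) \<in> borel_measurable M"
  unfolding cdot_def by measurable

lemma measurable_cis [measurable]:
  assumes [measurable]: "f \<in> borel_measurable M" shows "(\<lambda>x. cis (f x)) \<in> borel_measurable M"
  unfolding cis_conv_exp by measurable

text \<open>A complex frequency \<xi> + i \<eta> is kept as a pair of real vectors and paired
  bilinearly by \<open>cdot\<close>; analyticity is asked along complex lines in real directions
  only, which is all that \<open>contour_shift\<close> uses. The tube has radius 2/r, twice the
  final shift, as that lemma requires. Measuring \<xi> in units of 1/r makes B free of
  scale.\<close>

definition multiplier :: "real \<Rightarrow> nat \<Rightarrow> real \<Rightarrow> ('a::euclidean_space \<Rightarrow> 'a \<Rightarrow> complex) \<Rightarrow> bool" where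
  "multiplier r k B M \<longleftrightarrow>
     (\<forall>\<xi> e. (\<lambda>s. M (\<xi> + Re s *\<^sub>R e) (Im s *\<^sub>R e)) holomorphic_on UNIV) \<and>
     (\<forall>\<eta>. (\<lambda>\<xi>. M \<xi> \<eta>) \<in> borel_measurable borel) \<and> 0 \<le> B \<and>
     (\<forall>\<xi> \<eta>. norm \<eta> \<le> 2 / r \<longrightarrow> norm (M \<xi> \<eta>) \<le> B * (1 + r * norm \<xi>) ^ k)"

lemma multiplier_one: "multiplier r 0 1 (\<lambda>\<xi> \<eta>. 1)"
  by (auto simp: multiplier_def)

lemma multiplier_mult:
  assumes "multiplier r k B M" "multiplier r l D N" 
  shows "multiplier r (k + l) (B * D) (\<lambda>\<xi> \<eta>. M \<xi> \<eta> * N \<xi> \<eta>)"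
proof -
  have "norm (M \<xi> \<eta>) * norm (N \<xi> \<eta>) \<le> B * D * (1 + r * norm \<xi>) ^ (k + l)" if e: "norm \<eta> \<le> 2 / r" for \<xi> \<eta>
  proof -
    have M: "norm (M \<xi> \<eta>) \<le> B * (1 + r * norm \<xi>) ^ k" using assms(1) e by (auto simp: multiplier_def)
    have "norm (M \<xi> \<eta>) * norm (N \<xi> \<eta>) \<le> (B * (1 + r * norm \<xi>) ^ k) * (D * (1 + r * norm \<xi>) ^ l)"
      using assms e order_trans[OF norm_ge_zero M] by (intro mult_mono M) (auto simp: multiplier_def)
    then show ?thesis by (simp add: power_add mult_ac)
  qed
  then show ?thesis using assms by (auto simp: multiplier_def norm_mult intro!: holomorphic_on_mult borel_measurable_times)
qed

lemma tube_arg: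
  assumes "0 < r" "norm \<eta> \<le> 2 / r"
  shows "norm (cdot z \<xi> \<eta>) \<le> 2 * (norm z / r) * (1 + r * norm \<xi>)"
proof -
  have "norm (cdot z \<xi> \<eta>) \<le> norm z * (norm \<xi> + norm \<eta>)" by (rule norm_cdot)
  also have "\<dots> \<le> norm z * (2 * norm \<xi> + 2 / r)" using assms by (intro mult_left_mono add_mono) auto
  also have "\<dots> = 2 * (norm z / r) * (1 + r * norm \<xi>)" using assms by (simp add: field_simps)
  finally show ?thesis .
qed

lemma tube_Im:
  assumes "0 < r" "norm \<eta> \<le> 2 / r" "norm z \<le> r"
  shows "\<bar>Im (cdot z \<xi> \<eta>)\<bar> \<le> 2"
proof -
  have "norm z * norm \<eta> \<le> r * (2 / r)" using assms by (intro mult_mono) auto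
  then show ?thesis using Im_cdot[of z \<xi> \<eta>] assms by simp
qed

text \<open>In contrast to the exponential multipliers, z is not confined to the ball of radius r.
  In P1 this serves the compensator of jumps between r and 1.\<close>

lemma multiplier_linear:
  fixes z :: "'a::euclidean_space"
  assumes "0 < r" shows "multiplier r 1 (2 * (norm z / r)) (\<lambda>\<xi> \<eta>. \<i> * cdot z \<xi> \<eta>)"
  unfolding multiplier_def
proof (intro conjI allI impI)
  show "(\<lambda>s. \<i> * cdot z (\<xi> + Re s *\<^sub>R e) (Im s *\<^sub>R e)) holomorphic_on UNIV" for \<xi> e
    unfolding cdot_line by (intro holomorphic_intros)
qed (use assms tube_arg[OF assms] in \<open>auto simp: norm_mult\<close>)

text \<open>For |z| \<le> r the exponential is at most exp 2 on the tube. Applied with x' - x in the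
  role of z, this is also the origin of the factor |x' - x| / r in the second inequality.\<close>

lemma multiplier_exp1:
  fixes z :: "'a::euclidean_space"
  assumes "0 < r" "norm z \<le> r" shows "multiplier r 1 (2 * exp 2 * (norm z / r)) (\<lambda>\<xi> \<eta>. exp (\<i> * cdot z \<xi> \<eta>) - 1)"
  unfolding multiplier_def
proof (intro conjI allI impI)
  show "(\<lambda>s. exp (\<i> * cdot z (\<xi> + Re s *\<^sub>R e) (Im s *\<^sub>R e)) - 1) holomorphic_on UNIV" for \<xi> e
    unfolding cdot_line by (intro holomorphic_intros)
  fix \<xi> \<eta> :: 'a assume e: "norm \<eta> \<le> 2 / r"
  have "norm (exp (\<i> * cdot z \<xi> \<eta>) - 1) \<le> norm (cdot z \<xi> \<eta>) * exp \<bar>Im (cdot z \<xi> \<eta>)\<bar>" by (rule norm_exp_i_minus_1)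
  also have "\<dots> \<le> (2 * (norm z / r) * (1 + r * norm \<xi>)) * exp 2"
    using tube_arg[OF assms(1) e] tube_Im[OF assms(1) e assms(2)] assms by (intro mult_mono) auto
  finally show "norm (exp (\<i> * cdot z \<xi> \<eta>) - 1) \<le> 2 * exp 2 * (norm z / r) * (1 + r * norm \<xi>) ^ 1" by (simp only: power_one_right mult_ac)
qed (use assms in auto)

lemma tube_square:
  assumes "0 < r" "norm z \<le> r" "norm \<eta> \<le> 2 / r"
  shows "(norm (cdot z \<xi> \<eta>))\<^sup>2 * exp \<bar>Im (cdot z \<xi> \<eta>)\<bar> \<le> 4 * exp 2 * (norm z / r)\<^sup>2 * (1 + r * norm \<xi>) ^ 2"
proof -
  have "(norm (cdot z \<xi> \<eta>))\<^sup>2 * exp \<bar>Im (cdot z \<xi> \<eta>)\<bar> \<le> (2 * (norm z / r) * (1 + r * norm \<xi>))\<^sup>2 * exp 2"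
    using tube_arg[OF assms(1,3)] tube_Im[OF assms(1,3,2)] assms by (intro mult_mono power_mono) auto
  then show ?thesis by (simp only: power_mult_distrib) (simp add: mult_ac)
qed

lemma multiplier_exp2:
  fixes z :: "'a::euclidean_space"
  assumes "0 < r" "norm z \<le> r" shows "multiplier r 2 (4 * exp 2 * (norm z / r)\<^sup>2) (\<lambda>\<xi> \<eta>. exp (\<i> * cdot z \<xi> \<eta>) - 1 - \<i> * cdot z \<xi> \<eta>)"
  unfolding multiplier_def
proof (intro conjI allI impI)
  show "(\<lambda>s. exp (\<i> * cdot z (\<xi> + Re s *\<^sub>R e) (Im s *\<^sub>R e)) - 1 - \<i> * cdot z (\<xi> + Re s *\<^sub>R e) (Im s *\<^sub>R e)) holomorphic_on UNIV" for \<xi> e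
    unfolding cdot_line by (intro holomorphic_intros)
  fix \<xi> \<eta> :: 'a assume e: "norm \<eta> \<le> 2 / r"
  show "norm (exp (\<i> * cdot z \<xi> \<eta>) - 1 - \<i> * cdot z \<xi> \<eta>) \<le> 4 * exp 2 * (norm z / r)\<^sup>2 * (1 + r * norm \<xi>) ^ 2"
    using norm_exp_i_minus_2 tube_square[OF assms e] by (rule order_trans)
qed (use assms in auto)

lemma multiplier_cos:
  fixes z :: "'a::euclidean_space"
  assumes "0 < r" "norm z \<le> r" shows "multiplier r 2 (4 * exp 2 * (norm z / r)\<^sup>2) (\<lambda>\<xi> \<eta>. cos (cdot z \<xi> \<eta>) - 1)"
  unfolding multiplier_def
proof (intro conjI allI impI)
  show "(\<lambda>s. cos (cdot z (\<xi> + Re s *\<^sub>R e) (Im s *\<^sub>R e)) - 1) holomorphic_on UNIV" for \<xi> e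
    unfolding cdot_line by (intro holomorphic_intros)
  show "(\<lambda>\<xi>. cos (cdot z \<xi> \<eta>) - 1) \<in> borel_measurable borel" for \<eta>
    unfolding cos_exp_eq by measurable
  fix \<xi> \<eta> :: 'a assume e: "norm \<eta> \<le> 2 / r"
  show "norm (cos (cdot z \<xi> \<eta>) - 1) \<le> 4 * exp 2 * (norm z / r)\<^sup>2 * (1 + r * norm \<xi>) ^ 2"
    using norm_cos_minus_1 tube_square[OF assms e] by (rule order_trans)
qed (use assms in auto)

section \<open>Bounds for the Fourier integrals\<close>

lemma inverse_poly_integral:
  fixes ty :: "'a::euclidean_space itself"
  shows "\<exists>q>0. \<forall>r>0. integrable lborel (\<lambda>x::'a. 1 / (1 + r * norm x) ^ (DIM('a) + 2)) \<and>
    (LBINT x. 1 / (1 + r * norm (x::'a)) ^ (DIM('a) + 2)) \<le> q / r ^ DIM('a)"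
proof -
  let ?d = "DIM('a)"
  obtain c where c: "0 < c" "\<And>r. 0 < r \<Longrightarrow> (\<integral>\<^sup>+ x. ennreal (indicator (- ball (0::'a) r) x / norm x ^ (?d + 2)) \<partial>lborel) \<le> ennreal (c / r\<^sup>2)"
    using nn_integral_tail_le[where 'a='a] by auto
  define V where "V = unit_ball_vol (real ?d)"
  have V: "0 < V" by (simp add: V_def unit_ball_vol_pos)
  have "integrable lborel (\<lambda>x::'a. 1 / (1 + r * norm x) ^ (?d + 2)) \<and>
    (LBINT x. 1 / (1 + r * norm (x::'a)) ^ (?d + 2)) \<le> (V + c) / r ^ ?d" if r: "0 < r" for r
  proof -
    have pos: "0 < 1 + r * norm x" for x :: 'a using r by (simp add: add_pos_nonneg)
    have "(\<integral>\<^sup>+ x. ennreal (1 / (1 + r * norm (x::'a)) ^ (?d + 2)) \<partial>lborel) \<le>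
      (\<integral>\<^sup>+ x. indicator (ball (0::'a) (1/r)) x + ennreal (1 / r ^ (?d + 2)) * ennreal (indicator (- ball (0::'a) (1/r)) x / norm x ^ (?d + 2)) \<partial>lborel)"
    proof (rule nn_integral_mono)
      fix x :: 'a
      show "ennreal (1 / (1 + r * norm x) ^ (?d + 2)) \<le> indicator (ball (0::'a) (1/r)) x + ennreal (1 / r ^ (?d + 2)) * ennreal (indicator (- ball (0::'a) (1/r)) x / norm x ^ (?d + 2))"
      proof (cases "norm x < 1 / r")
        case True
        have "1 \<le> (1 + r * norm x) ^ (?d + 2)" using r by (intro one_le_power) auto
        then have "1 / (1 + r * norm x) ^ (?d + 2) \<le> 1" using pos[of x] by (simp add: divide_le_eq)
        then have "ennreal (1 / (1 + r * norm x) ^ (?d + 2)) \<le> ennreal 1" by (rule ennreal_leI)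
        then show ?thesis using True by (simp add: add_increasing2)
      next
        case False
        then have x: "0 < norm x" using r by (auto simp: not_less intro: less_le_trans[of _ "1/r"])
        have "1 / (1 + r * norm x) ^ (?d + 2) \<le> 1 / (r * norm x) ^ (?d + 2)"
          using r x by (intro divide_left_mono power_mono mult_pos_pos zero_less_power pos) auto
        also have "\<dots> = 1 / r ^ (?d + 2) * (1 / norm x ^ (?d + 2))" by (simp only: power_mult_distrib) simp
        finally have "ennreal (1 / (1 + r * norm x) ^ (?d + 2)) \<le> ennreal (1 / r ^ (?d + 2) * (1 / norm x ^ (?d + 2)))" by (rule ennreal_leI)
        also have "\<dots> = ennreal (1 / r ^ (?d + 2)) * ennreal (1 / norm x ^ (?d + 2))"
          using r by (intro ennreal_mult) auto
        finally show ?thesis using False by simp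
      qed
    qed
    also have "\<dots> = emeasure lborel (ball (0::'a) (1/r)) + ennreal (1 / r ^ (?d + 2)) * (\<integral>\<^sup>+ x. ennreal (indicator (- ball (0::'a) (1/r)) x / norm x ^ (?d + 2)) \<partial>lborel)"
      by (subst nn_integral_add) (auto simp: nn_integral_cmult)
    also have "\<dots> \<le> ennreal (V * (1/r) ^ ?d) + ennreal (1 / r ^ (?d + 2)) * ennreal (c / (1/r)\<^sup>2)"
      using c(2)[of "1/r"] r by (intro add_mono mult_left_mono) (auto simp: emeasure_ball V_def)
    also have "\<dots> = ennreal ((V + c) / r ^ ?d)"
      using r V c by (simp add: ennreal_mult'[symmetric] ennreal_plus[symmetric] power_add power_divide add_divide_distrib power2_eq_square del: ennreal_plus)
    finally have le: "(\<integral>\<^sup>+ x. ennreal (1 / (1 + r * norm (x::'a)) ^ (?d + 2)) \<partial>lborel) \<le> ennreal ((V + c) / r ^ ?d)" .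
    then have int: "integrable lborel (\<lambda>x::'a. 1 / (1 + r * norm x) ^ (?d + 2))"
      using pos by (intro integrableI_nonneg AE_I2) (auto simp: less_imp_le[OF pos] intro: le_less_trans)
    have "ennreal (LBINT x. 1 / (1 + r * norm (x::'a)) ^ (?d + 2)) \<le> ennreal ((V + c) / r ^ ?d)"
      using le nn_integral_eq_integral[OF int] pos by (simp add: less_imp_le[OF pos])
    then have "(LBINT x. 1 / (1 + r * norm (x::'a)) ^ (?d + 2)) \<le> (V + c) / r ^ ?d"
      using V c r by (subst (asm) ennreal_le_iff) auto
    then show ?thesis using int by blast
  qed
  then show ?thesis using V c by (intro exI[of _ "V + c"]) auto
qed

text \<open>\<open>a\<close> and \<open>A\<close> bound the jump density against \<nu> from below
  and above, and \<open>D\<close> bounds the drift in units of r h(r). They end up as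
  \<kappa>0/\<Lambda>, \<kappa>1 \<Lambda> and a multiple of the latter.\<close>

locale levy_bounds = levy_scaling \<nu> ty R \<alpha> C for \<nu> and ty :: "'a::euclidean_space itself" and R \<alpha> C +
  fixes a A D :: real
  assumes a: "0 < a" and A: "0 < A" and D: "0 \<le> D"
begin

text \<open>The constants must not depend on \<open>r\<close>, \<open>N\<close>, \<open>b\<close>, so they are chosen before these are fixed.\<close>

definition low_const :: real where
  "low_const = exp (- 2) * a / (4 * (real DIM('a))\<^sup>2 * CK * C)"

lemma low_const: "0 < low_const" using a CK1 C1 by (simp add: low_const_def)

text \<open>The exponent d + 5 is d + 2, for integrability in \<xi>, plus 3, the largest degree of a
  multiplier that occurs.\<close>

definition decay_const :: real where
  "decay_const = (SOME B. 0 < B \<and> (\<forall>x\<ge>0. (1 + x) ^ (DIM('a) + 5) * exp (- low_const * (if 1 \<le> x then x powr \<alpha> else 0)) \<le> B))"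

lemma decay_const: "0 < decay_const"
  "0 \<le> x \<Longrightarrow> (1 + x) ^ (DIM('a) + 5) * exp (- low_const * (if 1 \<le> x then x powr \<alpha> else 0)) \<le> decay_const"
  using someI_ex[OF poly_exp_bound[OF alpha low_const, of "DIM('a) + 5"], folded decay_const_def] by blast+

definition poly_const :: real where
  "poly_const = (SOME q. 0 < q \<and> (\<forall>r>0. integrable lborel (\<lambda>x::'a. 1 / (1 + r * norm x) ^ (DIM('a) + 2)) \<and>
    (LBINT x. 1 / (1 + r * norm (x::'a)) ^ (DIM('a) + 2)) \<le> q / r ^ DIM('a)))"

lemma poly_const: "0 < poly_const"
  "0 < r \<Longrightarrow> integrable lborel (\<lambda>x::'a. 1 / (1 + r * norm x) ^ (DIM('a) + 2))"
  "0 < r \<Longrightarrow> (LBINT x. 1 / (1 + r * norm (x::'a)) ^ (DIM('a) + 2)) \<le> poly_const / r ^ DIM('a)"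
  using someI_ex[OF inverse_poly_integral[where 'a='a], folded poly_const_def] by blast+

text \<open>On the tube the exponent can grow by at most 4 exp(2) A through the small jumps, from
  exp(2) |\<eta>|^2 times their second moment, and by 2 D through the drift;
  \<open>decay_const\<close> turns the rest into polynomial decay.\<close>

definition tube_const :: real where
  "tube_const = exp (4 * exp 2 * A + 2 * D) * decay_const"

lemma tube_const: "0 < tube_const" using decay_const by (simp add: tube_const_def)

text \<open>The factorial comes from exp(-y) \<le> (d+2)! / y^(d+2), which brings the exponential to
  the power of \<open>rr_lower_far\<close>.\<close>

definition small_const :: real where
  "small_const = tube_const * poly_const * fact (DIM('a) + 2) * CK"

text \<open>The new factor is the sum over n of (A \<open>conv_const\<close>)^n / n!, that is, the
  cost of restoring the large jumps.\<close>

definition core_const :: real where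
  "core_const = small_const * exp (A * conv_const)"

lemma small_const: "0 < small_const" using tube_const poly_const(1) CK1 by (simp add: small_const_def)
lemma core_const: "0 < core_const" using small_const by (simp add: core_const_def)

end

text \<open>
  In all three cases the symbol with jump density \<open>N\<close> is the one with the jumps below \<open>r\<close> compensated,
  up to a drift \<open>b\<close> with \<open>t \<bar>b\<bar> \<le> D r\<close>: this is where \<open>\<alpha>\<^sub>h > 1\<close>, \<open>\<beta>\<^sub>h < 1\<close> or the symmetry is used.
\<close>

locale levy_kernel = levy_bounds \<nu> ty R \<alpha> C a A D
  for \<nu> and ty :: "'a::euclidean_space itself" and R \<alpha> C a A D +
  fixes r :: real and N :: "'a \<Rightarrow> real" and b :: 'a
  assumes r: "0 < r" "r \<le> R"
    and N_meas [measurable]: "N \<in> borel_measurable borel"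
    and N0: "0 \<le> N z"
    and N_le: "z \<noteq> 0 \<Longrightarrow> ennreal (N z) \<le> ennreal A * \<nu> (norm z)"
    and N_ge: "z \<noteq> 0 \<Longrightarrow> ennreal a * \<nu> (norm z) \<le> ennreal (N z)"
    and b: "norm b \<le> D * r * h r"
begin

section \<open>Integration against the jump density\<close>

lemma hr: "0 < h r" using h_pos r by blast

lemma N_integral:
  assumes [measurable]: "f \<in> borel_measurable borel" and f: "\<And>z. 0 \<le> f z" and I: "nuint f \<le> ennreal I" "0 \<le> I"
  shows "integrable lborel (\<lambda>z. f z * N z)" "(LBINT z. f z * N z) \<le> A * I"
proof -
  have "(\<integral>\<^sup>+ z. ennreal (f z * N z) \<partial>lborel) \<le> (\<integral>\<^sup>+ z. ennreal A * (ennreal (f z) * \<nu> (norm z)) \<partial>lborel)"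
  proof (rule nn_integral_mono_AE)
    have "AE x::'a in lborel. x \<noteq> 0" by (rule AE_lborel_singleton)
    then show "AE z in lborel. ennreal (f z * N z) \<le> ennreal A * (ennreal (f z) * \<nu> (norm z))"
    proof eventually_elim
      case (elim z)
      have "ennreal (f z * N z) = ennreal (f z) * ennreal (N z)" using f N0 by (simp add: ennreal_mult)
      also have "\<dots> \<le> ennreal (f z) * (ennreal A * \<nu> (norm z))" using elim by (intro mult_left_mono N_le) auto
      finally show ?case by (simp add: mult_ac)
    qed
  qed
  also have "\<dots> = ennreal A * nuint f" unfolding nuint_def by (intro nn_integral_cmult) measurable
  also have "\<dots> \<le> ennreal A * ennreal I" by (intro mult_left_mono I) auto
  also have "\<dots> = ennreal (A * I)" using A I by (simp add: ennreal_mult)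
  finally have le: "(\<integral>\<^sup>+ z. ennreal (f z * N z) \<partial>lborel) \<le> ennreal (A * I)" .
  then show int: "integrable lborel (\<lambda>z. f z * N z)"
    using f N0 by (intro integrableI_nonneg) (auto intro: le_less_trans)
  have "ennreal (LBINT z. f z * N z) \<le> ennreal (A * I)"
    using le nn_integral_eq_integral[OF int] f N0 by simp
  then show "(LBINT z. f z * N z) \<le> A * I" using A I by (subst (asm) ennreal_le_iff) auto
qed

lemma N_integral_ge:
  assumes [measurable]: "f \<in> borel_measurable borel" and f: "\<And>z. 0 \<le> f z" and I: "ennreal I \<le> nuint f" 
    and int: "integrable lborel (\<lambda>z. f z * N z)"
  shows "a * I \<le> (LBINT z. f z * N z)"
proof -
  have "ennreal (a * I) \<le> ennreal a * nuint f" using a I by (simp add: ennreal_mult' mult_left_mono)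
  also have "\<dots> = (\<integral>\<^sup>+ z. ennreal a * (ennreal (f z) * \<nu> (norm z)) \<partial>lborel)"
    unfolding nuint_def by (intro nn_integral_cmult[symmetric]) measurable
  also have "\<dots> \<le> (\<integral>\<^sup>+ z. ennreal (f z * N z) \<partial>lborel)"
  proof (rule nn_integral_mono_AE)
    have "AE x::'a in lborel. x \<noteq> 0" by (rule AE_lborel_singleton)
    then show "AE z in lborel. ennreal a * (ennreal (f z) * \<nu> (norm z)) \<le> ennreal (f z * N z)"
    proof eventually_elim
      case (elim z)
      have "ennreal (f z) * (ennreal a * \<nu> (norm z)) \<le> ennreal (f z) * ennreal (N z)" using elim by (intro mult_left_mono N_ge) auto
      also have "\<dots> = ennreal (f z * N z)" using f N0 by (simp add: ennreal_mult)
      finally show ?case by (simp add: mult_ac)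
    qed
  qed
  also have "\<dots> = ennreal (LBINT z. f z * N z)"
    using nn_integral_eq_integral[OF int] f N0 by simp
  finally show ?thesis using f N0 by (subst (asm) ennreal_le_iff) (auto intro!: integral_nonneg)
qed

lemma small_second_moment:
  "integrable lborel (\<lambda>z. indicator (ball 0 r) z * (norm z)\<^sup>2 * N z)"
  "(LBINT z. indicator (ball 0 r) z * (norm z)\<^sup>2 * N z) \<le> A * (r\<^sup>2 * h r)"
proof -
  have "nuint (\<lambda>z. indicator (ball 0 r) z * (norm z)\<^sup>2) \<le> ennreal (r\<^sup>2 * h r)"
    unfolding nuint_K[OF r(1)] using K_le_h[OF r(1)] by (intro ennreal_leI mult_left_mono) auto
  then show "integrable lborel (\<lambda>z. indicator (ball 0 r) z * (norm z)\<^sup>2 * N z)"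
    "(LBINT z. indicator (ball 0 r) z * (norm z)\<^sup>2 * N z) \<le> A * (r\<^sup>2 * h r)"
    using N_integral[of "\<lambda>z. indicator (ball 0 r) z * (norm z)\<^sup>2" "r\<^sup>2 * h r"] hr by auto
qed

section \<open>The exponent of the small jumps on the tube\<close>

definition N1 :: "'a \<Rightarrow> real" where "N1 z = indicator (ball 0 r) z * N z"
definition N2 :: "'a \<Rightarrow> real" where "N2 z = indicator (- ball 0 r) z * N z"

lemma N12_meas [measurable]: "N1 \<in> borel_measurable borel" "N2 \<in> borel_measurable borel"
  unfolding N1_def[abs_def] N2_def[abs_def] by measurable

lemma N1_nonneg: "0 \<le> N1 z" and N2_nonneg: "0 \<le> N2 z" using N0 by (auto simp: N1_def N2_def)

lemma N1_moment: "integrable lborel (\<lambda>z. (norm z)\<^sup>2 * N1 z)" "(LBINT z. (norm z)\<^sup>2 * N1 z) \<le> A * (r\<^sup>2 * h r)"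
  using small_second_moment by (auto simp: N1_def mult_ac)

lemma N2_integrable: "integrable lborel N2" "(LBINT z. N2 z) \<le> A * h r"
  using N_integral[of "indicator (- ball 0 r)" "h r"] h_ball_compl[OF r(1)] hr by (auto simp: N2_def[abs_def])

text \<open>Minus the symbol of the jumps below r, all of them compensated, continued to complex
  frequencies. It converges everywhere because these jumps are bounded.\<close>

definition lexp :: "'a \<Rightarrow> 'a \<Rightarrow> complex" where
  "lexp \<xi> \<eta> = (LBINT z. complex_of_real (N1 z) * (exp (\<i> * cdot z \<xi> \<eta>) - 1 - \<i> * cdot z \<xi> \<eta>))"

lemma N1_bound:
  assumes "norm z < r \<Longrightarrow> norm y \<le> c * (norm z)\<^sup>2"
  shows "norm (complex_of_real (N1 z) * y) \<le> c * ((norm z)\<^sup>2 * N1 z)"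
proof (cases "norm z < r")
  case True
  have "norm (complex_of_real (N1 z) * y) = N1 z * norm y" using N1_nonneg[of z] by (simp add: norm_mult)
  also have "\<dots> \<le> N1 z * (c * (norm z)\<^sup>2)" using assms True by (intro mult_left_mono N1_nonneg) auto
  finally show ?thesis by (simp add: mult_ac)
qed (auto simp: N1_def)

lemma N1_integrable:
  assumes [measurable]: "f \<in> borel_measurable borel" and "\<And>z. norm z < r \<Longrightarrow> norm (f z) \<le> c * (norm z)\<^sup>2"
  shows "integrable lborel (\<lambda>z. complex_of_real (N1 z) * f z)"
    "norm (LBINT z. complex_of_real (N1 z) * f z) \<le> c * (LBINT z. (norm z)\<^sup>2 * N1 z)"
proof -
  have le: "norm (complex_of_real (N1 z) * f z) \<le> c * ((norm z)\<^sup>2 * N1 z)" for z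
    using assms(2) by (rule N1_bound)
  have i: "integrable lborel (\<lambda>z. c * ((norm z)\<^sup>2 * N1 z))" using N1_moment by auto
  show j: "integrable lborel (\<lambda>z. complex_of_real (N1 z) * f z)"
    using le by (intro Bochner_Integration.integrable_bound[OF i] AE_I2) (auto intro: order_trans[OF _ abs_ge_self])
  have "norm (LBINT z. complex_of_real (N1 z) * f z) \<le> (LBINT z. c * ((norm z)\<^sup>2 * N1 z))"
    by (rule Bochner_Integration.integral_norm_bound_integral[OF j i]) (rule le)
  then show "norm (LBINT z. complex_of_real (N1 z) * f z) \<le> c * (LBINT z. (norm z)\<^sup>2 * N1 z)" by simp
qed

lemma cdot_square_exp:
  assumes "norm z < r"
  shows "(norm (cdot z \<xi> \<eta>))\<^sup>2 * exp \<bar>Im (cdot z \<xi> \<eta>)\<bar> \<le> ((norm \<xi> + norm \<eta>)\<^sup>2 * exp (r * norm \<eta>)) * (norm z)\<^sup>2"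
proof -
  have "\<bar>Im (cdot z \<xi> \<eta>)\<bar> \<le> r * norm \<eta>" 
    by (rule order_trans[OF Im_cdot]) (use assms in \<open>auto intro!: mult_right_mono\<close>)
  then have "(norm (cdot z \<xi> \<eta>))\<^sup>2 * exp \<bar>Im (cdot z \<xi> \<eta>)\<bar> \<le> (norm z * (norm \<xi> + norm \<eta>))\<^sup>2 * exp (r * norm \<eta>)"
    by (intro mult_mono power_mono norm_cdot) auto
  then show ?thesis by (simp add: power_mult_distrib mult_ac)
qed

lemma lexp_integrable: "integrable lborel (\<lambda>z. complex_of_real (N1 z) * (exp (\<i> * cdot z \<xi> \<eta>) - 1 - \<i> * cdot z \<xi> \<eta>))"
  by (rule N1_integrable(1)[where c = "(norm \<xi> + norm \<eta>)\<^sup>2 * exp (r * norm \<eta>)"])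
    (measurable, rule order_trans[OF norm_exp_i_minus_2 cdot_square_exp])

lemma lexp_meas [measurable]: "(\<lambda>\<xi>. lexp \<xi> \<eta>) \<in> borel_measurable borel"
  unfolding lexp_def by measurable

text \<open>With c the pairing of z with the base point and q = z \<bullet> e, the first-order
  remainder of the integrand in v is exactly exp(i c) (exp(i v q) - 1 - i v q). It is O(|v|^2 |z|^2)
  for |v| \<le> 1, so the second moment of \<open>N1\<close> suffices.\<close>

lemma lexp_holomorphic: "(\<lambda>s. lexp (\<xi> + Re s *\<^sub>R e) (Im s *\<^sub>R e)) holomorphic_on UNIV"
proof -
  define L where "L = (\<lambda>s. lexp (\<xi> + Re s *\<^sub>R e) (Im s *\<^sub>R e))"
  have "\<exists>d. (L has_field_derivative d) (at s)" for s
  proof -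
    define \<xi>' where "\<xi>' = \<xi> + Re s *\<^sub>R e"
    define \<eta>' where "\<eta>' = Im s *\<^sub>R e"
    let ?c = "\<lambda>z. cdot z \<xi>' \<eta>'"
    let ?q = "\<lambda>z. complex_of_real (z \<bullet> e)"
    define d where "d = (LBINT z. complex_of_real (N1 z) * (\<i> * ?q z * (exp (\<i> * ?c z) - 1)))"
    have Lv: "L (s + v) = (LBINT z. complex_of_real (N1 z) * (exp (\<i> * (?c z + v * ?q z)) - 1 - \<i> * (?c z + v * ?q z)))"
      "integrable lborel (\<lambda>z. complex_of_real (N1 z) * (exp (\<i> * (?c z + v * ?q z)) - 1 - \<i> * (?c z + v * ?q z)))" for v
    proof -
      have "cdot z (\<xi> + Re (s + v) *\<^sub>R e) (Im (s + v) *\<^sub>R e) = ?c z + v * ?q z" for z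
        unfolding \<xi>'_def \<eta>'_def cdot_line by (simp add: algebra_simps)
      then show "L (s + v) = (LBINT z. complex_of_real (N1 z) * (exp (\<i> * (?c z + v * ?q z)) - 1 - \<i> * (?c z + v * ?q z)))"
      "integrable lborel (\<lambda>z. complex_of_real (N1 z) * (exp (\<i> * (?c z + v * ?q z)) - 1 - \<i> * (?c z + v * ?q z)))"
        using lexp_integrable[of "\<xi> + Re (s + v) *\<^sub>R e" "Im (s + v) *\<^sub>R e"] unfolding L_def lexp_def by simp_all
    qed
    have di: "integrable lborel (\<lambda>z. complex_of_real (N1 z) * (\<i> * ?q z * (exp (\<i> * ?c z) - 1)))"
    proof (rule N1_integrable(1)[where c = "norm e * (norm \<xi>' + norm \<eta>') * exp (r * norm \<eta>')"])
      fix z :: 'a assume z: "norm z < r"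
      have "\<bar>Im (?c z)\<bar> \<le> r * norm \<eta>'" 
        by (rule order_trans[OF Im_cdot]) (use z in \<open>auto intro!: mult_right_mono\<close>)
      then have "norm (?c z) * exp \<bar>Im (?c z)\<bar> \<le> (norm z * (norm \<xi>' + norm \<eta>')) * exp (r * norm \<eta>')"
        by (intro mult_mono norm_cdot) auto
      then have "norm (exp (\<i> * ?c z) - 1) \<le> (norm z * (norm \<xi>' + norm \<eta>')) * exp (r * norm \<eta>')"
        using norm_exp_i_minus_1[of "?c z"] by (rule order_trans[rotated])
      then have "\<bar>z \<bullet> e\<bar> * norm (exp (\<i> * ?c z) - 1) \<le> (norm z * norm e) * ((norm z * (norm \<xi>' + norm \<eta>')) * exp (r * norm \<eta>'))"
        by (intro mult_mono Cauchy_Schwarz_ineq2) auto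
      then show "norm (\<i> * ?q z * (exp (\<i> * ?c z) - 1)) \<le> norm e * (norm \<xi>' + norm \<eta>') * exp (r * norm \<eta>') * (norm z)\<^sup>2"
        by (simp add: norm_mult power2_eq_square mult_ac)
    qed measurable
    define I where "I = (LBINT z. (norm z)\<^sup>2 * N1 z)"
    have "(L has_derivative (*) d) (at s)"
    proof (rule has_derivative_quadratic[where e = 1 and C = "exp (r * norm \<eta>' + r * norm e) * (norm e)\<^sup>2 * I"])
      fix v :: complex assume v: "norm v \<le> 1"
      have ptw: "norm (exp (\<i> * ?c z) * (exp (\<i> * (v * ?q z)) - 1 - \<i> * (v * ?q z))) \<le> (exp (r * norm \<eta>' + r * norm e) * (norm e)\<^sup>2 * (norm v)\<^sup>2) * (norm z)\<^sup>2"
        if z: "norm z < r" for z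
      proof -
        have "- Im (?c z) \<le> r * norm \<eta>'" using Im_cdot[of z \<xi>' \<eta>'] mult_right_mono[of "norm z" r "norm \<eta>'"] z by auto
        then have 1: "norm (exp (\<i> * ?c z)) \<le> exp (r * norm \<eta>')" by (simp add: norm_exp_eq_Re)
        have ze: "\<bar>z \<bullet> e\<bar> \<le> norm z * norm e" by (rule Cauchy_Schwarz_ineq2)
        have vq: "norm (v * ?q z) \<le> norm v * (norm z * norm e)" using ze by (simp add: norm_mult mult_left_mono)
        have "\<bar>Im (v * ?q z)\<bar> \<le> norm (v * ?q z)" by (rule abs_Im_le_cmod)
        also have "\<dots> \<le> 1 * (r * norm e)" by (rule order_trans[OF vq], intro mult_mono) (use z v r in auto)
        finally have im: "\<bar>Im (v * ?q z)\<bar> \<le> r * norm e" by simp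
        have "norm (exp (\<i> * (v * ?q z)) - 1 - \<i> * (v * ?q z)) \<le> (norm (v * ?q z))\<^sup>2 * exp \<bar>Im (v * ?q z)\<bar>"
          by (rule norm_exp_i_minus_2)
        also have "\<dots> \<le> (norm v * (norm z * norm e))\<^sup>2 * exp (r * norm e)"
          using im by (intro mult_mono power_mono vq) auto
        finally have 2: "norm (exp (\<i> * (v * ?q z)) - 1 - \<i> * (v * ?q z)) \<le> (norm v * (norm z * norm e))\<^sup>2 * exp (r * norm e)" .
        have "norm (exp (\<i> * ?c z)) * norm (exp (\<i> * (v * ?q z)) - 1 - \<i> * (v * ?q z)) \<le> exp (r * norm \<eta>') * ((norm v * (norm z * norm e))\<^sup>2 * exp (r * norm e))"
          by (intro mult_mono 1 2) auto
        then show ?thesis by (simp add: norm_mult exp_add power_mult_distrib mult_ac)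
      qed
      have "L (s + v) - L s - d * v = (LBINT z. complex_of_real (N1 z) * (exp (\<i> * ?c z) * (exp (\<i> * (v * ?q z)) - 1 - \<i> * (v * ?q z))))"
      proof -
        have "L (s + v) - L s - d * v = (LBINT z. complex_of_real (N1 z) * (exp (\<i> * (?c z + v * ?q z)) - 1 - \<i> * (?c z + v * ?q z)) -
            complex_of_real (N1 z) * (exp (\<i> * ?c z) - 1 - \<i> * ?c z) - complex_of_real (N1 z) * (\<i> * ?q z * (exp (\<i> * ?c z) - 1)) * v)"
          using Lv(1)[of v] Lv(1)[of 0] Lv(2)[of v] Lv(2)[of 0] di by (simp add: d_def)
        also have "\<dots> = (LBINT z. complex_of_real (N1 z) * (exp (\<i> * ?c z) * (exp (\<i> * (v * ?q z)) - 1 - \<i> * (v * ?q z))))"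
          by (intro Bochner_Integration.integral_cong refl) (simp add: distrib_left exp_add algebra_simps)
        finally show ?thesis .
      qed
      also have "norm \<dots> \<le> (exp (r * norm \<eta>' + r * norm e) * (norm e)\<^sup>2 * (norm v)\<^sup>2) * I"
        unfolding I_def by (intro N1_integrable(2) ptw) measurable
      finally show "norm (L (s + v) - L s - d * v) \<le> exp (r * norm \<eta>' + r * norm e) * (norm e)\<^sup>2 * I * (norm v)\<^sup>2"
        by (simp add: mult_ac)
    qed (auto intro: bounded_linear_mult_right)
    then show ?thesis by (auto simp: has_field_derivative_def)
  qed
  then show ?thesis unfolding L_def[symmetric] holomorphic_on_def field_differentiable_def
    by (auto intro: has_field_derivative_at_within)
qed

text \<open>\<open>Re_exp_i_minus_2\<close> is integrated in z. The cosine part is bounded below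
  through \<open>symbol_lower\<close>, which gives the decay; the quadratic part is at most exp(2)
  (2/r)^2 A r^2 h(r).\<close>

lemma lexp_Re:
  assumes e: "norm \<eta> \<le> 2 / r"
  shows "Re (lexp \<xi> \<eta>) \<le> h r * (4 * exp 2 * A - low_const * (if 1 \<le> r * norm \<xi> then (r * norm \<xi>) powr \<alpha> else 0))"
proof -
  have ci: "integrable lborel (\<lambda>z. indicator (ball 0 r) z * (1 - cos (\<xi> \<bullet> z)) * N z)"
  proof (rule Bochner_Integration.integrable_bound[OF integrable_mult_right[OF small_second_moment(1), of "(norm \<xi>)\<^sup>2"]])
    show "AE z in lborel. norm (indicator (ball 0 r) z * (1 - cos (\<xi> \<bullet> z)) * N z) \<le> norm ((norm \<xi>)\<^sup>2 * (indicator (ball 0 r) z * (norm z)\<^sup>2 * N z))"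
    proof (rule AE_I2)
      fix z :: 'a
      have "1 - cos (\<xi> \<bullet> z) = 2 * (sin ((\<xi> \<bullet> z) / 2))\<^sup>2" using cos_double_sin[of "(\<xi> \<bullet> z) / 2"] by simp
      also have "(sin ((\<xi> \<bullet> z) / 2))\<^sup>2 \<le> ((\<xi> \<bullet> z) / 2)\<^sup>2" using abs_sin_x_le_abs_x[of "(\<xi> \<bullet> z) / 2"] by (subst abs_le_square_iff[symmetric]) auto
      also have "2 * ((\<xi> \<bullet> z) / 2)\<^sup>2 \<le> (\<xi> \<bullet> z)\<^sup>2" by (simp add: power_divide)
      also have "(\<xi> \<bullet> z)\<^sup>2 \<le> (norm \<xi> * norm z)\<^sup>2" using Cauchy_Schwarz_ineq2[of \<xi> z] by (subst abs_le_square_iff[symmetric]) auto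
      finally have "1 - cos (\<xi> \<bullet> z) \<le> (norm \<xi>)\<^sup>2 * (norm z)\<^sup>2" by (simp add: power_mult_distrib)
      then have "indicator (ball 0 r) z * (1 - cos (\<xi> \<bullet> z)) * N z \<le> indicator (ball 0 r) z * ((norm \<xi>)\<^sup>2 * (norm z)\<^sup>2) * N z"
        by (intro mult_right_mono mult_left_mono N0) auto
      then show "norm (indicator (ball 0 r) z * (1 - cos (\<xi> \<bullet> z)) * N z) \<le> norm ((norm \<xi>)\<^sup>2 * (indicator (ball 0 r) z * (norm z)\<^sup>2 * N z))"
        using N0[of z] by (simp add: abs_mult mult_ac)
    qed
  qed measurable
  have low: "a * (if 1 \<le> r * norm \<xi> then 1 / (4 * (real DIM('a))\<^sup>2 * CK * C) * (r * norm \<xi>) powr \<alpha> * h r else 0) \<le> (LBINT z. indicator (ball 0 r) z * (1 - cos (\<xi> \<bullet> z)) * N z)"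
    using symbol_lower[OF r, of \<xi>] by (intro N_integral_ge ci) auto
  have up: "Re (complex_of_real (N1 z) * (exp (\<i> * cdot z \<xi> \<eta>) - 1 - \<i> * cdot z \<xi> \<eta>)) \<le>
      - exp (- 2) * (indicator (ball 0 r) z * (1 - cos (\<xi> \<bullet> z)) * N z) + exp 2 * (norm \<eta>)\<^sup>2 * (indicator (ball 0 r) z * (norm z)\<^sup>2 * N z)" for z
  proof (cases "norm z < r")
    case True
    have "\<bar>Im (cdot z \<xi> \<eta>)\<bar> \<le> 2" using True tube_Im[OF r(1) e, of z \<xi>] by simp
    then have "Re (exp (\<i> * cdot z \<xi> \<eta>) - 1 - \<i> * cdot z \<xi> \<eta>) \<le> - (exp (- 2) * (1 - cos (\<xi> \<bullet> z))) + exp 2 * (z \<bullet> \<eta>)\<^sup>2"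
      using Re_exp_i_minus_2[of "cdot z \<xi> \<eta>"] by (simp add: cdot_def inner_commute)
    also have "(z \<bullet> \<eta>)\<^sup>2 \<le> (norm z * norm \<eta>)\<^sup>2" using Cauchy_Schwarz_ineq2[of z \<eta>] by (subst abs_le_square_iff[symmetric]) auto
    finally have "Re (exp (\<i> * cdot z \<xi> \<eta>) - 1 - \<i> * cdot z \<xi> \<eta>) \<le> - (exp (- 2) * (1 - cos (\<xi> \<bullet> z))) + exp 2 * (norm z * norm \<eta>)\<^sup>2"
      by simp
    then have "N z * Re (exp (\<i> * cdot z \<xi> \<eta>) - 1 - \<i> * cdot z \<xi> \<eta>) \<le> N z * (- (exp (- 2) * (1 - cos (\<xi> \<bullet> z))) + exp 2 * (norm z * norm \<eta>)\<^sup>2)"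
      by (intro mult_left_mono N0)
    then show ?thesis using True by (simp add: N1_def power_mult_distrib algebra_simps)
  qed (auto simp: N1_def)
  have "Re (lexp \<xi> \<eta>) = (LBINT z. Re (complex_of_real (N1 z) * (exp (\<i> * cdot z \<xi> \<eta>) - 1 - \<i> * cdot z \<xi> \<eta>)))"
    unfolding lexp_def by (rule integral_Re[symmetric, OF lexp_integrable])
  also have "\<dots> \<le> (LBINT z. - exp (- 2) * (indicator (ball 0 r) z * (1 - cos (\<xi> \<bullet> z)) * N z) + exp 2 * (norm \<eta>)\<^sup>2 * (indicator (ball 0 r) z * (norm z)\<^sup>2 * N z))"
    using ci small_second_moment(1)
    by (intro integral_mono up integrable_Re lexp_integrable Bochner_Integration.integrable_add integrable_mult_right)
  also have "\<dots> = - exp (- 2) * (LBINT z. indicator (ball 0 r) z * (1 - cos (\<xi> \<bullet> z)) * N z) + exp 2 * (norm \<eta>)\<^sup>2 * (LBINT z. indicator (ball 0 r) z * (norm z)\<^sup>2 * N z)"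
    using ci small_second_moment(1) by (subst Bochner_Integration.integral_add) auto
  also have "\<dots> \<le> - exp (- 2) * (a * (if 1 \<le> r * norm \<xi> then 1 / (4 * (real DIM('a))\<^sup>2 * CK * C) * (r * norm \<xi>) powr \<alpha> * h r else 0)) + exp 2 * (2 / r)\<^sup>2 * (A * (r\<^sup>2 * h r))"
  proof (rule add_mono)
    show "- exp (- 2) * (LBINT z. indicator (ball 0 r) z * (1 - cos (\<xi> \<bullet> z)) * N z) \<le> - exp (- 2) * (a * (if 1 \<le> r * norm \<xi> then 1 / (4 * (real DIM('a))\<^sup>2 * CK * C) * (r * norm \<xi>) powr \<alpha> * h r else 0))"
      using low by simp
    show "exp 2 * (norm \<eta>)\<^sup>2 * (LBINT z. indicator (ball 0 r) z * (norm z)\<^sup>2 * N z) \<le> exp 2 * (2 / r)\<^sup>2 * (A * (r\<^sup>2 * h r))"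
      using e by (intro mult_mono power_mono small_second_moment(2)) (auto intro!: integral_nonneg simp: N0)
  qed
  also have "exp 2 * (2 / r)\<^sup>2 * (A * (r\<^sup>2 * h r)) = h r * (4 * exp 2 * A)"
    using r by (simp add: power_divide)
  also have "- exp (- 2) * (a * (if 1 \<le> r * norm \<xi> then 1 / (4 * (real DIM('a))\<^sup>2 * CK * C) * (r * norm \<xi>) powr \<alpha> * h r else 0))
     = - h r * (low_const * (if 1 \<le> r * norm \<xi> then (r * norm \<xi>) powr \<alpha> else 0))"
    by (simp add: low_const_def)
  finally show ?thesis by (simp add: algebra_simps)
qed

text \<open>Division by h(r) is multiplication by t. The drift stays with the small jumps, since it
  is entire in the frequency and bounded on the tube.\<close>

definition E :: "'a \<Rightarrow> 'a \<Rightarrow> complex" where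
  "E \<xi> \<eta> = (lexp \<xi> \<eta> + \<i> * cdot b \<xi> \<eta>) / complex_of_real (h r)"

lemma E_meas [measurable]: "(\<lambda>\<xi>. E \<xi> \<eta>) \<in> borel_measurable borel"
  unfolding E_def by measurable

lemma exp_E_bound:
  assumes e: "norm \<eta> \<le> 2 / r"
  shows "norm (exp (E \<xi> \<eta>)) \<le> tube_const / (1 + r * norm \<xi>) ^ (DIM('a) + 5)"
proof -
  let ?J = "(if 1 \<le> r * norm \<xi> then (r * norm \<xi>) powr \<alpha> else 0)"
  have "- (b \<bullet> \<eta>) \<le> norm b * norm \<eta>" using Cauchy_Schwarz_ineq2[of b \<eta>] by linarith
  also have "\<dots> \<le> (D * r * h r) * (2 / r)" using D r hr by (intro mult_mono b e) auto
  also have "\<dots> = h r * (2 * D)" using r by simp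
  finally have bb: "- (b \<bullet> \<eta>) \<le> h r * (2 * D)" .
  have "Re (E \<xi> \<eta>) = (Re (lexp \<xi> \<eta>) - b \<bullet> \<eta>) / h r" by (simp add: E_def cdot_def Re_divide_of_real)
  also have "\<dots> \<le> (h r * (4 * exp 2 * A - low_const * ?J) + h r * (2 * D)) / h r"
    using lexp_Re[OF e, of \<xi>] bb hr by (intro divide_right_mono) linarith+
  also have "\<dots> = (4 * exp 2 * A + 2 * D) + (- low_const * ?J)" using hr by (simp add: field_simps)
  finally have "norm (exp (E \<xi> \<eta>)) \<le> exp (4 * exp 2 * A + 2 * D) * exp (- low_const * ?J)"
    by (simp only: norm_exp_eq_Re exp_add[symmetric] exp_le_cancel_iff)
  also have "exp (- low_const * ?J) \<le> decay_const / (1 + r * norm \<xi>) ^ (DIM('a) + 5)"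
    using decay_const(2)[of "r * norm \<xi>"] r by (subst pos_le_divide_eq) (auto simp: mult.commute add_pos_nonneg)
  finally show ?thesis by (simp add: tube_const_def)
qed

lemma tube_bound:
  assumes e: "norm \<eta> \<le> 2 / r" and M: "multiplier r k B M" and k: "k \<le> 3"
  shows "norm (M \<xi> \<eta> * exp (E \<xi> \<eta>)) \<le> B * tube_const * (1 / (1 + r * norm \<xi>) ^ (DIM('a) + 2))"
proof -
  have B: "0 \<le> B" using M by (simp add: multiplier_def)
  define x where "x = 1 + r * norm \<xi>"
  have x: "1 \<le> x" using r by (simp add: x_def)
  have "norm (M \<xi> \<eta>) \<le> B * x ^ k" using M e by (simp add: multiplier_def x_def)
  also have "\<dots> \<le> B * x ^ 3" using B x k by (intro mult_left_mono power_increasing) auto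
  finally have "norm (M \<xi> \<eta>) * norm (exp (E \<xi> \<eta>)) \<le> (B * x ^ 3) * (tube_const / x ^ (DIM('a) + 5))"
    using exp_E_bound[OF e, of \<xi>] B x by (intro mult_mono) (auto simp: x_def)
  also have "x ^ (DIM('a) + 5) = x ^ 3 * x ^ (DIM('a) + 2)"
  proof -
    have eq: "DIM('a) + 5 = 3 + (DIM('a) + 2)" by simp
    show ?thesis unfolding eq by (rule power_add)
  qed
  also have "(B * x ^ 3) * (tube_const / (x ^ 3 * x ^ (DIM('a) + 2))) = B * tube_const * (1 / x ^ (DIM('a) + 2))"
    using x by simp
  finally show ?thesis by (simp only: norm_mult x_def)
qed


lemma E_holomorphic: "(\<lambda>s. E (\<xi> + Re s *\<^sub>R e) (Im s *\<^sub>R e)) holomorphic_on UNIV"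
  unfolding E_def cdot_line using hr by (intro holomorphic_intros lexp_holomorphic) auto

section \<open>Decay of the small-jump integrals\<close>

definition amp :: "('a \<Rightarrow> 'a \<Rightarrow> complex) \<Rightarrow> 'a \<Rightarrow> complex" where
  "amp M \<xi> = M \<xi> 0 * exp (E \<xi> 0)"

lemma amp_bound:
  assumes M: "multiplier r k B M" and k: "k \<le> 3"
  shows "norm (amp M \<xi>) \<le> B * tube_const * (1 / (1 + r * norm \<xi>) ^ (DIM('a) + 2))"
  unfolding amp_def using r by (intro tube_bound[OF _ M k]) auto

lemma multiplier_meas: "multiplier r k B M \<Longrightarrow> (\<lambda>\<xi>. M \<xi> \<eta>) \<in> borel_measurable borel"
  by (simp add: multiplier_def)

lemma amp_meas: assumes M: "multiplier r k B M" shows "amp M \<in> borel_measurable borel"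
proof -
  note [measurable] = multiplier_meas[OF M]
  show ?thesis unfolding amp_def[abs_def] by measurable
qed

lemma amp_integrable:
  assumes M: "multiplier r k B M" and k: "k \<le> 3"
  shows "integrable lborel (amp M)"
proof (rule Bochner_Integration.integrable_bound)
  show "integrable lborel (\<lambda>\<xi>. B * tube_const * (1 / (1 + r * norm (\<xi>::'a)) ^ (DIM('a) + 2)))"
    using poly_const(2)[OF r(1)] by (rule integrable_mult_right)
  show "amp M \<in> borel_measurable lborel" using amp_meas[OF M] by simp
  show "AE \<xi> in lborel. norm (amp M \<xi>) \<le> norm (B * tube_const * (1 / (1 + r * norm (\<xi>::'a)) ^ (DIM('a) + 2)))"
    by (rule AE_I2, unfold real_norm_def, rule order_trans[OF amp_bound[OF M k] abs_ge_self])
qed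

lemma shift_bound:
  assumes M: "multiplier r k B M" and k: "k \<le> 3"
  shows "norm (LBINT \<xi>. cis (- (w \<bullet> \<xi>)) * amp M \<xi>) \<le> B * tube_const * poly_const * (exp (- norm w / r) / r ^ DIM('a))"
proof -
  have B: "0 \<le> B" using M by (simp add: multiplier_def)
  note [measurable] = multiplier_meas[OF M]
  \<comment> \<open>Along this direction the Fourier factor has modulus exp(-|w|/r) at height 1/r.
    For w = 0 the division by zero yields e = 0, the shift is void and the estimate keeps its
    form.\<close>
  define e where "e = - (1 / norm w) *\<^sub>R w"
  have e1: "norm e \<le> 1" by (simp add: e_def)
  have we: "w \<bullet> e = - norm w" by (cases "w = 0") (auto simp: e_def power2_norm_eq_inner[symmetric] power2_eq_square)
  define H where "H = (\<lambda>\<xi> \<eta>. exp (- (\<i> * cdot w \<xi> \<eta>)) * (M \<xi> \<eta> * exp (E \<xi> \<eta>)))"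
  have wexp: "norm (exp (- (\<i> * cdot w \<xi> \<eta>))) = exp (w \<bullet> \<eta>)" for \<xi> \<eta> by (simp add: norm_exp_eq_Re cdot_def)
  \<comment> \<open>Only integrability of this majorant matters, so the growing factor exp(2 |w|/r)
    is harmless. The power of 2 pays for the real displacement, of length at most 1/r.\<close>
  define g where "g = (\<lambda>\<xi>::'a. exp (2 * norm w / r) * (B * tube_const * 2 ^ (DIM('a) + 2)) * (1 / (1 + r * norm \<xi>) ^ (DIM('a) + 2)))"
  have "(LBINT \<xi>. H \<xi> 0) = (LBINT \<xi>. H \<xi> ((1/r) *\<^sub>R e))"
  proof (rule contour_shift[where g = g])
    show "(\<lambda>s. H (\<xi> + Re s *\<^sub>R e) (Im s *\<^sub>R e)) holomorphic_on UNIV" for \<xi>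
    proof -
      have "(\<lambda>s. M (\<xi> + Re s *\<^sub>R e) (Im s *\<^sub>R e)) holomorphic_on UNIV" using M by (simp add: multiplier_def)
      then show ?thesis unfolding H_def cdot_line
        by (intro holomorphic_intros E_holomorphic holomorphic_on_compose[OF E_holomorphic, of exp, unfolded o_def])
    qed
    show "(\<lambda>\<xi>. H \<xi> \<eta>) \<in> borel_measurable borel" for \<eta> unfolding H_def by measurable
    show "integrable lborel g" unfolding g_def using poly_const(2)[OF r(1)] by (rule integrable_mult_right)
    fix \<xi> s assume s: "\<bar>Re s\<bar> \<le> 1 / r" "\<bar>Im s\<bar> \<le> 2 * (1 / r)"
    have sn: "norm (Im s *\<^sub>R e) \<le> 2 / r" using s(2) e1 mult_mono[of "\<bar>Im s\<bar>" "2 / r" "norm e" 1] r by simp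
    have rn: "norm (Re s *\<^sub>R e) \<le> 1 / r" using s(1) e1 mult_mono[of "\<bar>Re s\<bar>" "1 / r" "norm e" 1] r by simp
    define x where "x = 1 + r * norm (\<xi> + Re s *\<^sub>R e)"
    have x1: "1 \<le> x" using r by (simp add: x_def)
    have "norm \<xi> \<le> norm (\<xi> + Re s *\<^sub>R e) + norm (Re s *\<^sub>R e)" using norm_triangle_ineq4[of "\<xi> + Re s *\<^sub>R e" "Re s *\<^sub>R e"] by simp
    then have "r * norm \<xi> \<le> r * (norm (\<xi> + Re s *\<^sub>R e) + 1 / r)" using rn r by (intro mult_left_mono) auto
    also have "\<dots> = x" using r by (simp add: x_def distrib_left)
    finally have "1 + r * norm \<xi> \<le> 2 * x" using x1 by linarith
    then have "(1 + r * norm \<xi>) ^ (DIM('a) + 2) \<le> (2 * x) ^ (DIM('a) + 2)" using r by (intro power_mono) auto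
    then have "1 / x ^ (DIM('a) + 2) \<le> 2 ^ (DIM('a) + 2) * (1 / (1 + r * norm \<xi>) ^ (DIM('a) + 2))"
      unfolding power_mult_distrib using x1 r zero_less_power[of "1 + r * norm \<xi>" "DIM('a) + 2"] zero_less_power[of x "DIM('a) + 2"] by (simp add: pos_divide_le_eq field_simps add_pos_nonneg del: power_Suc power_Suc2 zero_less_power power_add add_2_eq_Suc' add_2_eq_Suc)
    then have inv: "B * tube_const * (1 / x ^ (DIM('a) + 2)) \<le> B * tube_const * (2 ^ (DIM('a) + 2) * (1 / (1 + r * norm \<xi>) ^ (DIM('a) + 2)))"
      using B tube_const by (intro mult_left_mono) auto
    have "w \<bullet> (Im s *\<^sub>R e) = - Im s * norm w" by (simp add: we)
    also have "\<dots> \<le> (2 / r) * norm w" using s by (intro mult_right_mono) auto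
    finally have w1: "exp (w \<bullet> (Im s *\<^sub>R e)) \<le> exp (2 * norm w / r)" by simp
    have "norm (H (\<xi> + Re s *\<^sub>R e) (Im s *\<^sub>R e)) \<le> exp (2 * norm w / r) * (B * tube_const * (1 / x ^ (DIM('a) + 2)))"
      unfolding H_def norm_mult[of "exp _"] wexp x_def by (intro mult_mono w1 tube_bound[OF sn M k]) auto
    also have "\<dots> \<le> g \<xi>" using mult_left_mono[OF inv exp_ge_zero] by (simp only: g_def mult.assoc)
    finally show "norm (H (\<xi> + Re s *\<^sub>R e) (Im s *\<^sub>R e)) \<le> g \<xi>" .
  qed (use r in auto)
  moreover have "H \<xi> 0 = cis (- (w \<bullet> \<xi>)) * amp M \<xi>" for \<xi>
    by (simp add: H_def amp_def cdot_0 cis_conv_exp)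
  ultimately have "(LBINT \<xi>. cis (- (w \<bullet> \<xi>)) * amp M \<xi>) = (LBINT \<xi>. H \<xi> ((1/r) *\<^sub>R e))" by simp
  also have "norm \<dots> \<le> (LBINT \<xi>. exp (- norm w / r) * (B * tube_const) * (1 / (1 + r * norm (\<xi>::'a)) ^ (DIM('a) + 2)))"
  proof -
    have sn: "norm ((1/r) *\<^sub>R e) \<le> 2 / r" using e1 r by (simp add: field_simps)
    have le: "norm (H \<xi> ((1/r) *\<^sub>R e)) \<le> exp (- norm w / r) * (B * tube_const) * (1 / (1 + r * norm (\<xi>::'a)) ^ (DIM('a) + 2))" for \<xi>
    proof -
      have "norm (H \<xi> ((1/r) *\<^sub>R e)) \<le> exp (- norm w / r) * (B * tube_const * (1 / (1 + r * norm \<xi>) ^ (DIM('a) + 2)))"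
        unfolding H_def norm_mult[of "exp _"] wexp by (intro mult_mono tube_bound[OF sn M k]) (auto simp: we)
      then show ?thesis by (simp only: mult.assoc)
    qed
    have gi: "integrable lborel (\<lambda>\<xi>::'a. exp (- norm w / r) * (B * tube_const) * (1 / (1 + r * norm \<xi>) ^ (DIM('a) + 2)))"
      using poly_const(2)[OF r(1)] by (rule integrable_mult_right)
    have "integrable lborel (\<lambda>\<xi>. H \<xi> ((1/r) *\<^sub>R e))"
    proof (rule Bochner_Integration.integrable_bound[OF gi])
      show "(\<lambda>\<xi>. H \<xi> ((1/r) *\<^sub>R e)) \<in> borel_measurable lborel" unfolding H_def by measurable
    qed (rule AE_I2, unfold real_norm_def, rule order_trans[OF le abs_ge_self])
    then show ?thesis using gi le by (rule Bochner_Integration.integral_norm_bound_integral)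
  qed
  also have "\<dots> = exp (- norm w / r) * (B * tube_const) * (LBINT \<xi>. 1 / (1 + r * norm (\<xi>::'a)) ^ (DIM('a) + 2))"
    by (rule integral_mult_right_zero)
  also have "\<dots> \<le> exp (- norm w / r) * (B * tube_const) * (poly_const / r ^ DIM('a))"
    using B tube_const by (intro mult_left_mono poly_const(3) r) auto
  finally show ?thesis by (simp add: mult_ac)
qed

lemma small_jump_bound:
  assumes M: "multiplier r k B M" and k: "k \<le> 3"
  shows "norm (LBINT \<xi>. cis (- (w \<bullet> \<xi>)) * amp M \<xi>) \<le> small_const * B * rr r w"
proof -
  let ?d = "DIM('a)"
  have B: "0 \<le> B" using M by (simp add: multiplier_def)
  have "exp (- norm w / r) / r ^ ?d \<le> fact (?d + 2) * (CK * rr r w)"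
  proof (cases "norm w \<le> r")
    case True
    have "exp (- norm w / r) / r ^ ?d \<le> 1 / r ^ ?d" using r by (intro divide_right_mono) auto
    also have "\<dots> \<le> 1 * (CK * rr r w)" using rr_lower_near[OF r True] by simp
    also have "\<dots> \<le> fact (?d + 2) * (CK * rr r w)"
      using CK1 rr_pos[OF r(1), of w] by (intro mult_right_mono fact_ge_1) auto
    finally show ?thesis .
  next
    case False
    define y where "y = norm w / r"
    have y: "0 < y" unfolding y_def using False r by (intro divide_pos_pos) auto
    have "y ^ (?d + 2) / fact (?d + 2) \<le> exp y" using y by (intro power_div_fact_le_exp) auto
    then have "exp (- y) \<le> fact (?d + 2) / y ^ (?d + 2)"
      using y zero_less_power[OF y, of "?d + 2"] by (simp only: exp_minus) (simp add: field_simps del: power_Suc fact_Suc add_2_eq_Suc')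
    then have "exp (- norm w / r) / r ^ ?d \<le> (fact (?d + 2) / y ^ (?d + 2)) / r ^ ?d"
      using r by (intro divide_right_mono) (auto simp: y_def)
    also have "\<dots> = fact (?d + 2) * (r\<^sup>2 / norm w ^ (?d + 2))"
    proof -
      have "y ^ (?d + 2) * r ^ ?d * r\<^sup>2 = norm w ^ (?d + 2)"
      proof -
        have "y ^ (?d + 2) * r ^ ?d * r\<^sup>2 = y ^ (?d + 2) * r ^ (?d + 2)" by (simp only: power_add mult.assoc)
        also have "\<dots> = (y * r) ^ (?d + 2)" by (simp only: power_mult_distrib)
        finally show ?thesis using r by (simp add: y_def)
      qed
      moreover have "w \<noteq> 0" using False r by auto
      ultimately show ?thesis using r y by (simp add: divide_simps mult_ac del: power_Suc fact_Suc add_2_eq_Suc')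
    qed
    also have "\<dots> \<le> fact (?d + 2) * (CK * rr r w)"
      using rr_lower_far[OF r, of w] False by (intro mult_left_mono) auto
    finally show ?thesis .
  qed
  then have "B * tube_const * poly_const * (exp (- norm w / r) / r ^ ?d) \<le> B * tube_const * poly_const * (fact (?d + 2) * (CK * rr r w))"
    using B tube_const poly_const(1) by (intro mult_left_mono) auto
  then show ?thesis using shift_bound[OF M k, of w] by (simp add: small_const_def mult_ac)
qed

section \<open>Large jumps as a convergent series\<close>

definition hat :: "'a \<Rightarrow> complex" where
  "hat \<xi> = (LBINT z. cis (\<xi> \<bullet> z) * complex_of_real (N2 z))"

lemma hat_meas [measurable]: "hat \<in> borel_measurable borel"
  unfolding hat_def[abs_def] by measurable

definition L2 :: real where "L2 = (LBINT z. N2 z)"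

lemma L2: "0 \<le> L2" "L2 \<le> A * h r"
  using N2_integrable(2) by (auto simp: L2_def N2_nonneg)

lemma cis_N2_integrable: "integrable lborel (\<lambda>z. cis (\<xi> \<bullet> z) * complex_of_real (N2 z))"
  by (rule Bochner_Integration.integrable_bound[OF N2_integrable(1)]) (auto simp: norm_mult)

lemma hat_le: "norm (hat \<xi>) \<le> L2"
  unfolding hat_def L2_def
  by (rule Bochner_Integration.integral_norm_bound_integral[OF cis_N2_integrable N2_integrable(1)]) (simp add: norm_mult N2_nonneg)

text \<open>Up to 1 / (n! h(r)^n) this is the n-th term after expanding the exponential of the large
  jumps: the small-jump integral convolved n times with \<open>N2\<close>. Convolution powers of
  \<open>N2\<close> are never formed; \<open>F_Suc\<close> adds one convolution at a time by
  Fubini.\<close>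

definition F :: "('a \<Rightarrow> 'a \<Rightarrow> complex) \<Rightarrow> nat \<Rightarrow> 'a \<Rightarrow> complex" where
  "F M n w = (LBINT \<xi>. cis (- (w \<bullet> \<xi>)) * amp M \<xi> * hat \<xi> ^ n)"

lemma F_integrable:
  assumes M: "multiplier r k B M" and k: "k \<le> 3"
  shows "integrable lborel (\<lambda>\<xi>. cis (- (w \<bullet> \<xi>)) * amp M \<xi> * hat \<xi> ^ n)"
    "(LBINT \<xi>. norm (cis (- (w \<bullet> \<xi>)) * amp M \<xi> * hat \<xi> ^ n)) \<le> L2 ^ n * (LBINT \<xi>. norm (amp M \<xi>))"
proof -
  note [measurable] = amp_meas[OF M]
  have i: "integrable lborel (\<lambda>\<xi>. L2 ^ n * norm (amp M \<xi>))"
    using amp_integrable[OF M k] by (intro integrable_mult_right integrable_norm)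
  have le: "norm (cis (- (w \<bullet> \<xi>)) * amp M \<xi> * hat \<xi> ^ n) \<le> L2 ^ n * norm (amp M \<xi>)" for \<xi>
  proof -
    have "norm (hat \<xi>) ^ n \<le> L2 ^ n" by (intro power_mono hat_le) auto
    then show ?thesis by (simp add: norm_mult norm_power mult.commute mult_right_mono)
  qed
  show j: "integrable lborel (\<lambda>\<xi>. cis (- (w \<bullet> \<xi>)) * amp M \<xi> * hat \<xi> ^ n)"
  proof (rule Bochner_Integration.integrable_bound[OF i])
    show "AE \<xi> in lborel. norm (cis (- (w \<bullet> \<xi>)) * amp M \<xi> * hat \<xi> ^ n) \<le> norm (L2 ^ n * norm (amp M \<xi>))"
      by (rule AE_I2, rule order_trans[OF le]) simp
  qed measurable
  have "(LBINT \<xi>. norm (cis (- (w \<bullet> \<xi>)) * amp M \<xi> * hat \<xi> ^ n)) \<le> (LBINT \<xi>. L2 ^ n * norm (amp M \<xi>))"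
    by (intro integral_mono integrable_norm j i le)
  then show "(LBINT \<xi>. norm (cis (- (w \<bullet> \<xi>)) * amp M \<xi> * hat \<xi> ^ n)) \<le> L2 ^ n * (LBINT \<xi>. norm (amp M \<xi>))"
    by simp
qed

lemma F_Suc:
  assumes M: "multiplier r k B M" and k: "k \<le> 3"
  shows "F M (Suc n) w = (LBINT z. F M n (w - z) * complex_of_real (N2 z))"
    "integrable lborel (\<lambda>z. F M n (w - z) * complex_of_real (N2 z))"
proof -
  note [measurable] = amp_meas[OF M]
  define u where "u = (\<lambda>\<xi> z. cis (- ((w - z) \<bullet> \<xi>)) * amp M \<xi> * hat \<xi> ^ n * complex_of_real (N2 z))"
  have um [measurable]: "(\<lambda>(\<xi>, z). u \<xi> z) \<in> borel_measurable (lborel \<Otimes>\<^sub>M lborel)"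
    unfolding u_def by measurable
  have split: "cis (- ((w - z) \<bullet> \<xi>)) = cis (- (w \<bullet> \<xi>)) * cis (\<xi> \<bullet> z)" for z \<xi>
    by (simp add: cis_mult inner_diff_left inner_commute[of \<xi> z])
  have u2: "u \<xi> z = cis (- (w \<bullet> \<xi>)) * amp M \<xi> * hat \<xi> ^ n * (cis (\<xi> \<bullet> z) * complex_of_real (N2 z))" for \<xi> z
    by (simp add: u_def split mult_ac)
  have nu: "norm (u \<xi> z) = norm (cis (- (w \<bullet> \<xi>)) * amp M \<xi> * hat \<xi> ^ n) * N2 z" for \<xi> z
    by (simp add: u_def norm_mult N2_nonneg)
  have ui: "integrable (lborel \<Otimes>\<^sub>M lborel) (\<lambda>(\<xi>, z). u \<xi> z)"
  proof (rule lborel_pair.Fubini_integrable)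
    show "integrable lborel (\<lambda>x. LBINT y. norm (case (x, y) of (\<xi>, z) \<Rightarrow> u \<xi> z))"
      using F_integrable(1)[OF M k, of w n] by (simp add: nu)
    show "AE x in lborel. integrable lborel (\<lambda>y. case (x, y) of (\<xi>, z) \<Rightarrow> u \<xi> z)"
      using cis_N2_integrable by (auto simp: u2)
  qed measurable
  have "F M (Suc n) w = (\<integral>\<xi>. \<integral>z. u \<xi> z \<partial>lborel \<partial>lborel)"
  proof -
    have "(LBINT z. u \<xi> z) = cis (- (w \<bullet> \<xi>)) * amp M \<xi> * hat \<xi> ^ n * hat \<xi>" for \<xi>
      unfolding u2 hat_def[of \<xi>] by (rule integral_mult_right_zero)
    then show ?thesis unfolding F_def by (simp add: mult_ac)
  qed
  also have "\<dots> = (\<integral>z. \<integral>\<xi>. u \<xi> z \<partial>lborel \<partial>lborel)"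
    using lborel_pair.Fubini_integral[OF ui] by simp
  finally have 1: "F M (Suc n) w = (\<integral>z. \<integral>\<xi>. u \<xi> z \<partial>lborel \<partial>lborel)" .
  have 2: "(LBINT \<xi>. u \<xi> z) = F M n (w - z) * complex_of_real (N2 z)" for z
    unfolding u_def F_def by (rule integral_mult_left_zero)
  show "F M (Suc n) w = (LBINT z. F M n (w - z) * complex_of_real (N2 z))" using 1 by (simp add: 2)
  have "integrable lborel (\<lambda>z. \<integral>\<xi>. u \<xi> z \<partial>lborel)" using lborel_pair.integrable_snd[OF ui] .
  then show "integrable lborel (\<lambda>z. F M n (w - z) * complex_of_real (N2 z))" by (simp add: 2)
qed

lemma F_bound:
  assumes M: "multiplier r k B M" and k: "k \<le> 3"
  shows "norm (F M n w) \<le> small_const * B * (A * conv_const * h r) ^ n * rr r w"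
proof (induction n arbitrary: w)
  case 0
  show ?case using small_jump_bound[OF M k, of w] by (simp add: F_def)
next
  case (Suc n)
  have B: "0 \<le> B" using M by (simp add: multiplier_def)
  define c where "c = small_const * B * (A * conv_const * h r) ^ n"
  have c: "0 \<le> c" using B small_const A conv_const(1) hr by (simp add: c_def)
  have rrw: "0 < rr r w" for w by (rule rr_pos[OF r(1)])
  have ri: "integrable lborel (\<lambda>z. (indicator (- ball 0 r) z * rr r (w - z)) * N z)"
    "(LBINT z. (indicator (- ball 0 r) z * rr r (w - z)) * N z) \<le> A * (conv_const * h r * rr r w)"
    using conv_const(2)[OF r(1), of w] conv_const(1) hr rrw[of w] less_imp_le[OF rrw]
    by (auto intro!: N_integral)
  have eq: "(indicator (- ball 0 r) z * rr r (w - z)) * N z = rr r (w - z) * N2 z" for z by (simp add: N2_def)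
  have "norm (F M (Suc n) w) \<le> (LBINT z. c * (rr r (w - z) * N2 z))"
    unfolding F_Suc(1)[OF M k]
  proof (rule Bochner_Integration.integral_norm_bound_integral[OF F_Suc(2)[OF M k]])
    show "integrable lborel (\<lambda>z. c * (rr r (w - z) * N2 z))" using ri(1) unfolding eq by (rule integrable_mult_right)
    show "norm (F M n (w - z) * complex_of_real (N2 z)) \<le> c * (rr r (w - z) * N2 z)" for z
      using mult_right_mono[OF Suc.IH[of "w - z"] N2_nonneg[of z]] by (simp add: norm_mult N2_nonneg c_def mult.assoc)
  qed
  also have "\<dots> = c * (LBINT z. rr r (w - z) * N2 z)" by simp
  also have "\<dots> \<le> c * (A * (conv_const * h r * rr r w))"
    using ri(2) unfolding eq by (intro mult_left_mono c) auto
  finally show ?case by (simp add: c_def mult_ac)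
qed

text \<open>Minus t times the full symbol, t = 1 / h(r). The term \<open>hat - L2\<close> is the
  exponent of the compound Poisson process of large jumps.\<close>

definition tpsi :: "'a \<Rightarrow> complex" where
  "tpsi \<xi> = E \<xi> 0 + (hat \<xi> - complex_of_real L2) / complex_of_real (h r)"

lemma tpsi_meas [measurable]: "tpsi \<in> borel_measurable borel"
  unfolding tpsi_def[abs_def] by measurable

lemma exp_tpsi_le: "norm (exp (tpsi \<xi>)) \<le> norm (exp (E \<xi> 0))"
proof -
  have "Re (hat \<xi>) \<le> L2" using hat_le[of \<xi>] complex_Re_le_cmod[of "hat \<xi>"] by linarith
  then have "Re (tpsi \<xi>) \<le> Re (E \<xi> 0)" using hr by (simp add: tpsi_def Re_divide_of_real divide_nonpos_pos)
  then show ?thesis by (simp add: norm_exp_eq_Re)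
qed

lemma kernel_integrable:
  assumes M: "multiplier r k B M" and k: "k \<le> 3"
  shows "integrable lborel (\<lambda>\<xi>. cis (- (w \<bullet> \<xi>)) * (M \<xi> 0 * exp (tpsi \<xi>)))"
proof -
  note [measurable] = multiplier_meas[OF M]
  show ?thesis
  proof (rule Bochner_Integration.integrable_bound[OF amp_integrable[OF M k]])
    show "AE \<xi> in lborel. norm (cis (- (w \<bullet> \<xi>)) * (M \<xi> 0 * exp (tpsi \<xi>))) \<le> norm (amp M \<xi>)"
      using exp_tpsi_le by (auto simp: norm_mult amp_def intro!: mult_left_mono)
  qed measurable
qed

text \<open>In \<open>F_bound\<close> each convolution gains h(r), which cancels against t = 1 /
  h(r); the n-th term is then of order q^n / n! and the series sums to exp q, whatever r is.\<close>

theorem kernel_bound: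
  assumes M: "multiplier r k B M" and k: "k \<le> 3"
  shows "norm (LBINT \<xi>. cis (- (w \<bullet> \<xi>)) * (M \<xi> 0 * exp (tpsi \<xi>))) \<le> core_const * B * rr r w"
proof -
  have B: "0 \<le> B" using M by (simp add: multiplier_def)
  note [measurable] = multiplier_meas[OF M] amp_meas[OF M]
  let ?f = "\<lambda>n \<xi>. cis (- (w \<bullet> \<xi>)) * amp M \<xi> * hat \<xi> ^ n * complex_of_real (1 / (fact n * h r ^ n))"
  define q where "q = A * conv_const"
  have fi: "integrable lborel (?f n)" for n
    using F_integrable(1)[OF M k, of w n] by (rule integrable_mult_left)
  have sums: "(\<lambda>n. ?f n \<xi>) sums (cis (- (w \<bullet> \<xi>)) * amp M \<xi> * exp (hat \<xi> / complex_of_real (h r)))" for \<xi>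
  proof -
    have "(\<lambda>n. (hat \<xi> / complex_of_real (h r)) ^ n /\<^sub>R fact n) sums exp (hat \<xi> / complex_of_real (h r))" by (rule exp_converges)
    then have "(\<lambda>n. cis (- (w \<bullet> \<xi>)) * amp M \<xi> * ((hat \<xi> / complex_of_real (h r)) ^ n /\<^sub>R fact n)) sums (cis (- (w \<bullet> \<xi>)) * amp M \<xi> * exp (hat \<xi> / complex_of_real (h r)))"
      by (rule sums_mult)
    then show ?thesis by (simp add: scaleR_conv_of_real power_divide field_simps)
  qed
  have nle: "norm (?f n \<xi>) \<le> norm (amp M \<xi>) * ((L2 / h r) ^ n /\<^sub>R fact n)" for n \<xi>
  proof -
    have "norm (hat \<xi>) ^ n \<le> L2 ^ n" by (intro power_mono hat_le) auto
    then have "norm (amp M \<xi>) * (norm (hat \<xi>) ^ n * (1 / (fact n * h r ^ n))) \<le> norm (amp M \<xi>) * (L2 ^ n * (1 / (fact n * h r ^ n)))"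
      using hr by (intro mult_left_mono mult_right_mono) auto
    then show ?thesis using hr by (simp add: norm_mult norm_power norm_divide power_divide field_simps)
  qed
  have summ: "summable (\<lambda>n. c * ((L2 / h r) ^ n /\<^sub>R fact n))" for c by (intro summable_mult summable_exp_generic)
  \<comment> \<open>Termwise integration is justified by the exponential series of L2 / h(r), which
    dominates the norms.\<close>
  have s1: "(\<lambda>n. integral\<^sup>L lborel (?f n)) sums (LBINT \<xi>. (\<Sum>n. ?f n \<xi>))"
  proof (rule sums_integral[OF fi])
    show "AE \<xi> in lborel. summable (\<lambda>n. norm (?f n \<xi>))"
      by (rule AE_I2, rule summable_comparison_test[OF _ summ]) (use nle in auto)
    show "summable (\<lambda>n. LINT \<xi>|lborel. norm (?f n \<xi>))"
    proof (rule summable_comparison_test[OF _ summ[of "\<integral>\<xi>. norm (amp M \<xi>) \<partial>lborel"]], intro exI allI impI)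
      fix n
      have "(LINT \<xi>|lborel. norm (?f n \<xi>)) \<le> (LINT \<xi>|lborel. norm (amp M \<xi>) * ((L2 / h r) ^ n /\<^sub>R fact n))"
        using amp_integrable[OF M k] by (intro integral_mono nle integrable_norm fi integrable_mult_left) auto
      then show "norm (LINT \<xi>|lborel. norm (?f n \<xi>)) \<le> (LBINT \<xi>. norm (amp M \<xi>)) * ((L2 / h r) ^ n /\<^sub>R fact n)"
        by simp
    qed
  qed
  have s2: "integral\<^sup>L lborel (?f n) = F M n w * complex_of_real (1 / (fact n * h r ^ n))" for n
    unfolding F_def by (rule integral_mult_left_zero)
  have s3: "(\<Sum>n. ?f n \<xi>) = cis (- (w \<bullet> \<xi>)) * amp M \<xi> * exp (hat \<xi> / complex_of_real (h r))" for \<xi>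
    using sums_unique[OF sums] by simp
  have S: "(\<lambda>n. F M n w * complex_of_real (1 / (fact n * h r ^ n))) sums (LBINT \<xi>. cis (- (w \<bullet> \<xi>)) * amp M \<xi> * exp (hat \<xi> / complex_of_real (h r)))"
    using s1 unfolding s2 s3 .
  have bn: "norm (F M n w * complex_of_real (1 / (fact n * h r ^ n))) \<le> small_const * B * rr r w * (q ^ n /\<^sub>R fact n)" for n
  proof -
    have "norm (F M n w) * (1 / (fact n * h r ^ n)) \<le> (small_const * B * (A * conv_const * h r) ^ n * rr r w) * (1 / (fact n * h r ^ n))"
      using hr by (intro mult_right_mono F_bound[OF M k]) auto
    also have "\<dots> = small_const * B * rr r w * (q ^ n /\<^sub>R fact n)"
      using hr by (simp add: power_mult_distrib q_def field_simps)
    finally show ?thesis using hr by (simp add: norm_mult norm_divide norm_power)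
  qed
  have T: "(\<lambda>n. small_const * B * rr r w * (q ^ n /\<^sub>R fact n)) sums (small_const * B * rr r w * exp q)"
    by (intro sums_mult exp_converges)
  have "norm (LBINT \<xi>. cis (- (w \<bullet> \<xi>)) * amp M \<xi> * exp (hat \<xi> / complex_of_real (h r))) \<le> small_const * B * rr r w * exp q"
  proof -
    have sn: "summable (\<lambda>n. norm (F M n w * complex_of_real (1 / (fact n * h r ^ n))))"
      by (rule summable_comparison_test[OF _ sums_summable[OF T]]) (use bn in auto)
    show ?thesis unfolding sums_unique[OF S] sums_unique[OF T]
      by (rule order_trans[OF summable_norm[OF sn] suminf_le[OF bn sn sums_summable[OF T]]])
  qed
  \<comment> \<open>The total mass of the large jumps enters only through a constant factor of
    modulus at most 1.\<close>
  moreover have "(LBINT \<xi>. cis (- (w \<bullet> \<xi>)) * (M \<xi> 0 * exp (tpsi \<xi>))) =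
     (LBINT \<xi>. cis (- (w \<bullet> \<xi>)) * amp M \<xi> * exp (hat \<xi> / complex_of_real (h r))) * exp (- (complex_of_real L2 / complex_of_real (h r)))"
    by (subst integral_mult_left_zero[symmetric], intro Bochner_Integration.integral_cong refl)
      (simp add: tpsi_def amp_def exp_add[symmetric] diff_divide_distrib add_diff_eq mult.assoc)
  moreover have "norm (exp (- (complex_of_real L2 / complex_of_real (h r)))) \<le> 1"
    using L2(1) hr by (simp add: norm_exp_eq_Re Re_divide_of_real)
  ultimately have "norm (LBINT \<xi>. cis (- (w \<bullet> \<xi>)) * (M \<xi> 0 * exp (tpsi \<xi>))) \<le> small_const * B * rr r w * exp q * 1"
    unfolding norm_mult using B small_const rr_pos[OF r(1), of w] by (simp only: norm_mult) (intro mult_mono, auto)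
  then show ?thesis by (simp add: core_const_def q_def mult_ac)
qed

section \<open>Compensators and drift\<close>

definition base :: "'a \<Rightarrow> complex" where
  "base \<xi> = lexp \<xi> 0 + hat \<xi> - complex_of_real L2"

lemma tpsi_base: "tpsi \<xi> = (base \<xi> + \<i> * complex_of_real (b \<bullet> \<xi>)) / complex_of_real (h r)"
  by (simp add: tpsi_def base_def E_def cdot_0 add_divide_distrib diff_divide_distrib)

lemma base_eq:
  "base \<xi> = (LBINT z. (cis (\<xi> \<bullet> z) - 1 - \<i> * complex_of_real (\<xi> \<bullet> z * indicator (ball 0 r) z)) * complex_of_real (N z))"
  "integrable lborel (\<lambda>z. (cis (\<xi> \<bullet> z) - 1 - \<i> * complex_of_real (\<xi> \<bullet> z * indicator (ball 0 r) z)) * complex_of_real (N z))"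
proof -
  let ?a = "\<lambda>z. complex_of_real (N1 z) * (exp (\<i> * cdot z \<xi> 0) - 1 - \<i> * cdot z \<xi> 0)"
  let ?b = "\<lambda>z. cis (\<xi> \<bullet> z) * complex_of_real (N2 z)"
  let ?c = "\<lambda>z. complex_of_real (N2 z)"
  have i: "integrable lborel ?a" "integrable lborel ?b" "integrable lborel ?c"
    using lexp_integrable cis_N2_integrable N2_integrable(1) by auto
  have eq: "(cis (\<xi> \<bullet> z) - 1 - \<i> * complex_of_real (\<xi> \<bullet> z * indicator (ball 0 r) z)) * complex_of_real (N z) = ?a z + ?b z - ?c z" for z
    by (auto simp: N1_def N2_def cdot_0 cis_conv_exp inner_commute indicator_def algebra_simps)
  have "base \<xi> = integral\<^sup>L lborel ?a + integral\<^sup>L lborel ?b - integral\<^sup>L lborel ?c"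
    by (simp add: base_def lexp_def hat_def L2_def)
  also have "\<dots> = (LBINT z. ?a z + ?b z - ?c z)" using i by simp
  finally show "base \<xi> = (LBINT z. (cis (\<xi> \<bullet> z) - 1 - \<i> * complex_of_real (\<xi> \<bullet> z * indicator (ball 0 r) z)) * complex_of_real (N z))"
    unfolding eq .
  show "integrable lborel (\<lambda>z. (cis (\<xi> \<bullet> z) - 1 - \<i> * complex_of_real (\<xi> \<bullet> z * indicator (ball 0 r) z)) * complex_of_real (N z))"
    unfolding eq using i by auto
qed

text \<open>Exchanging the compensator cutoff at r for another one alters the exponent by a term
  linear in \<xi>, with coefficient the vector integral of c(z) z against the jump density. P1 takes
  for c the difference of the two balls, P2 the whole ball.\<close>

lemma drift:
  fixes c :: "'a \<Rightarrow> real"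
  assumes [measurable]: "c \<in> borel_measurable borel" and I: "nuint (\<lambda>z. \<bar>c z\<bar> * norm z) \<le> ennreal I" "0 \<le> I"
  obtains b' where "norm b' \<le> A * I"
    "\<And>\<xi>. base \<xi> + \<i> * complex_of_real (b' \<bullet> \<xi>) =
      (LBINT z. (cis (\<xi> \<bullet> z) - 1 - \<i> * complex_of_real (\<xi> \<bullet> z * (indicator (ball 0 r) z - c z))) * complex_of_real (N z))"
proof
  note Ni = N_integral[OF _ _ I, simplified]
  have vi: "integrable lborel (\<lambda>z. (c z * N z) *\<^sub>R z)"
    by (rule Bochner_Integration.integrable_bound[OF Ni(1)]) (auto simp: abs_mult N0 mult_ac)
  show "norm (LBINT z. (c z * N z) *\<^sub>R z) \<le> A * I"
    by (rule order_trans[OF Bochner_Integration.integral_norm_bound_integral[OF vi Ni(1)] Ni(2)]) (auto simp: abs_mult N0 mult_ac)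
  fix \<xi>
  have si: "integrable lborel (\<lambda>z. c z * N z * (\<xi> \<bullet> z))"
    using integrable_inner_right[OF vi, of \<xi>] by simp
  have "(LBINT z. (c z * N z) *\<^sub>R z) \<bullet> \<xi> = (LBINT z. c z * N z * (\<xi> \<bullet> z))"
    by (subst integral_inner_left[symmetric]) (auto simp: vi inner_commute)
  then have "base \<xi> + \<i> * complex_of_real ((LBINT z. (c z * N z) *\<^sub>R z) \<bullet> \<xi>)
    = base \<xi> + \<i> * (LBINT z. complex_of_real (c z * N z * (\<xi> \<bullet> z)))"
    by (simp only: integral_complex_of_real)
  also have "\<dots> = (LBINT z. (cis (\<xi> \<bullet> z) - 1 - \<i> * complex_of_real (\<xi> \<bullet> z * indicator (ball 0 r) z)) * complex_of_real (N z) + \<i> * complex_of_real (c z * N z * (\<xi> \<bullet> z)))"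
    unfolding base_eq(1) using base_eq(2) si by (subst Bochner_Integration.integral_add) (auto simp del: of_real_mult)
  also have "\<dots> = (LBINT z. (cis (\<xi> \<bullet> z) - 1 - \<i> * complex_of_real (\<xi> \<bullet> z * (indicator (ball 0 r) z - c z))) * complex_of_real (N z))"
    by (intro Bochner_Integration.integral_cong refl) (simp add: algebra_simps)
  finally show "base \<xi> + \<i> * complex_of_real ((LBINT z. (c z * N z) *\<^sub>R z) \<bullet> \<xi>) = (LBINT z. (cis (\<xi> \<bullet> z) - 1 - \<i> * complex_of_real (\<xi> \<bullet> z * (indicator (ball 0 r) z - c z))) * complex_of_real (N z))" .
qed

text \<open>Adding the integral to its reflection under z \<mapsto> -z cancels the sine and the
  compensator pointwise, so no integrability of the separate terms is needed.\<close>

lemma base_symmetric: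
  assumes sym: "\<And>z. N (- z) = N z"
  shows "base \<xi> = - complex_of_real (LBINT z. (1 - cos (\<xi> \<bullet> z)) * N z)"
proof -
  let ?G = "\<lambda>z. (cis (\<xi> \<bullet> z) - 1 - \<i> * complex_of_real (\<xi> \<bullet> z * indicator (ball 0 r) z)) * complex_of_real (N z)"
  have "(LBINT z. ?G z) = (\<integral>z. ?G z \<partial>(distr lborel borel uminus))" by (simp only: lborel_distr_minus)
  also have "\<dots> = (LBINT z. ?G (- z))" by (subst integral_distr) auto
  finally have e: "(LBINT z. ?G z) = (LBINT z. ?G (- z))" .
  have "integrable (distr lborel borel uminus) ?G" using base_eq(2) by (simp only: lborel_distr_minus)
  then have i: "integrable lborel (\<lambda>z. ?G (- z))" by (subst (asm) integrable_distr_eq) auto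
  have "2 * base \<xi> = (LBINT z. ?G z + ?G (- z))"
    unfolding base_eq(1) using e i base_eq(2) by (subst Bochner_Integration.integral_add) auto
  also have "\<dots> = (LBINT z. - 2 * complex_of_real ((1 - cos (\<xi> \<bullet> z)) * N z))"
    by (intro Bochner_Integration.integral_cong refl) (auto simp: sym complex_eq_iff indicator_def algebra_simps)
  also have "\<dots> = - 2 * complex_of_real (LBINT z. (1 - cos (\<xi> \<bullet> z)) * N z)"
    by (simp only: integral_mult_right_zero integral_complex_of_real)
  finally show ?thesis by simp
qed

end

section \<open>Increments of the heat kernel\<close>

text \<open>Only these two facts about the symbol are used from here on. Drift, cut and series are
  hidden, which lets the three cases share the rest of the argument.\<close>

locale levy_core = levy_scaling \<nu> ty R \<alpha> C for \<nu> and ty :: "'a::euclidean_space itself" and R \<alpha> C +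
  fixes r c0 :: real and \<psi> :: "'a \<Rightarrow> complex"
  assumes r: "0 < r" "r \<le> R" and c0: "0 < c0"
    and core_int: "multiplier r k B M \<Longrightarrow> k \<le> 3 \<Longrightarrow>
      integrable lborel (\<lambda>\<xi>. cis (- (w \<bullet> \<xi>)) * (M \<xi> 0 * exp (- complex_of_real (1 / h r) * \<psi> \<xi>)))"
    and core_bound: "multiplier r k B M \<Longrightarrow> k \<le> 3 \<Longrightarrow>
      norm (LBINT \<xi>. cis (- (w \<bullet> \<xi>)) * (M \<xi> 0 * exp (- complex_of_real (1 / h r) * \<psi> \<xi>))) \<le> c0 * B * rr r w"
begin

lemma hr: "0 < h r" using h_pos r by blast
lemma rrw: "0 < rr r w" by (rule rr_pos[OF r(1)])

section \<open>Fourier integrals and translations\<close>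

definition ker :: "('a \<Rightarrow> 'a \<Rightarrow> complex) \<Rightarrow> 'a \<Rightarrow> 'a \<Rightarrow> complex" where
  "ker M w \<xi> = cis (- (w \<bullet> \<xi>)) * (M \<xi> 0 * exp (- complex_of_real (1 / h r) * \<psi> \<xi>))"

definition g :: "('a \<Rightarrow> 'a \<Rightarrow> complex) \<Rightarrow> 'a \<Rightarrow> complex" where
  "g M w = (LBINT \<xi>. ker M w \<xi>)"

lemma ker_integrable: "multiplier r k B M \<Longrightarrow> k \<le> 3 \<Longrightarrow> integrable lborel (ker M w)"
  unfolding ker_def[abs_def] by (rule core_int)

lemma g_bound: "multiplier r k B M \<Longrightarrow> k \<le> 3 \<Longrightarrow> norm (g M w) \<le> c0 * B * rr r w"
  unfolding g_def ker_def[abs_def] by (rule core_bound)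

text \<open>Moving x by u moves w = y - x by -u; this is how every difference in x becomes a
  multiplier.\<close>

lemma ker_shift: "ker (\<lambda>\<xi> \<eta>. M \<xi> \<eta> * exp (\<i> * cdot u \<xi> \<eta>)) w = ker M (w - u)"
proof
  fix \<xi>
  have "cis (- ((w - u) \<bullet> \<xi>)) = cis (- (w \<bullet> \<xi>)) * exp (\<i> * cdot u \<xi> 0)"
    by (simp add: cdot_0 cis_conv_exp exp_add[symmetric] inner_diff_left algebra_simps)
  then show "ker (\<lambda>\<xi> \<eta>. M \<xi> \<eta> * exp (\<i> * cdot u \<xi> \<eta>)) w \<xi> = ker M (w - u) \<xi>"
    by (simp add: ker_def mult_ac)
qed

lemma ker_shift_neg: "ker (\<lambda>\<xi> \<eta>. M \<xi> \<eta> * exp (- (\<i> * cdot u \<xi> \<eta>))) w = ker M (w + u)"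
proof -
  have "- (\<i> * cdot u \<xi> \<eta>) = \<i> * cdot (- u) \<xi> \<eta>" for \<xi> \<eta> :: 'a by (simp add: cdot_def complex_eq_iff)
  then show ?thesis using ker_shift[of M "- u" w] by simp
qed

lemma ker_diff: "ker (\<lambda>\<xi> \<eta>. M \<xi> \<eta> - M' \<xi> \<eta>) w \<xi> = ker M w \<xi> - ker M' w \<xi>"
  by (simp add: ker_def algebra_simps)

text \<open>Integrability over real frequencies is enough here, so u may be arbitrarily large and M
  may be a symbol of \<delta> with |z| > r, which need not be small on the tube.\<close>

lemma increment:
  assumes "\<And>w. integrable lborel (ker M w)"
  shows "integrable lborel (ker (\<lambda>\<xi> \<eta>. M \<xi> \<eta> * (exp (\<i> * cdot u \<xi> \<eta>) - 1)) w)"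
    "g (\<lambda>\<xi> \<eta>. M \<xi> \<eta> * (exp (\<i> * cdot u \<xi> \<eta>) - 1)) w = g M (w - u) - g M w"
proof -
  have "ker (\<lambda>\<xi> \<eta>. M \<xi> \<eta> * (exp (\<i> * cdot u \<xi> \<eta>) - 1)) w \<xi> = ker M (w - u) \<xi> - ker M w \<xi>" for \<xi>
    unfolding right_diff_distrib mult_1_right ker_diff ker_shift ..
  then have eq: "ker (\<lambda>\<xi> \<eta>. M \<xi> \<eta> * (exp (\<i> * cdot u \<xi> \<eta>) - 1)) w = (\<lambda>\<xi>. ker M (w - u) \<xi> - ker M w \<xi>)" by auto
  show "integrable lborel (ker (\<lambda>\<xi> \<eta>. M \<xi> \<eta> * (exp (\<i> * cdot u \<xi> \<eta>) - 1)) w)" unfolding eq using assms by auto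
  show "g (\<lambda>\<xi> \<eta>. M \<xi> \<eta> * (exp (\<i> * cdot u \<xi> \<eta>) - 1)) w = g M (w - u) - g M w"
    unfolding g_def eq using assms by auto
qed

text \<open>\<open>mP1\<close>, \<open>mP2\<close> and \<open>mP3\<close> are the symbols of
  \<delta> as an operator in x: a shift by z becomes an exponential, the gradient the linear term,
  and the symmetric difference a cosine.\<close>

definition mP1 :: "'a \<Rightarrow> 'a \<Rightarrow> 'a \<Rightarrow> complex" where
  "mP1 z \<xi> \<eta> = exp (\<i> * cdot z \<xi> \<eta>) - 1 - (if norm z < 1 then \<i> * cdot z \<xi> \<eta> else 0)"

definition mP2 :: "'a \<Rightarrow> 'a \<Rightarrow> 'a \<Rightarrow> complex" where
  "mP2 z \<xi> \<eta> = exp (\<i> * cdot z \<xi> \<eta>) - 1"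

definition mP3 :: "'a \<Rightarrow> 'a \<Rightarrow> 'a \<Rightarrow> complex" where
  "mP3 z \<xi> \<eta> = cos (cdot z \<xi> \<eta>) - 1"

text \<open>Beyond r the exponential has no uniform bound on the tube, so the two translates are
  estimated one by one. The translated term is later integrated in z by
  \<open>conv_const\<close>.\<close>

lemma large_increment:
  assumes Q: "multiplier r l B Q" and l: "l \<le> 1"
  shows "norm (g (\<lambda>\<xi> \<eta>. Q \<xi> \<eta> * (exp (\<i> * cdot z \<xi> \<eta>) - 1)) w) \<le> c0 * B * (rr r (w - z) + rr r w)"
proof -
  have "norm (g Q (w - z) - g Q w) \<le> c0 * B * rr r (w - z) + c0 * B * rr r w"
    using l by (intro order_trans[OF norm_triangle_ineq4] add_mono g_bound[OF Q]) auto
  then show ?thesis using l by (subst increment) (auto intro: ker_integrable[OF Q] simp: distrib_left)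
qed

section \<open>Integration in z in the three cases\<close>

lemma h_ball_compl1: "nuint (indicator (- ball 0 1)) \<le> ennreal (R\<^sup>2 * h r)"
  using h_ball_compl[of 1] h1_le[OF r] by (auto intro: order_trans ennreal_leI)

lemma nuint_square: "nuint (\<lambda>z. indicator (ball 0 r) z * (norm z)\<^sup>2) \<le> ennreal (r\<^sup>2 * h r)"
  unfolding nuint_K[OF r(1)] using K_le_h[OF r(1)] by (intro ennreal_leI mult_left_mono) auto

text \<open>A measurable majorant is recorded instead of the integral, because upper bounds for
  \<open>nn_integral\<close> only add up for measurable functions and measurability in \<open>z\<close> is not proved.\<close>

definition dominated :: "('a \<Rightarrow> 'a \<Rightarrow> 'a \<Rightarrow> complex) \<Rightarrow> 'a \<Rightarrow> real \<Rightarrow> bool" where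
  "dominated m w X \<longleftrightarrow> (\<exists>F \<in> borel_measurable borel. (\<forall>z. norm (g (m z) w) \<le> F z) \<and> nuint F \<le> ennreal X)"

lemma dominatedI:
  assumes ptw: "\<And>z. norm (g (m z) w) \<le> q * f z" and q: "0 \<le> q" and f: "nuint f \<le> ennreal X" "0 \<le> X"
    and [measurable]: "f \<in> borel_measurable borel"
  shows "dominated m w (q * X)"
  unfolding dominated_def
proof (intro bexI[of _ "\<lambda>z. q * f z"] conjI allI)
  show "norm (g (m z) w) \<le> q * f z" for z by (rule ptw)
  have "nuint (\<lambda>z. q * f z) = ennreal q * nuint f" using q by (intro nuint_cmult) auto
  also have "\<dots> \<le> ennreal q * ennreal X" by (intro mult_left_mono f) auto
  also have "\<dots> = ennreal (q * X)" using q f by (simp add: ennreal_mult)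
  finally show "nuint (\<lambda>z. q * f z) \<le> ennreal (q * X)" .
qed measurable

text \<open>Q is 1 for the first inequality and the exponential increment in x for the second, so
  one estimate serves both; this also explains the bound 1 on its degree. Jumps below r cost |z|/r,
  paid by the first moment.\<close>

lemma bound_P2:
  assumes M: "nuint (\<lambda>z. indicator (ball 0 r) z * norm z) \<le> ennreal (m * r * h r)" "0 \<le> m"
    and Q: "multiplier r l B Q" and l: "l \<le> 1"
  shows "dominated (\<lambda>z \<xi> \<eta>. Q \<xi> \<eta> * mP2 z \<xi> \<eta>) w (c0 * B * ((2 * exp 2 * m + conv_const + 1) * h r * rr r w))"
proof (rule dominatedI)
  have B: "0 \<le> B" using Q by (simp add: multiplier_def)
  let ?f1 = "\<lambda>z. indicator (ball 0 r) z * norm z" and ?f2 = "\<lambda>z. indicator (- ball 0 r) z * rr r (w - z)"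
  let ?F = "\<lambda>z. (2 * exp 2 * rr r w / r) * ?f1 z + 1 * (1 * ?f2 z + rr r w * indicator (- ball 0 r) z)"
  show "norm (g (\<lambda>\<xi> \<eta>. Q \<xi> \<eta> * mP2 z \<xi> \<eta>) w) \<le> (c0 * B) * ?F z" for z
  proof (cases "norm z < r")
    case True
    have "norm (g (\<lambda>\<xi> \<eta>. Q \<xi> \<eta> * mP2 z \<xi> \<eta>) w) \<le> c0 * (B * (2 * exp 2 * (norm z / r))) * rr r w"
      unfolding mP2_def using True r l by (intro g_bound[OF multiplier_mult[OF Q multiplier_exp1]]) auto
    then show ?thesis using True by (simp add: mult_ac)
  next
    case False
    then show ?thesis unfolding mP2_def using large_increment[OF Q l, of z w] by simp
  qed
  show "nuint ?F \<le> ennreal ((2 * exp 2 * m + conv_const + 1) * h r * rr r w)"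
  proof -
    have "nuint ?F \<le> ennreal ((2 * exp 2 * rr r w / r) * (m * r * h r) + 1 * (1 * (conv_const * h r * rr r w) + rr r w * h r))"
      using M r hr rrw[of w] less_imp_le[OF rrw] conv_const(1)
      by (intro nuint_lin conv_const(2) h_ball_compl) auto
    then show ?thesis using r by (simp add: algebra_simps)
  qed
  show "0 \<le> (2 * exp 2 * m + conv_const + 1) * h r * rr r w" using M hr rrw[of w] conv_const(1) by simp
  show "0 \<le> c0 * B" using B c0 by simp
qed measurable

text \<open>Below r the cosine vanishes to second order, and the second moment is always available.
  Beyond r it is the average of the increments at z and at -z, whence both convolutions.\<close>

lemma bound_P3:
  assumes Q: "multiplier r l B Q" and l: "l \<le> 1"
  shows "dominated (\<lambda>z \<xi> \<eta>. Q \<xi> \<eta> * mP3 z \<xi> \<eta>) w (c0 * B * ((4 * exp 2 + conv_const + 1) * h r * rr r w))"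
proof (rule dominatedI)
  have B: "0 \<le> B" using Q by (simp add: multiplier_def)
  let ?f1 = "\<lambda>z. indicator (ball 0 r) z * (norm z)\<^sup>2"
    and ?f2 = "\<lambda>z. indicator (- ball 0 r) z * rr r (w - z)" and ?f3 = "\<lambda>z. indicator (- ball 0 r) z * rr r (w + z)"
  let ?F = "\<lambda>z. (4 * exp 2 * rr r w / r\<^sup>2) * ?f1 z + 1 * (1 * (1/2 * ?f2 z + 1/2 * ?f3 z) + rr r w * indicator (- ball 0 r) z)"
  show "norm (g (\<lambda>\<xi> \<eta>. Q \<xi> \<eta> * mP3 z \<xi> \<eta>) w) \<le> (c0 * B) * ?F z" for z
  proof (cases "norm z < r")
    case True
    have "norm (g (\<lambda>\<xi> \<eta>. Q \<xi> \<eta> * mP3 z \<xi> \<eta>) w) \<le> c0 * (B * (4 * exp 2 * (norm z / r)\<^sup>2)) * rr r w"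
      unfolding mP3_def using True r l by (intro g_bound[OF multiplier_mult[OF Q multiplier_cos]]) auto
    then show ?thesis using True by (simp add: power_divide mult_ac)
  next
    case False
    have "cos (cdot z \<xi> \<eta>) - 1 = 1/2 * ((exp (\<i> * cdot z \<xi> \<eta>) - 1) + (exp (\<i> * cdot (- z) \<xi> \<eta>) - 1))" for \<xi> \<eta>
    proof -
      have "\<i> * cdot (- z) \<xi> \<eta> = - (\<i> * cdot z \<xi> \<eta>)" by (simp add: cdot_def complex_eq_iff)
      then show ?thesis by (simp add: cos_exp_eq field_simps)
    qed
    then have "ker (\<lambda>\<xi> \<eta>. Q \<xi> \<eta> * mP3 z \<xi> \<eta>) w = (\<lambda>\<xi>. 1/2 * (ker (\<lambda>\<xi> \<eta>. Q \<xi> \<eta> * (exp (\<i> * cdot z \<xi> \<eta>) - 1)) w \<xi> + ker (\<lambda>\<xi> \<eta>. Q \<xi> \<eta> * (exp (\<i> * cdot (- z) \<xi> \<eta>) - 1)) w \<xi>))"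
      by (auto simp: ker_def mP3_def algebra_simps)
    moreover have "integrable lborel (ker (\<lambda>\<xi> \<eta>. Q \<xi> \<eta> * (exp (\<i> * cdot z \<xi> \<eta>) - 1)) w)" for z
      using l by (intro increment ker_integrable[OF Q]) auto
    ultimately have "g (\<lambda>\<xi> \<eta>. Q \<xi> \<eta> * mP3 z \<xi> \<eta>) w = 1/2 * (g (\<lambda>\<xi> \<eta>. Q \<xi> \<eta> * (exp (\<i> * cdot z \<xi> \<eta>) - 1)) w + g (\<lambda>\<xi> \<eta>. Q \<xi> \<eta> * (exp (\<i> * cdot (- z) \<xi> \<eta>) - 1)) w)"
      by (simp add: g_def)
    also have "norm \<dots> \<le> 1/2 * (c0 * B * (rr r (w - z) + rr r w) + c0 * B * (rr r (w - - z) + rr r w))"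
      using large_increment[OF Q l, of z w] large_increment[OF Q l, of "- z" w]
      unfolding norm_mult by (intro mult_mono order_trans[OF norm_triangle_ineq] add_mono) auto
    finally show ?thesis using False by (simp add: algebra_simps)
  qed
  show "nuint ?F \<le> ennreal ((4 * exp 2 + conv_const + 1) * h r * rr r w)"
  proof -
    have "nuint ?F \<le> ennreal ((4 * exp 2 * rr r w / r\<^sup>2) * (r\<^sup>2 * h r) + 1 * (1 * (1/2 * (conv_const * h r * rr r w) + 1/2 * (conv_const * h r * rr r w)) + rr r w * h r))"
      using r hr rrw[of w] less_imp_le[OF rrw] conv_const(1)
      by (intro nuint_lin conv_const(2) conv_const_plus h_ball_compl nuint_square) auto
    then show ?thesis using r by (simp add: algebra_simps)
  qed
  show "0 \<le> (4 * exp 2 + conv_const + 1) * h r * rr r w" using hr rrw[of w] conv_const(1) by simp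
  show "0 \<le> c0 * B" using B c0 by simp
qed measurable

text \<open>Since |z| is compared both with r and with the compensator cutoff 1, there are four
  regions. Jumps below both radii use the second-order multiplier, those beyond both the plain
  increments; the two mixed regions produce the terms with R^2 and with m.\<close>

lemma bound_P1:
  assumes M: "nuint (\<lambda>z. indicator (ball 0 1 - ball 0 r) z * norm z) \<le> ennreal (m * r * h r)" "0 \<le> m"
    and Q: "multiplier r l B Q" and l: "l \<le> 1"
  shows "dominated (\<lambda>z \<xi> \<eta>. Q \<xi> \<eta> * mP1 z \<xi> \<eta>) w (c0 * B * ((4 * exp 2 + 2 * exp 2 * R\<^sup>2 + conv_const + 1 + 2 * m) * h r * rr r w))"
proof (rule dominatedI)
  have B: "0 \<le> B" using Q by (simp add: multiplier_def)
  have cB: "0 \<le> c0 * B" using B c0 by simp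
  let ?f1 = "\<lambda>z. indicator (ball 0 r) z * (norm z)\<^sup>2"
    and ?f2 = "\<lambda>z. indicator (- ball 0 r) z * rr r (w - z)"
    and ?f3 = "\<lambda>z. indicator (ball 0 1 - ball 0 r) z * norm z"
  let ?F = "\<lambda>z. 1 * ((4 * exp 2 * rr r w / r\<^sup>2) * ?f1 z + (2 * exp 2 * rr r w) * indicator (- ball 0 1) z)
    + 1 * (1 * (1 * ?f2 z + rr r w * indicator (- ball 0 r) z) + (2 * rr r w / r) * ?f3 z)"
  show "norm (g (\<lambda>\<xi> \<eta>. Q \<xi> \<eta> * mP1 z \<xi> \<eta>) w) \<le> (c0 * B) * ?F z" for z
  proof (cases "norm z < r")
    case zr: True
    show ?thesis
    proof (cases "norm z < 1")
      case True
      have "norm (g (\<lambda>\<xi> \<eta>. Q \<xi> \<eta> * mP1 z \<xi> \<eta>) w) \<le> c0 * (B * (4 * exp 2 * (norm z / r)\<^sup>2)) * rr r w"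
      proof -
        have mp: "mP1 z \<xi> \<eta> = exp (\<i> * cdot z \<xi> \<eta>) - 1 - \<i> * cdot z \<xi> \<eta>" for \<xi> \<eta> using True by (simp add: mP1_def)
        show ?thesis unfolding mp using zr r l by (intro g_bound[OF multiplier_mult[OF Q multiplier_exp2]]) auto
      qed
      then show ?thesis using True zr by (simp add: power_divide mult_ac)
    next
      case False
      \<comment> \<open>The region 1 \<le> |z| < r occurs only if r > 1. It has no compensator, and
        the mass beyond 1 is at most R^2 h(r).\<close>
      have "norm (g (\<lambda>\<xi> \<eta>. Q \<xi> \<eta> * mP1 z \<xi> \<eta>) w) \<le> c0 * (B * (2 * exp 2 * (norm z / r))) * rr r w"
      proof -
        have mp: "mP1 z \<xi> \<eta> = exp (\<i> * cdot z \<xi> \<eta>) - 1" for \<xi> \<eta> using False by (simp add: mP1_def)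
        show ?thesis unfolding mp using zr r l by (intro g_bound[OF multiplier_mult[OF Q multiplier_exp1]]) auto
      qed
      also have "\<dots> \<le> c0 * (B * (2 * exp 2 * 1)) * rr r w"
        using zr r c0 B rrw[of w] by (intro mult_left_mono mult_right_mono) auto
      also have "\<dots> \<le> (c0 * B) * ?F z"
      proof -
        have "0 \<le> (4 * exp 2 * rr r w / r\<^sup>2) * (norm z)\<^sup>2" using rrw[of w] by simp
        then have "2 * exp 2 * rr r w \<le> ?F z" using zr False by simp
        then have "c0 * B * (2 * exp 2 * rr r w) \<le> (c0 * B) * ?F z" by (rule mult_left_mono[OF _ cB])
        moreover have "c0 * (B * (2 * exp 2 * 1)) * rr r w = c0 * B * (2 * exp 2 * rr r w)" by simp
        ultimately show ?thesis by (simp only:)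
      qed
      finally show ?thesis .
    qed
  next
    case zr: False
    show ?thesis
    proof (cases "norm z < 1")
      case False
      have "norm (g (\<lambda>\<xi> \<eta>. Q \<xi> \<eta> * mP1 z \<xi> \<eta>) w) \<le> c0 * B * (rr r (w - z) + rr r w)"
        using large_increment[OF Q l, of z w] False by (simp add: mP1_def)
      also have "\<dots> \<le> (c0 * B) * ?F z"
        using zr False rrw[of w] by (intro mult_left_mono cB) auto
      finally show ?thesis .
    next
      case True
      \<comment> \<open>Between r and 1 nothing is gained from compensation: increment and gradient
        term are bounded apart, the latter by |z|/r and hence by the first moment of
        \<open>moment_large\<close>.\<close>
      have mp: "mP1 z \<xi> \<eta> = (exp (\<i> * cdot z \<xi> \<eta>) - 1) - \<i> * cdot z \<xi> \<eta>" for \<xi> \<eta> using True by (simp add: mP1_def)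
      have mL: "multiplier r (l + 1) (B * (2 * (norm z / r))) (\<lambda>\<xi> \<eta>. Q \<xi> \<eta> * (\<i> * cdot z \<xi> \<eta>))"
        by (rule multiplier_mult[OF Q multiplier_linear[OF r(1)]])
      have "g (\<lambda>\<xi> \<eta>. Q \<xi> \<eta> * mP1 z \<xi> \<eta>) w = g (\<lambda>\<xi> \<eta>. Q \<xi> \<eta> * (exp (\<i> * cdot z \<xi> \<eta>) - 1)) w - g (\<lambda>\<xi> \<eta>. Q \<xi> \<eta> * (\<i> * cdot z \<xi> \<eta>)) w"
      proof -
        have "integrable lborel (ker (\<lambda>\<xi> \<eta>. Q \<xi> \<eta> * (exp (\<i> * cdot z \<xi> \<eta>) - 1)) w)"
          using l by (intro increment ker_integrable[OF Q]) auto
        moreover have "integrable lborel (ker (\<lambda>\<xi> \<eta>. Q \<xi> \<eta> * (\<i> * cdot z \<xi> \<eta>)) w)"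
          using l by (intro ker_integrable[OF mL]) auto
        moreover have "ker (\<lambda>\<xi> \<eta>. Q \<xi> \<eta> * mP1 z \<xi> \<eta>) w = (\<lambda>\<xi>. ker (\<lambda>\<xi> \<eta>. Q \<xi> \<eta> * (exp (\<i> * cdot z \<xi> \<eta>) - 1)) w \<xi> - ker (\<lambda>\<xi> \<eta>. Q \<xi> \<eta> * (\<i> * cdot z \<xi> \<eta>)) w \<xi>)"
          unfolding mp right_diff_distrib[of "Q _ _" "_ - 1"] by (intro ext ker_diff)
        ultimately show ?thesis by (simp add: g_def)
      qed
      also have "norm \<dots> \<le> c0 * B * (rr r (w - z) + rr r w) + c0 * (B * (2 * (norm z / r))) * rr r w"
        using l by (intro order_trans[OF norm_triangle_ineq4] add_mono large_increment[OF Q l] g_bound[OF mL]) auto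
      also have "\<dots> = (c0 * B) * ?F z" using zr True by (simp add: algebra_simps)
      finally show ?thesis .
    qed
  qed
  show "nuint ?F \<le> ennreal ((4 * exp 2 + 2 * exp 2 * R\<^sup>2 + conv_const + 1 + 2 * m) * h r * rr r w)"
  proof -
    have "nuint ?F \<le> ennreal (1 * ((4 * exp 2 * rr r w / r\<^sup>2) * (r\<^sup>2 * h r) + (2 * exp 2 * rr r w) * (R\<^sup>2 * h r))
      + 1 * (1 * (1 * (conv_const * h r * rr r w) + rr r w * h r) + (2 * rr r w / r) * (m * r * h r)))"
      using r hr rrw[of w] less_imp_le[OF rrw] conv_const(1) M
      by (intro nuint_lin conv_const(2) h_ball_compl h_ball_compl1 nuint_square) auto
    then show ?thesis using r by (simp add: algebra_simps)
  qed
  show "0 \<le> (4 * exp 2 + 2 * exp 2 * R\<^sup>2 + conv_const + 1 + 2 * m) * h r * rr r w"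
    using hr rrw[of w] conv_const(1) M by simp
qed (use Q c0 in \<open>simp_all add: multiplier_def\<close>)

text \<open>For |x' - x| \<le> r the difference is \<delta> at x with one more multiplier, of size 2
  exp(2) |x' - x| / r. Otherwise the minimum is 1 and the triangle inequality suffices; there two
  majorants are added, which is where their measurability enters. The normalisation
  \<open>u\<close>, later (2 pi)^d, only lowers the values.\<close>

lemma delta_bounds:
  fixes dlt :: "'a \<Rightarrow> 'a \<Rightarrow> 'a \<Rightarrow> real"
  assumes dlt: "\<And>x y z. dlt x y z = Re (g (m z) (y - x)) / u" and u: "1 \<le> u"
    and mint: "\<And>z w. integrable lborel (ker (m z) w)"
    and bnd: "\<And>Q l B w. multiplier r l B Q \<Longrightarrow> l \<le> 1 \<Longrightarrow>
      dominated (\<lambda>z \<xi> \<eta>. Q \<xi> \<eta> * m z \<xi> \<eta>) w (c0 * B * (c * h r * rr r w))"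
    and c: "0 \<le> c"
  shows "(\<integral>\<^sup>+ z. ennreal \<bar>dlt x y z\<bar> * \<nu> (norm z) \<partial>lborel) \<le> ennreal (2 * exp 2 * c0 * c * h r * rr r (y - x))"
    "(\<integral>\<^sup>+ z. ennreal \<bar>dlt x' y z - dlt x y z\<bar> * \<nu> (norm z) \<partial>lborel)
      \<le> ennreal (2 * exp 2 * c0 * c * min (norm (x' - x) / r) 1 * h r * (rr r (y - x') + rr r (y - x)))"
proof -
  note un = abs_Re_divide_le[OF u]
  have e2: "1 \<le> 2 * exp (2::real)" using exp_ge_add_one_self[of 2] by linarith
  have nn: "0 \<le> c0 * c * h r * rr r w" for w using c0 c hr rrw[of w] by simp
  have le_nuint: "(\<integral>\<^sup>+ z. ennreal (f z) * \<nu> (norm z) \<partial>lborel) \<le> nuint F" if "\<And>z. f z \<le> F z" for f F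
    unfolding nuint_def using that by (intro nn_integral_mono mult_right_mono ennreal_leI) auto
  have dom: "\<exists>F \<in> borel_measurable borel. (\<forall>z. \<bar>dlt x y z\<bar> \<le> F z) \<and> nuint F \<le> ennreal (c0 * c * h r * rr r (y - x))" for x
  proof -
    have "dominated (\<lambda>z \<xi> \<eta>. 1 * m z \<xi> \<eta>) (y - x) (c0 * 1 * (c * h r * rr r (y - x)))" by (intro bnd[OF multiplier_one]) auto
    then obtain F where "F \<in> borel_measurable borel" "\<And>z. norm (g (m z) (y - x)) \<le> F z" "nuint F \<le> ennreal (c0 * c * h r * rr r (y - x))"
      by (auto simp: dominated_def mult_ac)
    moreover from this(2) have "\<bar>dlt x y z\<bar> \<le> F z" for z unfolding dlt by (rule order_trans[OF un])
    ultimately show ?thesis by blast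
  qed
  have one: "(\<integral>\<^sup>+ z. ennreal \<bar>dlt x y z\<bar> * \<nu> (norm z) \<partial>lborel) \<le> ennreal (c0 * c * h r * rr r (y - x))" for x
  proof -
    obtain F where F: "\<And>z. \<bar>dlt x y z\<bar> \<le> F z" "nuint F \<le> ennreal (c0 * c * h r * rr r (y - x))"
      using dom[of x] by blast
    show ?thesis by (rule order_trans[OF le_nuint[OF F(1)] F(2)])
  qed
  have up: "c0 * c * h r * rr r w \<le> 2 * exp 2 * c0 * c * h r * rr r w" for w
    using mult_right_mono[OF e2 nn[of w]] by (simp add: mult_ac)
  show "(\<integral>\<^sup>+ z. ennreal \<bar>dlt x y z\<bar> * \<nu> (norm z) \<partial>lborel) \<le> ennreal (2 * exp 2 * c0 * c * h r * rr r (y - x))"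
    using one[of x] ennreal_leI[OF up] by (rule order_trans)
  show "(\<integral>\<^sup>+ z. ennreal \<bar>dlt x' y z - dlt x y z\<bar> * \<nu> (norm z) \<partial>lborel)
      \<le> ennreal (2 * exp 2 * c0 * c * min (norm (x' - x) / r) 1 * h r * (rr r (y - x') + rr r (y - x)))"
  proof (cases "norm (x' - x) \<le> r")
    case True
    have mn: "min (norm (x' - x) / r) 1 = norm (x' - x) / r" using True r by simp
    have d1: "\<bar>dlt x' y z - dlt x y z\<bar> \<le> norm (g (\<lambda>\<xi> \<eta>. (exp (\<i> * cdot (x' - x) \<xi> \<eta>) - 1) * m z \<xi> \<eta>) (y - x))" for z
    proof -
      have "dlt x' y z - dlt x y z = Re (g (m z) (y - x - (x' - x)) - g (m z) (y - x)) / u"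
        by (simp add: dlt diff_divide_distrib)
      also have "g (m z) (y - x - (x' - x)) - g (m z) (y - x) = g (\<lambda>\<xi> \<eta>. (exp (\<i> * cdot (x' - x) \<xi> \<eta>) - 1) * m z \<xi> \<eta>) (y - x)"
        by (subst increment(2)[OF mint, symmetric]) (simp add: mult.commute)
      finally show ?thesis using un by simp
    qed
    have "dominated (\<lambda>z \<xi> \<eta>. (exp (\<i> * cdot (x' - x) \<xi> \<eta>) - 1) * m z \<xi> \<eta>) (y - x) (c0 * (2 * exp 2 * (norm (x' - x) / r)) * (c * h r * rr r (y - x)))"
      by (intro bnd[OF multiplier_exp1[OF r(1) True]]) auto
    then obtain F where F: "\<And>z. norm (g (\<lambda>\<xi> \<eta>. (exp (\<i> * cdot (x' - x) \<xi> \<eta>) - 1) * m z \<xi> \<eta>) (y - x)) \<le> F z"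
        "nuint F \<le> ennreal (c0 * (2 * exp 2 * (norm (x' - x) / r)) * (c * h r * rr r (y - x)))"
      unfolding dominated_def by blast
    have "(\<integral>\<^sup>+ z. ennreal \<bar>dlt x' y z - dlt x y z\<bar> * \<nu> (norm z) \<partial>lborel) \<le> ennreal (c0 * (2 * exp 2 * (norm (x' - x) / r)) * (c * h r * rr r (y - x)))"
      by (rule order_trans[OF le_nuint[OF order_trans[OF d1 F(1)]] F(2)])
    also have "\<dots> \<le> ennreal (2 * exp 2 * c0 * c * min (norm (x' - x) / r) 1 * h r * (rr r (y - x') + rr r (y - x)))"
    proof (rule ennreal_leI)
      have "2 * exp 2 * c0 * c * (norm (x' - x) / r) * h r * rr r (y - x) \<le> 2 * exp 2 * c0 * c * (norm (x' - x) / r) * h r * (rr r (y - x') + rr r (y - x))"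
        using c0 c r hr rrw[of "y - x'"] by (intro mult_left_mono) auto
      then show "c0 * (2 * exp 2 * (norm (x' - x) / r)) * (c * h r * rr r (y - x)) \<le> 2 * exp 2 * c0 * c * min (norm (x' - x) / r) 1 * h r * (rr r (y - x') + rr r (y - x))"
        unfolding mn by (simp only: mult_ac)
    qed
    finally show ?thesis .
  next
    case False
    have mn: "min (norm (x' - x) / r) 1 = 1" using False r by (simp add: min_def field_simps)
    obtain F where [measurable]: "F \<in> borel_measurable borel" and F: "\<And>z. \<bar>dlt x y z\<bar> \<le> F z" "nuint F \<le> ennreal (c0 * c * h r * rr r (y - x))"
      using dom[of x] by blast
    obtain F' where [measurable]: "F' \<in> borel_measurable borel" and F': "\<And>z. \<bar>dlt x' y z\<bar> \<le> F' z" "nuint F' \<le> ennreal (c0 * c * h r * rr r (y - x'))"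
      using dom[of x'] by blast
    have "(\<integral>\<^sup>+ z. ennreal \<bar>dlt x' y z - dlt x y z\<bar> * \<nu> (norm z) \<partial>lborel) \<le> nuint (\<lambda>z. 1 * F' z + 1 * F z)"
    proof (rule le_nuint)
      show "\<bar>dlt x' y z - dlt x y z\<bar> \<le> 1 * F' z + 1 * F z" for z using F(1)[of z] F'(1)[of z] by linarith
    qed
    also have "\<dots> \<le> ennreal (1 * (c0 * c * h r * rr r (y - x')) + 1 * (c0 * c * h r * rr r (y - x)))"
      using order_trans[OF abs_ge_zero F(1)] order_trans[OF abs_ge_zero F'(1)] nn
      by (intro nuint_lin F(2) F'(2)) auto
    also have "\<dots> \<le> ennreal (2 * exp 2 * c0 * c * min (norm (x' - x) / r) 1 * h r * (rr r (y - x') + rr r (y - x)))"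
      unfolding mn using up[of "y - x'"] up[of "y - x"] by (intro ennreal_leI) (simp add: distrib_left)
    finally show ?thesis .
  qed
qed


section \<open>From Fourier integrals to \<open>heat\<close> and \<open>delta\<close>\<close>

lemma dominated_mono: "dominated m w X \<Longrightarrow> X \<le> Y \<Longrightarrow> dominated m w Y"
  unfolding dominated_def by (meson ennreal_leI order_trans)

lemma ker_one_integrable: "integrable lborel (ker (\<lambda>\<xi> \<eta>. 1) w)"
  by (rule ker_integrable[OF multiplier_one]) simp

lemma ker_linear_integrable: "integrable lborel (ker (\<lambda>\<xi> \<eta>. \<i> * cdot z \<xi> \<eta>) w)"
  by (rule ker_integrable[OF multiplier_linear[OF r(1)]]) simp

lemma g_mP2: "g (mP2 z) w = g (\<lambda>\<xi> \<eta>. 1) (w - z) - g (\<lambda>\<xi> \<eta>. 1) w" "integrable lborel (ker (mP2 z) w)"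
  using increment[OF ker_one_integrable, of z w] by (simp_all add: mP2_def[abs_def])

lemma g_mP1:
  "g (mP1 z) w = g (\<lambda>\<xi> \<eta>. 1) (w - z) - g (\<lambda>\<xi> \<eta>. 1) w - (if norm z < 1 then g (\<lambda>\<xi> \<eta>. \<i> * cdot z \<xi> \<eta>) w else 0)"
  "integrable lborel (ker (mP1 z) w)"
proof -
  have e: "ker (mP1 z) w = (\<lambda>\<xi>. ker (mP2 z) w \<xi> - (if norm z < 1 then ker (\<lambda>\<xi> \<eta>. \<i> * cdot z \<xi> \<eta>) w \<xi> else 0))"
    by (auto simp: ker_def mP1_def mP2_def algebra_simps)
  show "integrable lborel (ker (mP1 z) w)"
    unfolding e using g_mP2(2)[of z w] ker_linear_integrable[of z w] by (cases "norm z < 1") auto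
  have "g (mP1 z) w = g (mP2 z) w - (if norm z < 1 then g (\<lambda>\<xi> \<eta>. \<i> * cdot z \<xi> \<eta>) w else 0)"
    unfolding g_def e using g_mP2(2)[of z w] ker_linear_integrable[of z w] by (cases "norm z < 1") auto
  then show "g (mP1 z) w = g (\<lambda>\<xi> \<eta>. 1) (w - z) - g (\<lambda>\<xi> \<eta>. 1) w - (if norm z < 1 then g (\<lambda>\<xi> \<eta>. \<i> * cdot z \<xi> \<eta>) w else 0)"
    unfolding g_mP2(1) .
qed

lemma g_mP3:
  "g (mP3 z) w = (g (\<lambda>\<xi> \<eta>. 1) (w - z) + g (\<lambda>\<xi> \<eta>. 1) (w + z) - 2 * g (\<lambda>\<xi> \<eta>. 1) w) / 2"
  "integrable lborel (ker (mP3 z) w)"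
proof -
  let ?o = "\<lambda>\<xi> \<eta>. 1 :: complex"
  have e: "ker (mP3 z) w = (\<lambda>\<xi>. (ker ?o (w - z) \<xi> + ker ?o (w + z) \<xi> - 2 * ker ?o w \<xi>) / 2)"
    unfolding ker_shift[of ?o, symmetric] ker_shift_neg[of ?o, symmetric]
    by (auto simp: ker_def mP3_def cos_exp_eq field_simps)
  show "integrable lborel (ker (mP3 z) w)" unfolding e using ker_one_integrable by auto
  show "g (mP3 z) w = (g ?o (w - z) + g ?o (w + z) - 2 * g ?o w) / 2"
    unfolding g_def e using ker_one_integrable by simp
qed

lemma heat_eq:
  assumes psi: "\<And>\<xi>. psi P J Kf \<xi> = \<psi> \<xi>"
  shows "heat P J Kf (1 / h r) x y = Re (g (\<lambda>\<xi> \<eta>. 1) (y - x)) / (2 * pi) ^ DIM('a)"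
  unfolding heat_def psi g_def ker_def Re_divide_of_real mult_1 ..

text \<open>The integral with the linear multiplier is a bounded linear function of z. The remainder
  of the first-order expansion has the multiplier of \<open>multiplier_exp2\<close> as its symbol
  and is therefore O(|v|^2 / r^2), which identifies the derivative.\<close>

lemma heat_derivative:
  assumes psi: "\<And>\<xi>. psi P J Kf \<xi> = \<psi> \<xi>"
  shows "frechet_derivative (\<lambda>w. heat P J Kf (1 / h r) w y) (at x) z = Re (g (\<lambda>\<xi> \<eta>. \<i> * cdot z \<xi> \<eta>) (y - x)) / (2 * pi) ^ DIM('a)"
proof -
  define u where "u = (2 * pi) ^ DIM('a)"
  have u: "1 \<le> u" unfolding u_def by (rule two_pi_power_ge_1)
  note un = abs_Re_divide_le[OF u]
  define gl where "gl = (\<lambda>z. g (\<lambda>\<xi> \<eta>. \<i> * cdot z \<xi> \<eta>) (y - x))"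
  have gl_add: "gl (v + v') = gl v + gl v'" for v v'
  proof -
    have "ker (\<lambda>\<xi> \<eta>. \<i> * cdot (v + v') \<xi> \<eta>) (y - x) = (\<lambda>\<xi>. ker (\<lambda>\<xi> \<eta>. \<i> * cdot v \<xi> \<eta>) (y - x) \<xi> + ker (\<lambda>\<xi> \<eta>. \<i> * cdot v' \<xi> \<eta>) (y - x) \<xi>)"
      by (auto simp: ker_def cdot_0 inner_add_left algebra_simps)
    then show ?thesis using ker_linear_integrable by (simp add: gl_def g_def)
  qed
  have gl_scale: "gl (s *\<^sub>R v) = complex_of_real s * gl v" for s v
  proof -
    have "ker (\<lambda>\<xi> \<eta>. \<i> * cdot (s *\<^sub>R v) \<xi> \<eta>) (y - x) = (\<lambda>\<xi>. complex_of_real s * ker (\<lambda>\<xi> \<eta>. \<i> * cdot v \<xi> \<eta>) (y - x) \<xi>)"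
      by (auto simp: ker_def cdot_0 algebra_simps)
    then show ?thesis by (simp add: gl_def g_def)
  qed
  have gl_le: "norm (gl v) \<le> norm v * (2 * c0 * rr r (y - x) / r)" for v
    using g_bound[OF multiplier_linear[OF r(1)], of v "y - x"] by (simp add: gl_def mult_ac)
  have "((\<lambda>w. heat P J Kf (1 / h r) w y) has_derivative (\<lambda>v. Re (gl v) / u)) (at x)"
  proof (rule has_derivative_quadratic[OF _ r(1), where C = "4 * exp 2 * c0 * rr r (y - x) / r\<^sup>2"])
    show "bounded_linear (\<lambda>v. Re (gl v) / u)"
    proof (rule bounded_linear_intro[where K = "2 * c0 * rr r (y - x) / r"])
      show "norm (Re (gl v) / u) \<le> norm v * (2 * c0 * rr r (y - x) / r)" for v
        using un[of "gl v"] gl_le[of v] by simp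
    qed (auto simp: gl_add gl_scale add_divide_distrib)
    fix v :: 'a assume v: "norm v \<le> r"
    let ?m = "\<lambda>\<xi> \<eta>. exp (\<i> * cdot v \<xi> \<eta>) - 1 - \<i> * cdot v \<xi> \<eta>"
    have "g ?m (y - x) = g (mP2 v) (y - x) - gl v"
    proof -
      have "ker ?m (y - x) = (\<lambda>\<xi>. ker (mP2 v) (y - x) \<xi> - ker (\<lambda>\<xi> \<eta>. \<i> * cdot v \<xi> \<eta>) (y - x) \<xi>)"
        by (auto simp: ker_def mP2_def algebra_simps)
      then show ?thesis using g_mP2(2) ker_linear_integrable by (simp add: gl_def g_def)
    qed
    then have "heat P J Kf (1 / h r) (x + v) y - heat P J Kf (1 / h r) x y - Re (gl v) / u = Re (g ?m (y - x)) / u"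
      unfolding heat_eq[OF psi] g_mP2 u_def[symmetric] by (simp add: diff_divide_distrib add_divide_distrib diff_diff_eq)
    then have "norm (heat P J Kf (1 / h r) (x + v) y - heat P J Kf (1 / h r) x y - Re (gl v) / u) \<le> norm (g ?m (y - x))"
      using un by simp
    also have "\<dots> \<le> c0 * (4 * exp 2 * (norm v / r)\<^sup>2) * rr r (y - x)"
      by (intro g_bound[OF multiplier_exp2[OF r(1) v]]) simp
    also have "\<dots> = 4 * exp 2 * c0 * rr r (y - x) / r\<^sup>2 * (norm v)\<^sup>2" by (simp add: power_divide mult_ac)
    finally show "norm (heat P J Kf (1 / h r) (x + v) y - heat P J Kf (1 / h r) x y - Re (gl v) / u) \<le> 4 * exp 2 * c0 * rr r (y - x) / r\<^sup>2 * (norm v)\<^sup>2" .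
  qed
  then have "frechet_derivative (\<lambda>w. heat P J Kf (1 / h r) w y) (at x) = (\<lambda>v. Re (gl v) / u)"
    by (rule frechet_derivative_at[symmetric])
  then show ?thesis by (simp add: gl_def u_def)
qed

text \<open>The value of c exceeds the constants of \<open>bound_P1\<close>, \<open>bound_P2\<close>
  and \<open>bound_P3\<close>, so that it need not depend on the case.\<close>

theorem heat_kernel_bounds:
  assumes psi: "\<And>\<xi>. psi P J Kf \<xi> = \<psi> \<xi>" and m: "0 \<le> m"
    and P1: "P = P1 \<Longrightarrow> nuint (\<lambda>z. indicator (ball 0 1 - ball 0 r) z * norm z) \<le> ennreal (m * r * h r)"
    and P2: "P = P2 \<Longrightarrow> nuint (\<lambda>z. indicator (ball 0 r) z * norm z) \<le> ennreal (m * r * h r)"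
    and c: "c = 4 * exp 2 + 2 * exp 2 * R\<^sup>2 + conv_const + 1 + 2 * exp 2 * m"
  shows "(\<integral>\<^sup>+ z. ennreal \<bar>delta P J Kf (1 / h r) x y z\<bar> * \<nu> (norm z) \<partial>lborel) \<le> ennreal (2 * exp 2 * c0 * c * h r * rr r (y - x)) \<and>
    (\<integral>\<^sup>+ z. ennreal \<bar>delta P J Kf (1 / h r) x' y z - delta P J Kf (1 / h r) x y z\<bar> * \<nu> (norm z) \<partial>lborel)
      \<le> ennreal (2 * exp 2 * c0 * c * min (norm (x' - x) / r) 1 * h r * (rr r (y - x') + rr r (y - x)))"
proof -
  define mP where "mP = (case P of P1 \<Rightarrow> mP1 | P2 \<Rightarrow> mP2 | P3 \<Rightarrow> mP3)"
  have c0': "0 \<le> c" using m conv_const(1) unfolding c by (intro add_nonneg_nonneg) auto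
  have e: "1 \<le> exp (2::real)" by simp
  have dlt: "delta P J Kf (1 / h r) x y z = Re (g (mP z) (y - x)) / (2 * pi) ^ DIM('a)" for x y z
  proof -
    note heat = heat_eq[OF psi] and der = heat_derivative[OF psi]
    have e: "y - (x + z) = y - x - z" "y - (x - z) = y - x + z" by (simp_all add: algebra_simps)
    show ?thesis unfolding delta_def unfolding der unfolding heat e
      by (cases P) (simp_all add: mP_def g_mP1 g_mP2 g_mP3 diff_divide_distrib add_divide_distrib)
  qed
  have mint: "integrable lborel (ker (mP z) w)" for z w
    using g_mP1(2) g_mP2(2) g_mP3(2) by (cases P) (auto simp: mP_def)
  have bnd: "dominated (\<lambda>z \<xi> \<eta>. Q \<xi> \<eta> * mP z \<xi> \<eta>) w (c0 * B * (c * h r * rr r w))"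
    if Q: "multiplier r l B Q" and l: "l \<le> 1" for Q l B w
  proof -
    have B: "0 \<le> B" using Q by (simp add: multiplier_def)
    have mono: "c0 * B * (c' * h r * rr r w) \<le> c0 * B * (c * h r * rr r w)" if "c' \<le> c" for c'
      using that B c0 hr rrw[of w] by (intro mult_left_mono mult_right_mono) auto
    have m2: "2 * m \<le> 2 * exp 2 * m" using mult_right_mono[OF e m] by simp
    have R2: "0 \<le> 2 * exp 2 * R\<^sup>2" by simp
    show ?thesis
    proof (cases P)
      case P1
      show ?thesis using bound_P1[OF assms(3)[OF P1] m Q l, of w]
        unfolding mP_def P1 pcase.case by (rule dominated_mono[OF _ mono]) (use m2 in \<open>simp add: c\<close>)
    next
      case P2
      show ?thesis using bound_P2[OF assms(4)[OF P2] m Q l, of w]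
        unfolding mP_def P2 pcase.case by (rule dominated_mono[OF _ mono]) (use R2 in \<open>simp add: c\<close>)
    next
      case P3
      show ?thesis using bound_P3[OF Q l, of w]
        unfolding mP_def P3 pcase.case by (rule dominated_mono[OF _ mono]) (use m R2 in \<open>simp add: c\<close>)
    qed
  qed
  show ?thesis
  proof
    show "(\<integral>\<^sup>+ z. ennreal \<bar>delta P J Kf (1 / h r) x y z\<bar> * \<nu> (norm z) \<partial>lborel) \<le> ennreal (2 * exp 2 * c0 * c * h r * rr r (y - x))"
      by (rule delta_bounds(1)[of "delta P J Kf (1 / h r)" mP, OF dlt two_pi_power_ge_1 mint bnd c0'])
    show "(\<integral>\<^sup>+ z. ennreal \<bar>delta P J Kf (1 / h r) x' y z - delta P J Kf (1 / h r) x y z\<bar> * \<nu> (norm z) \<partial>lborel)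
      \<le> ennreal (2 * exp 2 * c0 * c * min (norm (x' - x) / r) 1 * h r * (rr r (y - x') + rr r (y - x)))"
      by (rule delta_bounds(2)[of "delta P J Kf (1 / h r)" mP, OF dlt two_pi_power_ge_1 mint bnd c0'])
  qed
qed

end

section \<open>The symbols of the three cases and the conclusion\<close>

lemma (in levy_kernel) levy_core_tpsi:
  assumes "\<And>\<xi>. \<psi> \<xi> = - (base \<xi> + \<i> * complex_of_real (b \<bullet> \<xi>))"
  shows "levy_core \<nu> ty R \<alpha> C r core_const \<psi>"
proof -
  have e: "- complex_of_real (1 / h r) * \<psi> \<xi> = tpsi \<xi>" for \<xi>
    unfolding tpsi_base assms using hr by (simp add: field_simps)
  show ?thesis
  proof unfold_locales
    fix M :: "'a \<Rightarrow> 'a \<Rightarrow> complex" and k B w assume M: "multiplier r k B M" "k \<le> 3"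
    show "integrable lborel (\<lambda>\<xi>. cis (- (w \<bullet> \<xi>)) * (M \<xi> 0 * exp (- complex_of_real (1 / h r) * \<psi> \<xi>)))"
      unfolding e by (rule kernel_integrable[OF M])
    show "norm (LBINT \<xi>. cis (- (w \<bullet> \<xi>)) * (M \<xi> 0 * exp (- complex_of_real (1 / h r) * \<psi> \<xi>))) \<le> core_const * B * rr r w"
      unfolding e by (rule kernel_bound[OF M])
  qed (rule r core_const)+
qed

text \<open>In D the term m pays for the first moment between r and 1 in P1, or below r in P2, and
  R^2 for the jumps between 1 and r when r > 1. In P3 symmetry makes the drift zero.\<close>

lemma (in levy_bounds) levy_core_psi:
  fixes J :: "'a \<Rightarrow> ennreal" and Kf :: "'a \<Rightarrow> real"
  assumes r: "0 < r" "r \<le> R" and m: "0 \<le> m" and Deq: "D = A * (m + R\<^sup>2)"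
    and P1: "P = P1 \<Longrightarrow> nuint (\<lambda>z. indicator (ball 0 1 - ball 0 r) z * norm z) \<le> ennreal (m * r * h r)"
    and P2: "P = P2 \<Longrightarrow> nuint (\<lambda>z. indicator (ball 0 r) z * norm z) \<le> ennreal (m * r * h r)"
    and P3: "P = P3 \<Longrightarrow> \<forall>z. J (- z) = J z \<and> Kf (- z) = Kf z"
    and meas [measurable]: "J \<in> borel_measurable borel" "Kf \<in> borel_measurable borel"
    and K0: "\<And>z. 0 \<le> Kf z"
    and up: "\<And>z. z \<noteq> 0 \<Longrightarrow> ennreal (Kf z * enn2real (J z)) \<le> ennreal A * \<nu> (norm z)"
    and low: "\<And>z. z \<noteq> 0 \<Longrightarrow> ennreal a * \<nu> (norm z) \<le> ennreal (Kf z * enn2real (J z))"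
  shows "levy_core \<nu> ty R \<alpha> C r core_const (psi P J Kf)"
proof -
  define N where "N = (\<lambda>z. Kf z * enn2real (J z))"
  have [measurable]: "N \<in> borel_measurable borel" unfolding N_def by measurable
  have lk: "levy_kernel \<nu> ty R \<alpha> C a A D r N b" if "norm b \<le> D * r * h r" for b
    by unfold_locales (use r K0 up low that in \<open>auto simp: N_def\<close>)
  have hr: "0 < h r" using h_pos r by blast
  \<comment> \<open>The exponent \<open>base\<close> does not involve the drift. It is obtained with
    drift 0, and the drift computed from it enters a second interpretation with the same
    \<open>base\<close>.\<close>
  interpret K0: levy_kernel \<nu> ty R \<alpha> C a A D r N 0 by (rule lk) (use D r hr in simp)
  show ?thesis
  proof (cases P)
    case P1
    \<comment> \<open>Subtracting this from the cutoff at r gives the cutoff at 1, whichever radius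
      is larger.\<close>
    let ?c = "\<lambda>z. indicator (ball 0 r) z - indicator (ball 0 1) z :: real"
    have "nuint (\<lambda>z. \<bar>?c z\<bar> * norm z) \<le> nuint (\<lambda>z. 1 * (indicator (ball 0 1 - ball 0 r) z * norm z) + r * indicator (- ball 0 1) z)"
      using r by (intro nuint_mono) (auto simp: indicator_def)
    also have "\<dots> \<le> ennreal (1 * (m * r * h r) + r * (R\<^sup>2 * h r))"
    proof (intro nuint_lin assms(5)[OF P1])
      show "nuint (indicator (- ball 0 1)) \<le> ennreal (R\<^sup>2 * h r)"
        using h_ball_compl[of 1] h1_le[OF r] by (auto intro: order_trans ennreal_leI)
    qed (use r m hr in auto)
    also have "1 * (m * r * h r) + r * (R\<^sup>2 * h r) = (m + R\<^sup>2) * r * h r" by (simp add: algebra_simps)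
    finally obtain b' where b': "norm b' \<le> A * ((m + R\<^sup>2) * r * h r)"
      "\<And>\<xi>. K0.base \<xi> + \<i> * complex_of_real (b' \<bullet> \<xi>) =
        (LBINT z. (cis (\<xi> \<bullet> z) - 1 - \<i> * complex_of_real (\<xi> \<bullet> z * (indicator (ball 0 r) z - ?c z))) * complex_of_real (N z))"
      using m r hr by (elim K0.drift[rotated]) auto
    interpret K1: levy_kernel \<nu> ty R \<alpha> C a A D r N b' by (rule lk) (use b'(1) in \<open>simp add: Deq mult_ac\<close>)
    show ?thesis
    proof (rule K1.levy_core_tpsi)
      show "psi P J Kf \<xi> = - (K0.base \<xi> + \<i> * complex_of_real (b' \<bullet> \<xi>))" for \<xi>
        unfolding b'(2) unfolding P1 psi_def pcase.case N_def
        by (intro arg_cong[where f = uminus] Bochner_Integration.integral_cong refl) (auto simp: indicator_def)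
    qed
  next
    case P2
    \<comment> \<open>Taking the whole indicator of the ball as correction removes the
      compensator.\<close>
    have I: "nuint (\<lambda>z. \<bar>indicator (ball 0 r) z\<bar> * norm z) \<le> ennreal (m * r * h r)" using assms(6)[OF P2] by simp
    obtain b' where b': "norm b' \<le> A * (m * r * h r)"
      "\<And>\<xi>. K0.base \<xi> + \<i> * complex_of_real (b' \<bullet> \<xi>) =
        (LBINT z. (cis (\<xi> \<bullet> z) - 1 - \<i> * complex_of_real (\<xi> \<bullet> z * (indicator (ball 0 r) z - indicator (ball 0 r) z))) * complex_of_real (N z))"
      using K0.drift[OF _ I] m r hr by auto
    have "A * (m * r * h r) \<le> D * r * h r" using A r hr unfolding Deq by (simp add: algebra_simps)
    then interpret K1: levy_kernel \<nu> ty R \<alpha> C a A D r N b' using b'(1) by (intro lk) simp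
    show ?thesis
    proof (rule K1.levy_core_tpsi)
      show "psi P J Kf \<xi> = - (K0.base \<xi> + \<i> * complex_of_real (b' \<bullet> \<xi>))" for \<xi>
        unfolding b'(2) unfolding P2 psi_def pcase.case N_def by simp
    qed
  next
    case P3
    show ?thesis
    proof (rule K0.levy_core_tpsi)
      have "N (- z) = N z" for z using assms(7)[OF P3] by (simp add: N_def)
      then show "psi P J Kf \<xi> = - (K0.base \<xi> + \<i> * complex_of_real (0 \<bullet> \<xi>))" for \<xi>
        using K0.base_symmetric unfolding P3 psi_def pcase.case by (simp add: N_def mult.assoc)
    qed
  qed
qed

theorem theorem2p9:
  fixes \<nu> :: "real \<Rightarrow> ennreal" and \<Lambda> \<kappa>0 \<kappa>1 \<alpha>h Ch \<beta>h ch T :: real and P :: pcase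
  assumes nu: "levy_profile \<nu> TYPE('a::euclidean_space)"
    and Lam: "1 \<le> \<Lambda>" and kap: "0 < \<kappa>0" "\<kappa>0 \<le> \<kappa>1"
    and wlsc: "WLSC \<nu> TYPE('a) \<alpha>h Ch"
    and P1: "P = P1 \<Longrightarrow> 1 < \<alpha>h"
    and P2: "P = P2 \<Longrightarrow> WUSC \<nu> TYPE('a) \<beta>h ch \<and> \<alpha>h \<le> \<beta>h \<and> \<beta>h < 1"
    and T: "0 < T"
  shows "\<exists>c>0. \<forall>(J :: 'a \<Rightarrow> ennreal) (K :: 'a \<Rightarrow> real).
     J \<in> borel_measurable borel \<longrightarrow>
     (\<forall>x. ennreal (1 / \<Lambda>) * \<nu> (norm x) \<le> J x \<and> J x \<le> ennreal \<Lambda> * \<nu> (norm x)) \<longrightarrow>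
     K \<in> borel_measurable borel \<longrightarrow>
     (\<forall>z. \<kappa>0 \<le> K z \<and> K z \<le> \<kappa>1) \<longrightarrow>
     (P = P3 \<longrightarrow> (\<forall>z. J (- z) = J z \<and> K (- z) = K z)) \<longrightarrow>
     (\<forall>t x x' y. 0 < t \<longrightarrow> t \<le> T \<longrightarrow>
        (\<integral>\<^sup>+ z. ennreal \<bar>delta P J K t x y z\<bar> * \<nu> (norm z) \<partial>lborel)
           \<le> ennreal (c * (1 / t) * rho \<nu> t (y - x))
      \<and> (\<integral>\<^sup>+ z. ennreal \<bar>delta P J K t x' y z - delta P J K t x y z\<bar> * \<nu> (norm z) \<partial>lborel)
           \<le> ennreal (c * min (norm (x' - x) / hinv \<nu> TYPE('a) (1 / t)) 1 * (1 / t)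
                        * (rho \<nu> t (y - x') + rho \<nu> t (y - x))))"
proof (cases "\<exists>s>0. 0 < \<nu> s")
  case False
  \<comment> \<open>The profile vanishes off the origin, a null set, so both left-hand sides are 0
    and any constant will do.\<close>
  have z: "(\<integral>\<^sup>+ z. f z * \<nu> (norm (z::'a)) \<partial>lborel) = 0" for f
  proof -
    have "AE x::'a in lborel. x \<noteq> 0" by (rule AE_lborel_singleton)
    then have "AE x::'a in lborel. f x * \<nu> (norm x) = 0"
    proof eventually_elim
      case (elim x)
      then have "\<nu> (norm x) = 0" using False by (metis not_gr_zero zero_less_norm_iff)
      then show ?case by simp
    qed
    then have "(\<integral>\<^sup>+ z. f z * \<nu> (norm (z::'a)) \<partial>lborel) = integral\<^sup>N lborel (\<lambda>z::'a. 0)" by (rule nn_integral_cong_AE)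
    then show ?thesis by simp
  qed
  show ?thesis by (intro exI[of _ 1]) (simp add: z)
next
  case True
  interpret levy_measure \<nu> "TYPE('a)" using nu True by unfold_locales
  note hinvT = hinv_props[OF _ h_unbounded[OF wlsc]]
  \<comment> \<open>The inverse of h at 1/t increases with t, so its value at 1/T bounds all radii
    in question; the maximum with 1 is for the extended scaling conditions.\<close>
  define R where "R = max 1 (hinv \<nu> TYPE('a) (1 / T))"
  have R1: "1 \<le> R" by (simp add: R_def)
  have al: "0 < \<alpha>h" "1 \<le> Ch" using wlsc by (auto simp: WLSC_def)
  have A: "0 < \<kappa>1 * \<Lambda>" and a: "0 < \<kappa>0 / \<Lambda>" using kap Lam by auto
  \<comment> \<open>The first-moment constant is chosen before t, J and the coefficient, as the
    required uniformity demands.\<close>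
  have "\<exists>m>0. (P = P1 \<longrightarrow> (\<forall>r>0. r \<le> R \<longrightarrow> nuint (\<lambda>z. indicator (ball 0 1 - ball 0 r) z * norm z) \<le> ennreal (m * r * h r))) \<and>
    (P = P2 \<longrightarrow> (\<forall>r>0. r \<le> R \<longrightarrow> nuint (\<lambda>z. indicator (ball 0 r) z * norm z) \<le> ennreal (m * r * h r)))"
  proof (cases P)
    case P1
    have sc: "h (2 ^ k * r) \<le> Ch * (1 / 2 ^ k) powr \<alpha>h * h r" if "0 < r" "2 ^ k * r \<le> 1" for k :: nat and r
    proof -
      have "h (2 ^ k * r) \<le> Ch * (1 / 2 ^ k) powr \<alpha>h * h (1 / 2 ^ k * (2 ^ k * r))"
      proof -
        have W: "\<And>l r. 0 < l \<Longrightarrow> l \<le> 1 \<Longrightarrow> 0 < r \<Longrightarrow> r \<le> 1 \<Longrightarrow> h r \<le> Ch * l powr \<alpha>h * h (l * r)"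
          using wlsc by (auto simp: WLSC_def)
        show ?thesis by (rule W) (use that in \<open>auto simp: one_le_power\<close>)
      qed
      then show ?thesis by simp
    qed
    show ?thesis using moment_large[OF assms(6)[OF P1] al(2)] sc P1 by auto
  next
    case P2
    then have w: "WUSC \<nu> TYPE('a) \<beta>h ch" "\<beta>h < 1" using assms(7) by auto
    then have b: "0 < \<beta>h" "0 < ch / R\<^sup>2" using R1 by (auto simp: WUSC_def)
    show ?thesis using moment_small[OF b(1) w(2) b(2)] wusc_extend[OF w(1) R1] P2 by auto
  next
    case P3
    then show ?thesis by (intro exI[of _ 1]) auto
  qed
  then obtain m where m: "0 < m"
    "\<And>r. P = P1 \<Longrightarrow> 0 < r \<Longrightarrow> r \<le> R \<Longrightarrow> nuint (\<lambda>z. indicator (ball 0 1 - ball 0 r) z * norm z) \<le> ennreal (m * r * h r)"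
    "\<And>r. P = P2 \<Longrightarrow> 0 < r \<Longrightarrow> r \<le> R \<Longrightarrow> nuint (\<lambda>z. indicator (ball 0 r) z * norm z) \<le> ennreal (m * r * h r)"
    by blast
  interpret B: levy_bounds \<nu> "TYPE('a)" R \<alpha>h "Ch * R powr \<alpha>h" "\<kappa>0 / \<Lambda>" "\<kappa>1 * \<Lambda>" "\<kappa>1 * \<Lambda> * (m + R\<^sup>2)"
  proof unfold_locales
    have "1 * 1 \<le> Ch * R powr \<alpha>h" using al R1 by (intro mult_mono ge_one_powr_ge_zero) auto
    then show "1 \<le> Ch * R powr \<alpha>h" by simp
    show "0 \<le> \<kappa>1 * \<Lambda> * (m + R\<^sup>2)" by (rule mult_nonneg_nonneg[OF less_imp_le[OF A]]) (use m in simp)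
  qed (use R1 al a A wlsc_extend[OF wlsc R1] in auto)
  define c where "c = 4 * exp 2 + 2 * exp 2 * R\<^sup>2 + conv_const + 1 + 2 * exp 2 * m"
  have c: "0 < c" unfolding c_def using conv_const(1) m by (intro add_pos_nonneg add_nonneg_pos) auto
  show ?thesis
  proof (intro exI[of _ "2 * exp 2 * B.core_const * c"] conjI allI impI)
    show "0 < 2 * exp 2 * B.core_const * c" using B.core_const c by simp
  next
    fix J :: "'a \<Rightarrow> ennreal" and Kf :: "'a \<Rightarrow> real" and t x x' y
    assume J [measurable]: "J \<in> borel_measurable borel"
      and Jb: "\<forall>x. ennreal (1 / \<Lambda>) * \<nu> (norm x) \<le> J x \<and> J x \<le> ennreal \<Lambda> * \<nu> (norm x)"
      and K [measurable]: "Kf \<in> borel_measurable borel" and Kb: "\<forall>z. \<kappa>0 \<le> Kf z \<and> Kf z \<le> \<kappa>1"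
      and sym: "P = P3 \<longrightarrow> (\<forall>z. J (- z) = J z \<and> Kf (- z) = Kf z)" and t: "0 < t" "t \<le> T"
    \<comment> \<open>With this r one has t = 1 / h(r), the parametrisation of all the estimates
      above.\<close>
    define r where "r = hinv \<nu> TYPE('a) (1 / t)"
    have r: "0 < r" "h r = 1 / t" unfolding r_def using hinvT[of "1 / t"] t by auto
    have rR: "r \<le> R"
    proof (rule ccontr)
      assume "\<not> r \<le> R"
      then have "hinv \<nu> TYPE('a) (1 / T) < r" by (simp add: R_def)
      then have "h r < h (hinv \<nu> TYPE('a) (1 / T))" using hinvT(1)[of "1 / T"] T by (intro h_strict) auto
      also have "\<dots> = 1 / T" using hinvT(2)[of "1 / T"] T by simp
      also have "\<dots> \<le> 1 / t" using t by (simp add: frac_le)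
      finally show False using r by simp
    qed
    \<comment> \<open>J may be infinite at the origin, where \<open>enn2real\<close> returns 0.
      Elsewhere \<open>nu_le_kd\<close> makes \<nu> finite, hence also J, and the conversion loses
      nothing.\<close>
    have Jeq: "ennreal (Kf z * enn2real (J z)) = ennreal (Kf z) * J z" if "z \<noteq> 0" for z
    proof -
      obtain c1 where "\<forall>s>0. \<nu> s \<le> ennreal (c1 * kd s)" using nu_le_kd by blast
      then have "\<nu> (norm z) \<le> ennreal (c1 * kd (norm z))" using that by simp
      then have "\<nu> (norm z) < \<infinity>" by (simp add: le_less_trans[OF _ ennreal_less_top])
      then have "ennreal \<Lambda> * \<nu> (norm z) < \<infinity>" by (simp add: ennreal_mult_less_top)
      then have "J z < \<infinity>" using Jb by (meson le_less_trans)
      then have "ennreal (enn2real (J z)) = J z" by simp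
      moreover have "0 \<le> Kf z" using Kb kap by (meson less_imp_le order_trans)
      ultimately show ?thesis by (simp add: ennreal_mult)
    qed
    have core: "levy_core \<nu> TYPE('a) R \<alpha>h (Ch * R powr \<alpha>h) r B.core_const (psi P J Kf)"
    proof (rule B.levy_core_psi[where m = m])
      show "0 \<le> Kf z" for z using Kb kap by (meson less_imp_le order_trans)
      fix z :: 'a assume z: "z \<noteq> 0"
      have "ennreal (Kf z) * J z \<le> ennreal \<kappa>1 * (ennreal \<Lambda> * \<nu> (norm z))"
        using Kb Jb by (intro mult_mono ennreal_leI) auto
      then show "ennreal (Kf z * enn2real (J z)) \<le> ennreal (\<kappa>1 * \<Lambda>) * \<nu> (norm z)"
        using kap Lam by (simp add: Jeq[OF z] ennreal_mult mult.assoc)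
      have "ennreal \<kappa>0 * (ennreal (1 / \<Lambda>) * \<nu> (norm z)) \<le> ennreal (Kf z) * J z"
        using Kb Jb by (intro mult_mono ennreal_leI) auto
      moreover have "ennreal (\<kappa>0 / \<Lambda>) = ennreal \<kappa>0 * ennreal (1 / \<Lambda>)" using kap Lam by (simp add: ennreal_mult[symmetric])
      ultimately show "ennreal (\<kappa>0 / \<Lambda>) * \<nu> (norm z) \<le> ennreal (Kf z * enn2real (J z))"
        by (simp add: Jeq[OF z] mult.assoc)
    qed (use r(1) rR m sym in auto)
    have rho: "rho \<nu> t w = rr r w" for w :: 'a
    proof -
      have "r powr (- real DIM('a)) = 1 / r ^ DIM('a)" using r(1) by (simp add: powr_minus_divide powr_realpow)
      moreover have "t * K (norm w) / norm w ^ DIM('a) = kd (norm w) / h r" by (simp add: kd_def r(2))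
      ultimately show ?thesis unfolding rho_def rr_def r_def[symmetric] by (simp only:)
    qed
    have th: "1 / (1 / t) = t" by simp
    have H: "(\<integral>\<^sup>+ z. ennreal \<bar>delta P J Kf (1 / h r) x y z\<bar> * \<nu> (norm z) \<partial>lborel) \<le> ennreal (2 * exp 2 * B.core_const * c * h r * rr r (y - x)) \<and>
      (\<integral>\<^sup>+ z. ennreal \<bar>delta P J Kf (1 / h r) x' y z - delta P J Kf (1 / h r) x y z\<bar> * \<nu> (norm z) \<partial>lborel)
        \<le> ennreal (2 * exp 2 * B.core_const * c * min (norm (x' - x) / r) 1 * h r * (rr r (y - x') + rr r (y - x)))"
      by (rule levy_core.heat_kernel_bounds[OF core refl less_imp_le[OF m(1)] m(2)[OF _ r(1) rR] m(3)[OF _ r(1) rR] c_def])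
    show "(\<integral>\<^sup>+ z. ennreal \<bar>delta P J Kf t x y z\<bar> * \<nu> (norm z) \<partial>lborel)
           \<le> ennreal (2 * exp 2 * B.core_const * c * (1 / t) * rho \<nu> t (y - x))"
      using conjunct1[OF H] unfolding rho r(2) th .
    show "(\<integral>\<^sup>+ z. ennreal \<bar>delta P J Kf t x' y z - delta P J Kf t x y z\<bar> * \<nu> (norm z) \<partial>lborel)
           \<le> ennreal (2 * exp 2 * B.core_const * c * min (norm (x' - x) / hinv \<nu> TYPE('a) (1 / t)) 1 * (1 / t)
                        * (rho \<nu> t (y - x') + rho \<nu> t (y - x)))"
      using conjunct2[OF H] unfolding rho r_def[symmetric] r(2) th .
  qed
qed

end
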